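(* Suppose $G$ is a groupoid acting properly on a space $X$. Then $(C_0(X),G,\mathrm{lt})$ is a proper groupoid dynamical system with respect to the dense subalgebra $C_c(X)$. Furthermore, $C_0(X)^{\mathrm{lt}}\cong C_0(G\backslash X)$.
   Context: Throughout, $G$ is a second countable locally compact Hausdorff groupoid with unit space $G^{(0)}$, range and source maps $r,s$, and (left) Haar system $\{\lambda^u\}_{u\in G^{(0)}}$; $\lambda_u$ is the image of $\lambda^u$ under inversion. $M(A)$ is the multiplier algebra of $A$. Spaces $X$ are locally compact Hausdorff and $C^*$-algebras are separable (so $C_0(X)$ is separable). If $G$ acts (on the left) on $X$ then $X$ is fibred over $G^{(0)}$ by a continuous map $r_X:X\to G^{(0)}$, and $\gamma\cdot x$ is defined when $s(\gamma)=r_X(x)$; the action is proper if $(\gamma,x)\mapsto(\gamma\cdot x,x)$, from $\{(\gamma,x):s(\gamma)=r_X(x)\}$ to $X\times X$, is a proper map. Via $r_X$, $C_0(X)$ is a $C_0(G^{(0)})$-algebra, whose associated upper semicontinuous $C^*$-bundle $\mathscr{C}$ over $G^{(0)}$ has fibres $C_0(r_X^{-1}(u))$, and $C_0(X)=\Gamma_0(G^{(0)},\mathscr{C})$ with $f(u)=f|_{r_X^{-1}(u)}$. The action $\mathrm{lt}$ is $\mathrm{lt}_\gamma:C_0(r_X^{-1}(s(\gamma)))\to C_0(r_X^{-1}(r(\gamma)))$, $\mathrm{lt}_\gamma(f)(x)=f(\gamma^{-1}\cdot x)$. Upper semicontinuous $C^*$-bundle over a locally compact Hausdorff space $Y$: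 a topological space $\mathscr{A}$ with a continuous open surjection $p:\mathscr{A}\to Y$ whose fibres $A(y)=p^{-1}(\{y\})$ are $C^*$-algebras, such that $a\mapsto\|a\|$ is upper semicontinuous; addition and multiplication are continuous on $\{(a,b):p(a)=p(b)\}$; scalar multiplication by each fixed scalar and $a\mapsto a^*$ are continuous; and if $p(a_i)\to y$, $\|a_i\|\to0$ then $a_i\to 0_y$. $\Gamma_0(Y,\mathscr{A})$ is the $C^*$-algebra of continuous sections vanishing at infinity. An element $d\in M(A)$ with $A=\Gamma_0(Y,\mathscr{A})$ has fibres $d(y)\in M(A(y))$ with $(da)(y)=d(y)a(y)$. Groupoid dynamical system $(\mathscr{A},G,\alpha)$: $\mathscr{A}$ is an upper semicontinuous $C^*$-bundle over $G^{(0)}$ with $A=\Gamma_0(G^{(0)},\mathscr{A})$ separable, and $\alpha=\{\alpha_\gamma\}_{\gamma\in G}$ is a family of $*$-isomorphisms $\alpha_\gamma:A(s(\gamma))\to A(r(\gamma))$ with $\alpha_{\gamma\eta}=\alpha_\gamma\circ\alpha_\eta$ for composable $(\gamma,\eta)$, and $(\gamma,a)\mapsto\alpha_\gamma(a)$ continuous on $\{(\gamma,a):s(\gamma)=p(a)\}$. $\bar\alpha_\gamma$ is the extension of $\alpha_\gamma$ to multiplier algebras. (One writes $(A,G,\alpha)$ for $(\mathscr{A},G,\alpha)$.) $I$-norm: $\|f\|_I=\max\{\sup_u\int\|f\|\,d\lambda_u,\ \sup_u\int\|f\|\,d\lambda^u\}$; $L^I(G)$ is the completion of $C_c(G)$ in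 this norm. Proper groupoid dynamical system: $(\mathscr{A},G,\alpha)$ is proper (with respect to $A_0$) if there is a dense $*$-subalgebra $A_0\subset A$ such that: (1) for all $a,b\in A_0$ the function ${}_E\langle a,b\rangle:\gamma\mapsto a(r(\gamma))\alpha_\gamma(b(s(\gamma))^* )$ is integrable, i.e. $\gamma\mapsto\|{}_E\langle a,b\rangle(\gamma)\|$ is in $L^I(G)$; (2) with $M(A_0)^\alpha:=\{d\in M(A): A_0d\subset A_0,\ \bar\alpha_\gamma(d(s(\gamma)))=d(r(\gamma))\text{ for all }\gamma\in G\}$, for all $a,b\in A_0$ there is a unique element $\langle a,b\rangle_D\in M(A_0)^\alpha$ such that for all $c\in A_0$, $(c\cdot\langle a,b\rangle_D)(u)=\int_G c(r(\gamma))\alpha_\gamma((a^*b)(s(\gamma)))\,d\lambda^u(\gamma)$ for $u\in G^{(0)}$. The generalized fixed point algebra is $A^\alpha=\overline{\operatorname{span}}\{\langle a,b\rangle_D:a,b\in A_0\}$, closure in $M(A)$; here $C_0(X)^{\mathrm{lt}}$ denotes this algebra for $A=C_0(X)$, $\alpha=\mathrm{lt}$, $A_0=C_c(X)$.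
   Formalization: Properness with L^I(G) the completion of C_c(G) is proved when r_X is open, and fails otherwise (e.g. X={0} over G=[0,1]); for general r_X, condition (1) uses the I-norm closure of compactly supported nonnegative upper semicontinuous functions. The isomorphism holds for all r_X. *)

theory Defs
  imports "HOL-Analysis.Analysis"
begin

section \<open>C*-algebras on carriers\<close>

text \<open>The fibres of a bundle form a family of C*-algebras indexed by the points of a space, so
  C*-algebras are records with a carrier set. Algebras need not be unital.\<close>

record 'a cstar =
  cs_carrier :: "'a set"
  cs_zero :: 'a
  cs_add :: "'a \<Rightarrow> 'a \<Rightarrow> 'a"
  cs_scale :: "complex \<Rightarrow> 'a \<Rightarrow> 'a"
  cs_mult :: "'a \<Rightarrow> 'a \<Rightarrow> 'a"
  cs_star :: "'a \<Rightarrow> 'a"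
  cs_norm :: "'a \<Rightarrow> real"

definition cs_diff :: "('a, 'm) cstar_scheme \<Rightarrow> 'a \<Rightarrow> 'a \<Rightarrow> 'a" where
  "cs_diff A a b = cs_add A a (cs_scale A (-1) b)"

text \<open>The locale \<^locale>\<open>Metric_space\<close> asks for symmetry and nonnegativity off the carrier too, hence
  the junk value.\<close>

definition cs_dist :: "('a, 'm) cstar_scheme \<Rightarrow> 'a \<Rightarrow> 'a \<Rightarrow> real" where
  "cs_dist A a b =
     (if a \<in> cs_carrier A \<and> b \<in> cs_carrier A then cs_norm A (cs_diff A a b) else 0)"

definition cs_topology :: "('a, 'm) cstar_scheme \<Rightarrow> 'a topology" where
  "cs_topology A = Metric_space.mtopology (cs_carrier A) (cs_dist A)"

definition cs_subspace :: "('a, 'm) cstar_scheme \<Rightarrow> 'a set \<Rightarrow> bool" where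
  "cs_subspace A V \<longleftrightarrow> V \<subseteq> cs_carrier A \<and> cs_zero A \<in> V \<and>
     (\<forall>a\<in>V. \<forall>b\<in>V. cs_add A a b \<in> V) \<and> (\<forall>k. \<forall>a\<in>V. cs_scale A k a \<in> V)"

definition star_subalgebra :: "('a, 'm) cstar_scheme \<Rightarrow> 'a set \<Rightarrow> bool" where
  "star_subalgebra A V \<longleftrightarrow> cs_subspace A V \<and>
     (\<forall>a\<in>V. \<forall>b\<in>V. cs_mult A a b \<in> V) \<and> (\<forall>a\<in>V. cs_star A a \<in> V)"

definition cstar_algebra :: "('a, 'm) cstar_scheme \<Rightarrow> bool" where
  "cstar_algebra A \<longleftrightarrow>
     star_subalgebra A (cs_carrier A) \<and>
     (\<forall>a\<in>cs_carrier A. \<forall>b\<in>cs_carrier A. \<forall>c\<in>cs_carrier A.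
        cs_add A (cs_add A a b) c = cs_add A a (cs_add A b c) \<and>
        cs_mult A (cs_mult A a b) c = cs_mult A a (cs_mult A b c) \<and>
        cs_mult A (cs_add A a b) c = cs_add A (cs_mult A a c) (cs_mult A b c) \<and>
        cs_mult A c (cs_add A a b) = cs_add A (cs_mult A c a) (cs_mult A c b)) \<and>
     (\<forall>a\<in>cs_carrier A. \<forall>b\<in>cs_carrier A.
        cs_add A a b = cs_add A b a \<and>
        (\<forall>k. cs_scale A k (cs_add A a b) = cs_add A (cs_scale A k a) (cs_scale A k b) \<and>
             cs_mult A (cs_scale A k a) b = cs_scale A k (cs_mult A a b) \<and>
             cs_mult A a (cs_scale A k b) = cs_scale A k (cs_mult A a b)) \<and>
        cs_star A (cs_add A a b) = cs_add A (cs_star A a) (cs_star A b) \<and>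
        cs_star A (cs_mult A a b) = cs_mult A (cs_star A b) (cs_star A a) \<and>
        cs_norm A (cs_add A a b) \<le> cs_norm A a + cs_norm A b \<and>
        cs_norm A (cs_mult A a b) \<le> cs_norm A a * cs_norm A b) \<and>
     (\<forall>a\<in>cs_carrier A.
        cs_add A (cs_zero A) a = a \<and>
        cs_add A a (cs_scale A (-1) a) = cs_zero A \<and>
        cs_scale A 1 a = a \<and>
        (\<forall>k l. cs_scale A (k + l) a = cs_add A (cs_scale A k a) (cs_scale A l a) \<and>
               cs_scale A (k * l) a = cs_scale A k (cs_scale A l a)) \<and>
        (\<forall>k. cs_star A (cs_scale A k a) = cs_scale A (cnj k) (cs_star A a) \<and>
             cs_norm A (cs_scale A k a) = cmod k * cs_norm A a) \<and>
        cs_star A (cs_star A a) = a \<and>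
        0 \<le> cs_norm A a \<and>
        (cs_norm A a = 0 \<longleftrightarrow> a = cs_zero A) \<and>
        cs_norm A (cs_mult A (cs_star A a) a) = (cs_norm A a)\<^sup>2) \<and>
     Metric_space.mcomplete (cs_carrier A) (cs_dist A)"

definition star_isomorphism ::
  "('a, 'm) cstar_scheme \<Rightarrow> ('b, 'n) cstar_scheme \<Rightarrow> ('a \<Rightarrow> 'b) \<Rightarrow> bool" where
  "star_isomorphism A B h \<longleftrightarrow>
     bij_betw h (cs_carrier A) (cs_carrier B) \<and>
     (\<forall>a\<in>cs_carrier A. \<forall>b\<in>cs_carrier A.
        h (cs_add A a b) = cs_add B (h a) (h b) \<and>
        h (cs_mult A a b) = cs_mult B (h a) (h b)) \<and>
     (\<forall>a\<in>cs_carrier A.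
        (\<forall>k. h (cs_scale A k a) = cs_scale B k (h a)) \<and>
        h (cs_star A a) = cs_star B (h a))"

definition cstar_isomorphic :: "('a, 'm) cstar_scheme \<Rightarrow> ('b, 'n) cstar_scheme \<Rightarrow> bool" where
  "cstar_isomorphic A B \<longleftrightarrow>
     cstar_algebra A \<and> cstar_algebra B \<and> (\<exists>h. star_isomorphism A B h)"

subsection \<open>Multiplier algebras\<close>

text \<open>\<open>M(A)\<close> is the algebra of double centralizers \<open>d = (L, R)\<close>, with \<open>d a = L a\<close> and
  \<open>a d = R a\<close>. Both maps are extensional on the carrier.\<close>

definition double_centralizers :: "('a, 'm) cstar_scheme \<Rightarrow> (('a \<Rightarrow> 'a) \<times> ('a \<Rightarrow> 'a)) set" where
  "double_centralizers A =
     {(L, R). (\<forall>T\<in>{L, R}.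
           T \<in> cs_carrier A \<rightarrow>\<^sub>E cs_carrier A \<and>
           (\<forall>a\<in>cs_carrier A. \<forall>b\<in>cs_carrier A. T (cs_add A a b) = cs_add A (T a) (T b)) \<and>
           (\<forall>k. \<forall>a\<in>cs_carrier A. T (cs_scale A k a) = cs_scale A k (T a)) \<and>
           (\<exists>K. \<forall>a\<in>cs_carrier A. cs_norm A (T a) \<le> K * cs_norm A a)) \<and>
        (\<forall>a\<in>cs_carrier A. \<forall>b\<in>cs_carrier A.
           L (cs_mult A a b) = cs_mult A (L a) b \<and>
           R (cs_mult A a b) = cs_mult A a (R b) \<and>
           cs_mult A a (L b) = cs_mult A (R a) b)}"

definition multiplier_algebra :: "('a, 'm) cstar_scheme \<Rightarrow> (('a \<Rightarrow> 'a) \<times> ('a \<Rightarrow> 'a)) cstar" where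
  "multiplier_algebra A =
     \<lparr> cs_carrier = double_centralizers A,
       cs_zero = (\<lambda>a\<in>cs_carrier A. cs_zero A, \<lambda>a\<in>cs_carrier A. cs_zero A),
       cs_add = (\<lambda>(L, R) (L', R').
          (\<lambda>a\<in>cs_carrier A. cs_add A (L a) (L' a), \<lambda>a\<in>cs_carrier A. cs_add A (R a) (R' a))),
       cs_scale = (\<lambda>k (L, R).
          (\<lambda>a\<in>cs_carrier A. cs_scale A k (L a), \<lambda>a\<in>cs_carrier A. cs_scale A k (R a))),
       cs_mult = (\<lambda>(L, R) (L', R').
          (\<lambda>a\<in>cs_carrier A. L (L' a), \<lambda>a\<in>cs_carrier A. R' (R a))),
       cs_star = (\<lambda>(L, R).
          (\<lambda>a\<in>cs_carrier A. cs_star A (R (cs_star A a)),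
           \<lambda>a\<in>cs_carrier A. cs_star A (L (cs_star A a)))),
       cs_norm = (\<lambda>(L, R). Sup {cs_norm A (L a) | a. a \<in> cs_carrier A \<and> cs_norm A a \<le> 1}) \<rparr>"

text \<open>The extension of a *-isomorphism \<open>h : A \<rightarrow> B\<close> to \<open>M(A) \<rightarrow> M(B)\<close>, determined by
  \<open>h(d) h(a) = h(d a)\<close>.\<close>

definition multiplier_extension ::
  "('a, 'm) cstar_scheme \<Rightarrow> ('b, 'n) cstar_scheme \<Rightarrow> ('a \<Rightarrow> 'b) \<Rightarrow>
     (('a \<Rightarrow> 'a) \<times> ('a \<Rightarrow> 'a)) \<Rightarrow> (('b \<Rightarrow> 'b) \<times> ('b \<Rightarrow> 'b))" where
  "multiplier_extension A B h d =
     (\<lambda>b\<in>cs_carrier B. h (fst d (inv_into (cs_carrier A) h b)),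
      \<lambda>b\<in>cs_carrier B. h (snd d (inv_into (cs_carrier A) h b)))"

subsection \<open>Bochner integrals with values in a carrier\<close>

text \<open>A list \<open>[(S\<^sub>1, v\<^sub>1), \<dots>, (S\<^sub>n, v\<^sub>n)]\<close> stands for the simple function that sums the \<open>v\<^sub>i\<close> times
  the indicator of \<open>S\<^sub>i\<close>.\<close>

definition simple_value :: "('a, 'm) cstar_scheme \<Rightarrow> ('w set \<times> 'a) list \<Rightarrow> 'w \<Rightarrow> 'a" where
  "simple_value A l x = foldr (\<lambda>(S, v) z. if x \<in> S then cs_add A v z else z) l (cs_zero A)"

definition simple_int :: "('a, 'm) cstar_scheme \<Rightarrow> 'w measure \<Rightarrow> ('w set \<times> 'a) list \<Rightarrow> 'a" where
  "simple_int A M l =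
     foldr (\<lambda>(S, v) z. cs_add A (cs_scale A (complex_of_real (measure M S)) v) z) l (cs_zero A)"

text \<open>The same shape as \<^const>\<open>has_bochner_integral\<close>: approximation in the mean by integrable simple
  functions. (Measurability of the differences makes the lower integral \<^const>\<open>nn_integral\<close> an
  honest integral.)\<close>

definition has_cs_integral ::
  "('a, 'm) cstar_scheme \<Rightarrow> 'w measure \<Rightarrow> ('w \<Rightarrow> 'a) \<Rightarrow> 'a \<Rightarrow> bool" where
  "has_cs_integral A M f z \<longleftrightarrow>
     f \<in> space M \<rightarrow> cs_carrier A \<and> z \<in> cs_carrier A \<and>
     (\<exists>l. (\<forall>n. \<forall>(S, v)\<in>set (l n). S \<in> sets M \<and> emeasure M S < \<infinity> \<and> v \<in> cs_carrier A) \<and>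
          (\<forall>n. (\<lambda>x. cs_dist A (f x) (simple_value A (l n) x)) \<in> borel_measurable M) \<and>
          (\<lambda>n. \<integral>\<^sup>+ x. ennreal (cs_dist A (f x) (simple_value A (l n) x)) \<partial>M) \<longlonglongrightarrow> 0 \<and>
          (\<lambda>n. cs_dist A (simple_int A M (l n)) z) \<longlonglongrightarrow> 0)"

subsection \<open>Functions on a space\<close>

text \<open>Functions on a space are extensional on its point set. In the supremum norm, \<open>0\<close> is inserted
  for the empty space, which occurs as a fibre.\<close>

definition C0 :: "'x topology \<Rightarrow> ('x \<Rightarrow> complex) cstar" where
  "C0 X =
     \<lparr> cs_carrier = {f \<in> extensional (topspace X). continuous_map X euclidean f \<and>
                      (\<forall>\<epsilon>>0. compactin X {x \<in> topspace X. \<epsilon> \<le> cmod (f x)})},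
       cs_zero = (\<lambda>x\<in>topspace X. 0),
       cs_add = (\<lambda>f g. \<lambda>x\<in>topspace X. f x + g x),
       cs_scale = (\<lambda>k f. \<lambda>x\<in>topspace X. k * f x),
       cs_mult = (\<lambda>f g. \<lambda>x\<in>topspace X. f x * g x),
       cs_star = (\<lambda>f. \<lambda>x\<in>topspace X. cnj (f x)),
       cs_norm = (\<lambda>f. Sup (insert 0 ((\<lambda>x. cmod (f x)) ` topspace X))) \<rparr>"

definition Cc :: "'x topology \<Rightarrow> ('x \<Rightarrow> complex) set" where
  "Cc X = {f \<in> extensional (topspace X). continuous_map X euclidean f \<and>
             compactin X (X closure_of {x \<in> topspace X. f x \<noteq> 0})}"

definition Usc_c :: "'x topology \<Rightarrow> ('x \<Rightarrow> complex) set" where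
  "Usc_c X = {\<lambda>x. complex_of_real (h x) | h.
     (\<forall>x\<in>topspace X. 0 \<le> h x) \<and> (\<forall>t. openin X {x \<in> topspace X. h x < t}) \<and>
     compactin X (X closure_of {x \<in> topspace X. h x \<noteq> 0})}"

section \<open>Upper semicontinuous C*-bundles\<close>

text \<open>A bundle over \<open>Y\<close> is a family of C*-algebras \<open>F y\<close> together with a topology \<open>E\<close> on their
  disjoint union \<open>Sigma (topspace Y) (\<lambda>y. cs_carrier (F y))\<close>; the bundle projection is \<^const>\<open>fst\<close>.
  The nets in the last axiom are rendered by filters on the total space.\<close>

definition usc_cstar_bundle ::
  "'y topology \<Rightarrow> ('y \<Rightarrow> 'b cstar) \<Rightarrow> ('y \<times> 'b) topology \<Rightarrow> bool" where
  "usc_cstar_bundle Y F E \<longleftrightarrow>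
     (\<forall>y\<in>topspace Y. cstar_algebra (F y)) \<and>
     topspace E = Sigma (topspace Y) (\<lambda>y. cs_carrier (F y)) \<and>
     continuous_map E Y fst \<and> open_map E Y fst \<and> fst ` topspace E = topspace Y \<and>
     (\<forall>t. openin E {(y, a) \<in> topspace E. cs_norm (F y) a < t}) \<and>
     continuous_map (subtopology (prod_topology E E) {(a, b). fst a = fst b}) E
       (\<lambda>((y, a), (_, b)). (y, cs_add (F y) a b)) \<and>
     continuous_map (subtopology (prod_topology E E) {(a, b). fst a = fst b}) E
       (\<lambda>((y, a), (_, b)). (y, cs_mult (F y) a b)) \<and>
     (\<forall>k. continuous_map E E (\<lambda>(y, a). (y, cs_scale (F y) k a))) \<and>
     continuous_map E E (\<lambda>(y, a). (y, cs_star (F y) a)) \<and>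
     (\<forall>\<Phi> y. eventually (\<lambda>e. e \<in> topspace E) \<Phi> \<and> limitin Y fst y \<Phi> \<and>
            ((\<lambda>(z, a). cs_norm (F z) a) \<longlongrightarrow> 0) \<Phi> \<longrightarrow>
            limitin E (\<lambda>e. e) (y, cs_zero (F y)) \<Phi>)"

definition Gamma0 ::
  "'y topology \<Rightarrow> ('y \<Rightarrow> 'b cstar) \<Rightarrow> ('y \<times> 'b) topology \<Rightarrow> ('y \<Rightarrow> 'b) cstar" where
  "Gamma0 Y F E =
     \<lparr> cs_carrier = {a \<in> (\<Pi>\<^sub>E y\<in>topspace Y. cs_carrier (F y)).
                      continuous_map Y E (\<lambda>y. (y, a y)) \<and>
                      (\<forall>\<epsilon>>0. compactin Y {y \<in> topspace Y. \<epsilon> \<le> cs_norm (F y) (a y)})},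
       cs_zero = (\<lambda>y\<in>topspace Y. cs_zero (F y)),
       cs_add = (\<lambda>a b. \<lambda>y\<in>topspace Y. cs_add (F y) (a y) (b y)),
       cs_scale = (\<lambda>k a. \<lambda>y\<in>topspace Y. cs_scale (F y) k (a y)),
       cs_mult = (\<lambda>a b. \<lambda>y\<in>topspace Y. cs_mult (F y) (a y) (b y)),
       cs_star = (\<lambda>a. \<lambda>y\<in>topspace Y. cs_star (F y) (a y)),
       cs_norm = (\<lambda>a. Sup (insert 0 ((\<lambda>y. cs_norm (F y) (a y)) ` topspace Y))) \<rparr>"

section \<open>Groupoids, Haar systems and actions\<close>

text \<open>The unit space is a subset of the groupoid; \<open>g_range\<close> and \<open>g_source\<close> take values in it.\<close>

record 'g groupoid =
  g_top :: "'g topology"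
  g_range :: "'g \<Rightarrow> 'g"
  g_source :: "'g \<Rightarrow> 'g"
  g_mult :: "'g \<Rightarrow> 'g \<Rightarrow> 'g"
  g_inv :: "'g \<Rightarrow> 'g"

abbreviation g_carrier :: "('g, 'm) groupoid_scheme \<Rightarrow> 'g set" where
  "g_carrier G \<equiv> topspace (g_top G)"

definition units :: "('g, 'm) groupoid_scheme \<Rightarrow> 'g set" where
  "units G = g_range G ` g_carrier G"

definition unit_space :: "('g, 'm) groupoid_scheme \<Rightarrow> 'g topology" where
  "unit_space G = subtopology (g_top G) (units G)"

definition range_fibre :: "('g, 'm) groupoid_scheme \<Rightarrow> 'g \<Rightarrow> 'g set" where
  "range_fibre G u = {\<gamma> \<in> g_carrier G. g_range G \<gamma> = u}"

definition groupoid :: "('g, 'm) groupoid_scheme \<Rightarrow> bool" where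
  "groupoid G \<longleftrightarrow>
     (\<forall>\<gamma>\<in>g_carrier G.
        g_range G \<gamma> \<in> g_carrier G \<and> g_source G \<gamma> \<in> g_carrier G \<and> g_inv G \<gamma> \<in> g_carrier G \<and>
        g_range G (g_range G \<gamma>) = g_range G \<gamma> \<and> g_source G (g_range G \<gamma>) = g_range G \<gamma> \<and>
        g_range G (g_source G \<gamma>) = g_source G \<gamma> \<and> g_source G (g_source G \<gamma>) = g_source G \<gamma> \<and>
        g_mult G (g_range G \<gamma>) \<gamma> = \<gamma> \<and> g_mult G \<gamma> (g_source G \<gamma>) = \<gamma> \<and>
        g_range G (g_inv G \<gamma>) = g_source G \<gamma> \<and> g_source G (g_inv G \<gamma>) = g_range G \<gamma> \<and>
        g_mult G \<gamma> (g_inv G \<gamma>) = g_range G \<gamma> \<and> g_mult G (g_inv G \<gamma>) \<gamma> = g_source G \<gamma>) \<and>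
     (\<forall>\<gamma>\<in>g_carrier G. \<forall>\<eta>\<in>g_carrier G. g_source G \<gamma> = g_range G \<eta> \<longrightarrow>
        g_mult G \<gamma> \<eta> \<in> g_carrier G \<and>
        g_range G (g_mult G \<gamma> \<eta>) = g_range G \<gamma> \<and> g_source G (g_mult G \<gamma> \<eta>) = g_source G \<eta> \<and>
        (\<forall>\<zeta>\<in>g_carrier G. g_source G \<eta> = g_range G \<zeta> \<longrightarrow>
           g_mult G (g_mult G \<gamma> \<eta>) \<zeta> = g_mult G \<gamma> (g_mult G \<eta> \<zeta>)))"

definition topological_groupoid :: "('g, 'm) groupoid_scheme \<Rightarrow> bool" where
  "topological_groupoid G \<longleftrightarrow>
     groupoid G \<and>
     continuous_map (subtopology (prod_topology (g_top G) (g_top G))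
                       {(\<gamma>, \<eta>). g_source G \<gamma> = g_range G \<eta>}) (g_top G)
       (\<lambda>(\<gamma>, \<eta>). g_mult G \<gamma> \<eta>) \<and>
     continuous_map (g_top G) (g_top G) (g_inv G)"

definition borel_of :: "'x topology \<Rightarrow> 'x measure" where
  "borel_of X = sigma (topspace X) {U. openin X U}"

definition measure_support :: "'x topology \<Rightarrow> 'x measure \<Rightarrow> 'x set" where
  "measure_support X M = {x \<in> topspace X. \<forall>U. openin X U \<and> x \<in> U \<longrightarrow> 0 < emeasure M U}"

text \<open>A Borel measure that is finite on compact sets is automatically regular here, because the
  groupoid is second countable and locally compact Hausdorff. In the invariance condition the
  product \<open>\<gamma>\<eta>\<close> is only meaningful on the fibre over \<open>s(\<gamma>)\<close>, hence the set integral.\<close>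

definition haar_system :: "('g, 'm) groupoid_scheme \<Rightarrow> ('g \<Rightarrow> 'g measure) \<Rightarrow> bool" where
  "haar_system G lam \<longleftrightarrow>
     (\<forall>u\<in>units G.
        space (lam u) = g_carrier G \<and> sets (lam u) = sets (borel_of (g_top G)) \<and>
        (\<forall>K. compactin (g_top G) K \<longrightarrow> emeasure (lam u) K < \<infinity>) \<and>
        measure_support (g_top G) (lam u) = range_fibre G u) \<and>
     (\<forall>f\<in>Cc (g_top G).
        continuous_map (unit_space G) euclidean (\<lambda>u. LINT \<gamma>|lam u. f \<gamma>) \<and>
        (\<forall>\<gamma>\<in>g_carrier G.
           (LINT \<eta>:range_fibre G (g_source G \<gamma>)|lam (g_source G \<gamma>). f (g_mult G \<gamma> \<eta>)) =
           (LINT \<eta>|lam (g_range G \<gamma>). f \<eta>)))"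

definition groupoid_action ::
  "('g, 'm) groupoid_scheme \<Rightarrow> 'x topology \<Rightarrow> ('x \<Rightarrow> 'g) \<Rightarrow> ('g \<Rightarrow> 'x \<Rightarrow> 'x) \<Rightarrow> bool" where
  "groupoid_action G X rX act \<longleftrightarrow>
     continuous_map X (unit_space G) rX \<and>
     continuous_map (subtopology (prod_topology (g_top G) X) {(\<gamma>, x). g_source G \<gamma> = rX x}) X
       (\<lambda>(\<gamma>, x). act \<gamma> x) \<and>
     (\<forall>x\<in>topspace X. act (rX x) x = x \<and>
        (\<forall>\<gamma>\<in>g_carrier G. g_source G \<gamma> = rX x \<longrightarrow> rX (act \<gamma> x) = g_range G \<gamma> \<and>
           (\<forall>\<eta>\<in>g_carrier G. g_source G \<eta> = g_range G \<gamma> \<longrightarrow>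
              act (g_mult G \<eta> \<gamma>) x = act \<eta> (act \<gamma> x))))"

definition proper_action ::
  "('g, 'm) groupoid_scheme \<Rightarrow> 'x topology \<Rightarrow> ('x \<Rightarrow> 'g) \<Rightarrow> ('g \<Rightarrow> 'x \<Rightarrow> 'x) \<Rightarrow> bool" where
  "proper_action G X rX act \<longleftrightarrow>
     groupoid_action G X rX act \<and>
     proper_map (subtopology (prod_topology (g_top G) X) {(\<gamma>, x). g_source G \<gamma> = rX x})
       (prod_topology X X) (\<lambda>(\<gamma>, x). (act \<gamma> x, x))"

definition orbit ::
  "('g, 'm) groupoid_scheme \<Rightarrow> ('x \<Rightarrow> 'g) \<Rightarrow> ('g \<Rightarrow> 'x \<Rightarrow> 'x) \<Rightarrow> 'x \<Rightarrow> 'x set" where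
  "orbit G rX act x = {act \<gamma> x | \<gamma>. \<gamma> \<in> g_carrier G \<and> g_source G \<gamma> = rX x}"

definition orbit_space ::
  "('g, 'm) groupoid_scheme \<Rightarrow> 'x topology \<Rightarrow> ('x \<Rightarrow> 'g) \<Rightarrow> ('g \<Rightarrow> 'x \<Rightarrow> 'x) \<Rightarrow> 'x set topology"
  where
  "orbit_space G X rX act =
     topology (\<lambda>U. U \<subseteq> orbit G rX act ` topspace X \<and>
                   openin X {x \<in> topspace X. orbit G rX act x \<in> U})"

lemma openin_orbit_space:
  "openin (orbit_space G X rX act) U \<longleftrightarrow>
     U \<subseteq> orbit G rX act ` topspace X \<and> openin X {x \<in> topspace X. orbit G rX act x \<in> U}"
proof -
  have "istopology (\<lambda>U. U \<subseteq> orbit G rX act ` topspace X \<and>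
                   openin X {x \<in> topspace X. orbit G rX act x \<in> U})"
    unfolding istopology_def
  proof (intro conjI allI impI)
    fix S T
    assume S: "S \<subseteq> orbit G rX act ` topspace X \<and> openin X {x \<in> topspace X. orbit G rX act x \<in> S}"
      and T: "T \<subseteq> orbit G rX act ` topspace X \<and> openin X {x \<in> topspace X. orbit G rX act x \<in> T}"
    show "S \<inter> T \<subseteq> orbit G rX act ` topspace X" using S by blast
    have "{x \<in> topspace X. orbit G rX act x \<in> S \<inter> T} =
        {x \<in> topspace X. orbit G rX act x \<in> S} \<inter> {x \<in> topspace X. orbit G rX act x \<in> T}" by blast
    with S T show "openin X {x \<in> topspace X. orbit G rX act x \<in> S \<inter> T}" by auto
  next
    fix \<K>
    assume K: "\<forall>K\<in>\<K>. K \<subseteq> orbit G rX act ` topspace X \<and>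
        openin X {x \<in> topspace X. orbit G rX act x \<in> K}"
    show "\<Union>\<K> \<subseteq> orbit G rX act ` topspace X" using K by blast
    have "{x \<in> topspace X. orbit G rX act x \<in> \<Union>\<K>} =
        (\<Union>K\<in>\<K>. {x \<in> topspace X. orbit G rX act x \<in> K})" by blast
    with K show "openin X {x \<in> topspace X. orbit G rX act x \<in> \<Union>\<K>}" by auto
  qed
  then show ?thesis by (simp add: orbit_space_def)
qed

subsection \<open>The I-norm\<close>

definition I_norm ::
  "('g, 'm) groupoid_scheme \<Rightarrow> ('g \<Rightarrow> 'g measure) \<Rightarrow> ('g \<Rightarrow> complex) \<Rightarrow> ennreal" where
  "I_norm G lam f =
     max (SUP u\<in>units G. \<integral>\<^sup>+ \<gamma>. ennreal (cmod (f \<gamma>)) \<partial>distr (lam u) (borel_of (g_top G)) (g_inv G))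
         (SUP u\<in>units G. \<integral>\<^sup>+ \<gamma>. ennreal (cmod (f \<gamma>)) \<partial>lam u)"

definition I_closure ::
  "('g, 'm) groupoid_scheme \<Rightarrow> ('g \<Rightarrow> 'g measure) \<Rightarrow> ('g \<Rightarrow> complex) set \<Rightarrow> ('g \<Rightarrow> complex) set" where
  "I_closure G lam T =
     {g \<in> borel_measurable (borel_of (g_top G)).
        \<forall>\<epsilon>>0. \<exists>f\<in>T. I_norm G lam (\<lambda>\<gamma>. g \<gamma> - f \<gamma>) < \<epsilon>}"

text \<open>\<open>L_I\<close> is the completion of \<open>C\<^sub>c(G)\<close>, realised by functions on \<open>G\<close>. The norm function of a
  continuous compactly supported section of an upper semicontinuous bundle need not belong to it
  (if \<open>G\<close> consists of units only and carries the point masses, then \<open>L_I\<close> is \<open>C\<^sub>0(G)\<close>);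
  \<open>L_I_usc\<close>, which contains every nonnegative function in \<open>L_I\<close>, does contain these norm functions.\<close>

definition L_I where
  "L_I G lam = I_closure G lam (Cc (g_top G))"

definition L_I_usc where
  "L_I_usc G lam = I_closure G lam (Usc_c (g_top G))"

section \<open>Groupoid dynamical systems\<close>

text \<open>The identification of \<open>A\<close> with the algebra of \<open>C\<^sub>0\<close>-sections of the bundle is carried by
  \<open>sys_eval\<close>: the value at \<open>u\<close> of the section given by \<open>a\<close> is \<open>sys_eval S a u\<close>.\<close>

record ('g, 'a, 'b) gsystem =
  sys_alg :: "'a cstar"
  sys_fibre :: "'g \<Rightarrow> 'b cstar"
  sys_total :: "('g \<times> 'b) topology"
  sys_eval :: "'a \<Rightarrow> 'g \<Rightarrow> 'b"
  sys_act :: "'g \<Rightarrow> 'b \<Rightarrow> 'b"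

definition groupoid_dynamical_system ::
  "('g, 'm) groupoid_scheme \<Rightarrow> ('g, 'a, 'b, 'n) gsystem_scheme \<Rightarrow> bool" where
  "groupoid_dynamical_system G S \<longleftrightarrow>
     usc_cstar_bundle (unit_space G) (sys_fibre S) (sys_total S) \<and>
     cstar_algebra (sys_alg S) \<and>
     star_isomorphism (sys_alg S) (Gamma0 (unit_space G) (sys_fibre S) (sys_total S)) (sys_eval S) \<and>
     separable_space (cs_topology (sys_alg S)) \<and>
     (\<forall>\<gamma>\<in>g_carrier G.
        star_isomorphism (sys_fibre S (g_source G \<gamma>)) (sys_fibre S (g_range G \<gamma>)) (sys_act S \<gamma>)) \<and>
     (\<forall>\<gamma>\<in>g_carrier G. \<forall>\<eta>\<in>g_carrier G. g_source G \<gamma> = g_range G \<eta> \<longrightarrow>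
        (\<forall>a\<in>cs_carrier (sys_fibre S (g_source G \<eta>)).
           sys_act S (g_mult G \<gamma> \<eta>) a = sys_act S \<gamma> (sys_act S \<eta> a))) \<and>
     continuous_map
       (subtopology (prod_topology (g_top G) (sys_total S)) {(\<gamma>, (y, a)). g_source G \<gamma> = y})
       (sys_total S) (\<lambda>(\<gamma>, (y, a)). (g_range G \<gamma>, sys_act S \<gamma> a))"

definition multiplier_fibre ::
  "('g, 'a, 'b, 'n) gsystem_scheme \<Rightarrow> (('a \<Rightarrow> 'a) \<times> ('a \<Rightarrow> 'a)) \<Rightarrow> 'g \<Rightarrow> ('b \<Rightarrow> 'b) \<times> ('b \<Rightarrow> 'b)"
  where
  "multiplier_fibre S d u =
     (THE m. m \<in> double_centralizers (sys_fibre S u) \<and>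
        (\<forall>a\<in>cs_carrier (sys_alg S). sys_eval S (fst d a) u = fst m (sys_eval S a u)))"

definition fixed_multipliers ::
  "('g, 'm) groupoid_scheme \<Rightarrow> ('g, 'a, 'b, 'n) gsystem_scheme \<Rightarrow> 'a set \<Rightarrow>
     (('a \<Rightarrow> 'a) \<times> ('a \<Rightarrow> 'a)) set" where
  "fixed_multipliers G S A0 =
     {d \<in> cs_carrier (multiplier_algebra (sys_alg S)).
        (\<forall>a\<in>A0. snd d a \<in> A0) \<and>
        (\<forall>\<gamma>\<in>g_carrier G.
           multiplier_extension (sys_fibre S (g_source G \<gamma>)) (sys_fibre S (g_range G \<gamma>)) (sys_act S \<gamma>)
             (multiplier_fibre S d (g_source G \<gamma>)) = multiplier_fibre S d (g_range G \<gamma>))}"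

definition E_inner ::
  "('g, 'm) groupoid_scheme \<Rightarrow> ('g, 'a, 'b, 'n) gsystem_scheme \<Rightarrow> 'a \<Rightarrow> 'a \<Rightarrow> 'g \<Rightarrow> 'b" where
  "E_inner G S a b \<gamma> =
     cs_mult (sys_fibre S (g_range G \<gamma>)) (sys_eval S a (g_range G \<gamma>))
       (sys_act S \<gamma> (cs_star (sys_fibre S (g_source G \<gamma>)) (sys_eval S b (g_source G \<gamma>))))"

definition is_D_inner ::
  "('g, 'm) groupoid_scheme \<Rightarrow> ('g \<Rightarrow> 'g measure) \<Rightarrow> ('g, 'a, 'b, 'n) gsystem_scheme \<Rightarrow> 'a set \<Rightarrow>
     'a \<Rightarrow> 'a \<Rightarrow> ('a \<Rightarrow> 'a) \<times> ('a \<Rightarrow> 'a) \<Rightarrow> bool" where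
  "is_D_inner G lam S A0 a b d \<longleftrightarrow>
     d \<in> fixed_multipliers G S A0 \<and>
     (\<forall>c\<in>A0. \<forall>u\<in>units G.
        has_cs_integral (sys_fibre S u) (restrict_space (lam u) (range_fibre G u))
          (\<lambda>\<gamma>. cs_mult (sys_fibre S u) (sys_eval S c (g_range G \<gamma>))
                 (sys_act S \<gamma>
                   (sys_eval S (cs_mult (sys_alg S) (cs_star (sys_alg S) a) b) (g_source G \<gamma>))))
          (sys_eval S (snd d c) u))"

definition D_inner ::
  "('g, 'm) groupoid_scheme \<Rightarrow> ('g \<Rightarrow> 'g measure) \<Rightarrow> ('g, 'a, 'b, 'n) gsystem_scheme \<Rightarrow> 'a set \<Rightarrow>
     'a \<Rightarrow> 'a \<Rightarrow> ('a \<Rightarrow> 'a) \<times> ('a \<Rightarrow> 'a)" where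
  "D_inner G lam S A0 a b = (THE d. is_D_inner G lam S A0 a b d)"

text \<open>The parameter \<open>LI\<close> is the space of functions in which the norms of the kernels
  \<^const>\<open>E_inner\<close> are required to lie.\<close>

definition proper_system_with ::
  "('g \<Rightarrow> complex) set \<Rightarrow> ('g, 'm) groupoid_scheme \<Rightarrow> ('g \<Rightarrow> 'g measure) \<Rightarrow>
     ('g, 'a, 'b, 'n) gsystem_scheme \<Rightarrow> 'a set \<Rightarrow> bool" where
  "proper_system_with LI G lam S A0 \<longleftrightarrow>
     groupoid_dynamical_system G S \<and>
     star_subalgebra (sys_alg S) A0 \<and>
     cs_topology (sys_alg S) closure_of A0 = cs_carrier (sys_alg S) \<and>
     (\<forall>a\<in>A0. \<forall>b\<in>A0.
        (\<lambda>\<gamma>. complex_of_real (cs_norm (sys_fibre S (g_range G \<gamma>)) (E_inner G S a b \<gamma>))) \<in> LI) \<and>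
     (\<forall>a\<in>A0. \<forall>b\<in>A0. \<exists>!d. is_D_inner G lam S A0 a b d)"

definition proper_groupoid_dynamical_system where
  "proper_groupoid_dynamical_system G lam S A0 \<longleftrightarrow> proper_system_with (L_I G lam) G lam S A0"

definition proper_groupoid_dynamical_system_usc where
  "proper_groupoid_dynamical_system_usc G lam S A0 \<longleftrightarrow>
     proper_system_with (L_I_usc G lam) G lam S A0"

definition generalized_fixed_point_algebra ::
  "('g, 'm) groupoid_scheme \<Rightarrow> ('g \<Rightarrow> 'g measure) \<Rightarrow> ('g, 'a, 'b, 'n) gsystem_scheme \<Rightarrow> 'a set \<Rightarrow>
     (('a \<Rightarrow> 'a) \<times> ('a \<Rightarrow> 'a)) cstar" where
  "generalized_fixed_point_algebra G lam S A0 =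
     (let M = multiplier_algebra (sys_alg S) in
      M \<lparr> cs_carrier :=
        cs_topology M closure_of (cs_subspace M hull {D_inner G lam S A0 a b | a b. a \<in> A0 \<and> b \<in> A0}) \<rparr>)"

section \<open>The system of a groupoid acting on a space\<close>

definition fibre_space :: "'x topology \<Rightarrow> ('x \<Rightarrow> 'g) \<Rightarrow> 'g \<Rightarrow> 'x topology" where
  "fibre_space X rX u = subtopology X {x \<in> topspace X. rX x = u}"

text \<open>The topology of the bundle associated with the \<open>C\<^sub>0(G\<^sup>(\<^sup>0\<^sup>))\<close>-algebra \<open>C\<^sub>0(X)\<close> is generated by
  the \<open>\<epsilon>\<close>-tubes around the sections \<open>u \<mapsto> f|r\<^sub>X\<^sup>-\<^sup>1(u)\<close> with \<open>f \<in> C\<^sub>0(X)\<close>, over open sets \<open>U\<close>.\<close>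

definition C0_bundle_topology ::
  "'g topology \<Rightarrow> 'x topology \<Rightarrow> ('x \<Rightarrow> 'g) \<Rightarrow> ('g \<times> ('x \<Rightarrow> complex)) topology" where
  "C0_bundle_topology Y X rX =
     topology_generated_by
       {{(u, a). u \<in> U \<and> a \<in> cs_carrier (C0 (fibre_space X rX u)) \<and>
           cs_dist (C0 (fibre_space X rX u)) (restrict f (topspace (fibre_space X rX u))) a < \<epsilon>}
        | f U \<epsilon>. f \<in> cs_carrier (C0 X) \<and> openin Y U \<and> 0 < \<epsilon>}"

definition C0_system ::
  "('g, 'm) groupoid_scheme \<Rightarrow> 'x topology \<Rightarrow> ('x \<Rightarrow> 'g) \<Rightarrow> ('g \<Rightarrow> 'x \<Rightarrow> 'x) \<Rightarrow>
     ('g, 'x \<Rightarrow> complex, 'x \<Rightarrow> complex) gsystem" where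
  "C0_system G X rX act =
     \<lparr> sys_alg = C0 X,
       sys_fibre = (\<lambda>u. C0 (fibre_space X rX u)),
       sys_total = C0_bundle_topology (unit_space G) X rX,
       sys_eval = (\<lambda>f. \<lambda>u\<in>units G. restrict f (topspace (fibre_space X rX u))),
       sys_act = (\<lambda>\<gamma> f. \<lambda>x\<in>topspace (fibre_space X rX (g_range G \<gamma>)). f (act (g_inv G \<gamma>) x)) \<rparr>"

end

theory Submission
  imports Defs
begin

text \<open>Write \<open>\<Psi>(\<phi>)(x) = \<integral> \<phi>(\<gamma>\<^sup>-\<^sup>1x) d\<lambda>\<^sup>r\<^sup>(\<^sup>x\<^sup>)(\<gamma>)\<close> for \<open>\<phi> \<in> C\<^sub>c(X)\<close>. Since the action is proper, only a compact
  set of \<open>\<gamma>\<close> matters while \<open>x\<close> stays in a compact set; hence \<open>\<Psi>(\<phi>)\<close> is continuous, and invariance of the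
  Haar system makes it constant on orbits. The inner product of \<open>a\<close> and \<open>b\<close> is multiplication by
  \<open>\<Psi>(a\<^sup>*b)\<close>; it is the only candidate because Bochner integrals in \<open>C\<^sub>0\<close> of a fibre can be evaluated pointwise
  and \<open>C\<^sub>c(X)\<close> is dense. Pulling functions back along the orbit map embeds \<open>C\<^sub>0(G \ X)\<close> isometrically into the
  multiplier algebra. The image is closed, contains all \<open>\<Psi>(a\<^sup>*b)\<close>, and each compactly supported \<open>f\<close> is hit,
  as \<open>f = \<Psi>(g \<cdot> (g f / \<Psi>(g\<^sup>2)))\<close> for a suitable \<open>g \<ge> 0\<close> in \<open>C\<^sub>c(X)\<close>.\<close>

section \<open>The algebra of functions vanishing at infinity\<close>

text \<open>Uniform control over a whole fibre is always obtained in the same way. To show that an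
  estimate |D(\<gamma>, x)| < \<epsilon>, valid over a given point of \<open>G\<close> or
  \<open>X\<close>, persists over nearby points, the pairs violating it are confined to a compact
  subset of a fibred product; its projection is compact, hence closed in a Hausdorff space, and
  misses the given point. Continuity of the action on the bundle, upper semicontinuity of the kernel
  norms, measurability of the integrands and continuity of \<Psi> all rest on this. Projections of
  compact sets control norms from above only. A bound from below needs projections of open sets,
  that is, openness of r_X, and this is why the integrability condition appears in two forms. The
  other recurrent tool is Tietze's theorem: an element of a fibre extends to a function in C_0(X),
  and a function on a closed range fibre to one in C_c(G), to which the axioms of a Haar system
  apply. The orbit space is accessible only through the quotient map, so compactness there comes
  from images of compact subsets of \<open>X\<close>.\<close>

lemma continuous_map_euclidean_tendsto:
  "continuous_map X euclidean f \<longleftrightarrow> (\<forall>x\<in>topspace X. (f \<longlongrightarrow> f x) (atin X x))"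
  by (simp add: continuous_map_atin limitin_canonical_iff)

lemma continuous_map_mult:
  fixes f g :: "'x \<Rightarrow> 'a::real_normed_algebra"
  assumes "continuous_map X euclidean f" and "continuous_map X euclidean g"
  shows "continuous_map X euclidean (\<lambda>x. f x * g x)"
  using assms by (auto simp: continuous_map_euclidean_tendsto intro!: tendsto_mult)

lemma continuous_map_on_topspace_cong:
  assumes "\<And>x. x \<in> topspace X \<Longrightarrow> f x = g x"
  shows "continuous_map X Y f \<longleftrightarrow> continuous_map X Y g"
  using assms by (metis continuous_map_eq)

lemma continuous_map_restrict:
  "continuous_map X Y (restrict f (topspace X)) \<longleftrightarrow> continuous_map X Y f"
  by (rule continuous_map_on_topspace_cong) simp

lemma closedin_continuous_cmod_ge:
  assumes "continuous_map X euclidean f"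
  shows "closedin X {x \<in> topspace X. (t::real) \<le> norm (f x)}"
proof -
  have "closedin X {x \<in> topspace X. norm (f x) \<in> {t..}}"
    by (rule closedin_continuous_map_preimage [of _ euclidean])
       (use assms continuous_map_norm in auto)
  then show ?thesis by simp
qed

lemma C0_sel [simp]:
  "cs_zero (C0 X) = (\<lambda>x\<in>topspace X. 0)"
  "cs_add (C0 X) f g = (\<lambda>x\<in>topspace X. f x + g x)"
  "cs_scale (C0 X) k f = (\<lambda>x\<in>topspace X. k * f x)"
  "cs_mult (C0 X) f g = (\<lambda>x\<in>topspace X. f x * g x)"
  "cs_star (C0 X) f = (\<lambda>x\<in>topspace X. cnj (f x))"
  by (simp_all add: C0_def)

lemma C0_norm_def: "cs_norm (C0 X) f = Sup (insert 0 ((\<lambda>x. cmod (f x)) ` topspace X))"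
  by (simp add: C0_def)

lemma C0_iff:
  "f \<in> cs_carrier (C0 X) \<longleftrightarrow> f \<in> extensional (topspace X) \<and> continuous_map X euclidean f \<and>
     (\<forall>\<epsilon>>0. compactin X {x \<in> topspace X. \<epsilon> \<le> cmod (f x)})"
  by (simp add: C0_def)

lemma C0_continuous: "f \<in> cs_carrier (C0 X) \<Longrightarrow> continuous_map X euclidean f"
  and C0_extensional: "f \<in> cs_carrier (C0 X) \<Longrightarrow> f \<in> extensional (topspace X)"
  and C0_compactin: "f \<in> cs_carrier (C0 X) \<Longrightarrow> 0 < \<epsilon> \<Longrightarrow> compactin X {x \<in> topspace X. \<epsilon> \<le> cmod (f x)}"
  by (auto simp: C0_iff)

lemma C0_restrictI:
  assumes "continuous_map X euclidean f"
    and "\<And>\<epsilon>. 0 < \<epsilon> \<Longrightarrow> \<exists>K. compactin X K \<and> (\<forall>x\<in>topspace X. \<epsilon> \<le> cmod (f x) \<longrightarrow> x \<in> K)"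
  shows "restrict f (topspace X) \<in> cs_carrier (C0 X)"
  unfolding C0_iff
proof (intro conjI allI impI)
  show "continuous_map X euclidean (restrict f (topspace X))"
    using assms(1) by (simp add: continuous_map_restrict)
  fix \<epsilon> :: real assume "0 < \<epsilon>"
  then obtain K where "compactin X K" "\<forall>x\<in>topspace X. \<epsilon> \<le> cmod (f x) \<longrightarrow> x \<in> K"
    using assms(2) by blast
  moreover have "{x \<in> topspace X. \<epsilon> \<le> cmod (restrict f (topspace X) x)} =
      {x \<in> topspace X. \<epsilon> \<le> cmod (f x)}" by auto
  ultimately show "compactin X {x \<in> topspace X. \<epsilon> \<le> cmod (restrict f (topspace X) x)}"
    using closed_compactin [OF _ _ closedin_continuous_cmod_ge [OF assms(1)], of K] by (simp add: subset_iff)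
qed simp

text \<open>A single nonzero value \<open>f z\<close> already reduces the supremum to the compact
  set where |f| is at least |f z|. That the supremum is a maximum is what turns strict norm
  inequalities into pointwise ones in \<open>C0_norm_less_iff\<close>.\<close>

lemma C0_norm_attained:
  assumes f: "f \<in> cs_carrier (C0 X)" and "topspace X \<noteq> {}"
  shows "\<exists>x\<in>topspace X. \<forall>y\<in>topspace X. cmod (f y) \<le> cmod (f x)"
proof (cases "\<exists>z\<in>topspace X. f z \<noteq> 0")
  case True
  then obtain z where z: "z \<in> topspace X" "f z \<noteq> 0" by blast
  let ?K = "{x \<in> topspace X. cmod (f z) \<le> cmod (f x)}"
  have "compactin X ?K" using z C0_compactin [OF f, of "cmod (f z)"] by simp
  moreover have "continuous_map X euclidean (\<lambda>x. cmod (f x))"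
    using C0_continuous [OF f] by (rule continuous_map_norm)
  ultimately have "compact ((\<lambda>x. cmod (f x)) ` ?K)"
    using image_compactin compactin_euclidean_iff by blast
  moreover have "(\<lambda>x. cmod (f x)) ` ?K \<noteq> {}" using z by auto
  ultimately obtain m where m: "m \<in> (\<lambda>x. cmod (f x)) ` ?K" "\<forall>t\<in>(\<lambda>x. cmod (f x)) ` ?K. t \<le> m"
    using compact_attains_sup [of "(\<lambda>x. cmod (f x)) ` ?K"] by blast
  then obtain x where x: "x \<in> topspace X" "cmod (f z) \<le> cmod (f x)" "m = cmod (f x)" by blast
  have "cmod (f y) \<le> cmod (f x)" if "y \<in> topspace X" for y
    using m(2) x that by (cases "cmod (f z) \<le> cmod (f y)") auto
  then show ?thesis using x by blast
next
  case False
  then show ?thesis using assms(2) by (metis all_not_in_conv norm_zero order_refl)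
qed

lemma C0_bdd_above:
  assumes "f \<in> cs_carrier (C0 X)"
  shows "bdd_above (insert 0 ((\<lambda>x. cmod (f x)) ` topspace X))"
proof (cases "topspace X = {}")
  case False
  then obtain x where "\<forall>y\<in>topspace X. cmod (f y) \<le> cmod (f x)"
    using C0_norm_attained [OF assms] by blast
  then show ?thesis by (intro bdd_aboveI [of _ "cmod (f x)"]) auto
qed simp

lemma C0_norm_upper: "f \<in> cs_carrier (C0 X) \<Longrightarrow> x \<in> topspace X \<Longrightarrow> cmod (f x) \<le> cs_norm (C0 X) f"
  unfolding C0_norm_def by (intro cSup_upper C0_bdd_above) auto

lemma C0_norm_nonneg: "f \<in> cs_carrier (C0 X) \<Longrightarrow> 0 \<le> cs_norm (C0 X) f"
  unfolding C0_norm_def by (intro cSup_upper C0_bdd_above) auto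

text \<open>The hypothesis on the sign of \<open>B\<close> accounts for the \<open>0\<close>
  inserted into the supremum, which is the whole set when the space is empty.\<close>

lemma C0_norm_le: "0 \<le> B \<Longrightarrow> (\<And>x. x \<in> topspace X \<Longrightarrow> cmod (f x) \<le> B) \<Longrightarrow> cs_norm (C0 X) f \<le> B"
  unfolding C0_norm_def by (intro cSup_least) auto

lemma C0_norm_le_iff:
  assumes "f \<in> cs_carrier (C0 X)" "0 \<le> B"
  shows "cs_norm (C0 X) f \<le> B \<longleftrightarrow> (\<forall>x\<in>topspace X. cmod (f x) \<le> B)"
proof
  assume "cs_norm (C0 X) f \<le> B"
  then show "\<forall>x\<in>topspace X. cmod (f x) \<le> B"
    by (auto intro: order_trans [OF C0_norm_upper [OF assms(1)]])
qed (simp add: C0_norm_le assms)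

lemma C0_norm_less_iff:
  assumes f: "f \<in> cs_carrier (C0 X)" and B: "0 < B"
  shows "cs_norm (C0 X) f < B \<longleftrightarrow> (\<forall>x\<in>topspace X. cmod (f x) < B)"
proof
  assume "\<forall>x\<in>topspace X. cmod (f x) < B"
  then have less: "cmod (f x) < B" if "x \<in> topspace X" for x using that by blast
  show "cs_norm (C0 X) f < B"
  proof (cases "topspace X = {}")
    case True
    then show ?thesis using B by (simp add: C0_norm_def)
  next
    case False
    then obtain x where x: "x \<in> topspace X" "\<forall>y\<in>topspace X. cmod (f y) \<le> cmod (f x)"
      using C0_norm_attained [OF f] by blast
    then have "cs_norm (C0 X) f \<le> cmod (f x)" by (intro C0_norm_le) auto
    also have "\<dots> < B" using less x by blast
    finally show ?thesis .
  qed
next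
  assume "cs_norm (C0 X) f < B"
  then show "\<forall>x\<in>topspace X. cmod (f x) < B"
    by (auto intro: order_le_less_trans [OF C0_norm_upper [OF f]])
qed

lemma C0_norm_cong: "(\<And>x. x \<in> topspace X \<Longrightarrow> cmod (f x) = cmod (g x)) \<Longrightarrow> cs_norm (C0 X) f = cs_norm (C0 X) g"
  unfolding C0_norm_def by (intro arg_cong [where f = Sup] arg_cong [where f = "insert 0"] image_cong) auto

lemma C0_zero_closed: "(\<lambda>x\<in>topspace X. 0) \<in> cs_carrier (C0 X)"
  by (rule C0_restrictI) (auto intro: exI [of _ "{}"])

lemma C0_add_closed:
  assumes "f \<in> cs_carrier (C0 X)" "g \<in> cs_carrier (C0 X)"
  shows "(\<lambda>x\<in>topspace X. f x + g x) \<in> cs_carrier (C0 X)"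
proof (rule C0_restrictI)
  show "continuous_map X euclidean (\<lambda>x. f x + g x)"
    using assms by (intro continuous_map_add C0_continuous)
  fix \<epsilon> :: real assume e: "0 < \<epsilon>"
  let ?K = "{x \<in> topspace X. \<epsilon>/2 \<le> cmod (f x)} \<union> {x \<in> topspace X. \<epsilon>/2 \<le> cmod (g x)}"
  have "compactin X ?K" using assms e by (intro compactin_Un C0_compactin) auto
  moreover have "\<epsilon>/2 \<le> cmod (f x) \<or> \<epsilon>/2 \<le> cmod (g x)" if "\<epsilon> \<le> cmod (f x + g x)" for x
    using norm_triangle_ineq [of "f x" "g x"] that by linarith
  ultimately show "\<exists>K. compactin X K \<and> (\<forall>x\<in>topspace X. \<epsilon> \<le> cmod (f x + g x) \<longrightarrow> x \<in> K)"
    by (intro exI [of _ ?K]) blast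
qed

text \<open>Products, scalar multiples and the multipliers given by bounded functions all reduce to
  this case: the bounded factor only rescales the threshold at which |f| has to be tested.\<close>

lemma C0_mult_bounded_closed:
  assumes g: "continuous_map X euclidean g" and B: "\<And>x. x \<in> topspace X \<Longrightarrow> cmod (g x) \<le> B"
    and f: "f \<in> cs_carrier (C0 X)"
  shows "(\<lambda>x\<in>topspace X. g x * f x) \<in> cs_carrier (C0 X)"
proof (rule C0_restrictI)
  show "continuous_map X euclidean (\<lambda>x. g x * f x)"
    using g C0_continuous [OF f] by (rule continuous_map_mult)
  fix \<epsilon> :: real assume e: "0 < \<epsilon>"
  \<comment> \<open>The divisor is positive for every \<open>B\<close>; on an empty space the bound
    may even be negative.\<close>
  have "\<epsilon> / (\<bar>B\<bar> + 1) \<le> cmod (f x)" if "x \<in> topspace X" "\<epsilon> \<le> cmod (g x * f x)" for x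
  proof -
    have "\<epsilon> \<le> cmod (g x) * cmod (f x)" using that by (simp add: norm_mult)
    also have "\<dots> \<le> (\<bar>B\<bar> + 1) * cmod (f x)" using B [OF that(1)] by (intro mult_right_mono) auto
    finally show ?thesis by (simp add: field_simps)
  qed
  then show "\<exists>K. compactin X K \<and> (\<forall>x\<in>topspace X. \<epsilon> \<le> cmod (g x * f x) \<longrightarrow> x \<in> K)"
    using C0_compactin [OF f, of "\<epsilon> / (\<bar>B\<bar> + 1)"] e
    by (intro exI [of _ "{x \<in> topspace X. \<epsilon> / (\<bar>B\<bar> + 1) \<le> cmod (f x)}"]) auto
qed

lemma C0_mult_closed:
  assumes "f \<in> cs_carrier (C0 X)" "g \<in> cs_carrier (C0 X)"
  shows "(\<lambda>x\<in>topspace X. f x * g x) \<in> cs_carrier (C0 X)"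
  by (rule C0_mult_bounded_closed [OF C0_continuous C0_norm_upper]) (use assms in auto)

lemma C0_scale_closed:
  "f \<in> cs_carrier (C0 X) \<Longrightarrow> (\<lambda>x\<in>topspace X. k * f x) \<in> cs_carrier (C0 X)"
  by (rule C0_mult_bounded_closed [of X "\<lambda>x. k" "cmod k"]) auto

lemma C0_star_closed:
  assumes "f \<in> cs_carrier (C0 X)"
  shows "(\<lambda>x\<in>topspace X. cnj (f x)) \<in> cs_carrier (C0 X)"
proof (rule C0_restrictI)
  show "continuous_map X euclidean (\<lambda>x. cnj (f x))"
    using C0_continuous [OF assms] by (auto simp: continuous_map_euclidean_tendsto intro!: tendsto_cnj)
  show "\<exists>K. compactin X K \<and> (\<forall>x\<in>topspace X. \<epsilon> \<le> cmod (cnj (f x)) \<longrightarrow> x \<in> K)" if "0 < \<epsilon>" for \<epsilon>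
    using C0_compactin [OF assms that] by (intro exI [of _ "{x \<in> topspace X. \<epsilon> \<le> cmod (f x)}"]) auto
qed

lemmas C0_closed = C0_zero_closed C0_add_closed C0_mult_closed C0_scale_closed C0_star_closed

lemma C0_diff_closed:
  assumes "f \<in> cs_carrier (C0 X)" "g \<in> cs_carrier (C0 X)"
  shows "(\<lambda>x\<in>topspace X. f x - g x) \<in> cs_carrier (C0 X)"
proof -
  have "(\<lambda>x\<in>topspace X. f x - g x) = (\<lambda>x\<in>topspace X. f x + (\<lambda>x\<in>topspace X. -1 * g x) x)" by auto
  then show ?thesis using assms by (metis C0_add_closed C0_scale_closed)
qed

lemma C0_eqI:
  "f \<in> cs_carrier (C0 X) \<Longrightarrow> g \<in> cs_carrier (C0 X) \<Longrightarrow> (\<And>x. x \<in> topspace X \<Longrightarrow> f x = g x) \<Longrightarrow> f = g"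
  using C0_extensional extensionalityI by blast

lemma C0_norm_eq_0_iff:
  assumes "f \<in> cs_carrier (C0 X)"
  shows "cs_norm (C0 X) f = 0 \<longleftrightarrow> f = (\<lambda>x\<in>topspace X. 0)"
proof -
  have "cs_norm (C0 X) f \<le> 0 \<longleftrightarrow> (\<forall>x\<in>topspace X. f x = 0)"
    using C0_norm_le_iff [OF assms, of 0] by simp
  also have "\<dots> \<longleftrightarrow> f = (\<lambda>x\<in>topspace X. 0)"
    using C0_eqI [OF assms C0_zero_closed] by auto
  finally show ?thesis using C0_norm_nonneg [OF assms] by linarith
qed

lemma C0_dist:
  assumes "f \<in> cs_carrier (C0 X)" "g \<in> cs_carrier (C0 X)"
  shows "cs_dist (C0 X) f g = cs_norm (C0 X) (\<lambda>x\<in>topspace X. f x - g x)"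
  using assms by (auto simp: cs_dist_def cs_diff_def intro!: C0_norm_cong)

lemma C0_dist_less_iff:
  assumes "f \<in> cs_carrier (C0 X)" "g \<in> cs_carrier (C0 X)" "0 < B"
  shows "cs_dist (C0 X) f g < B \<longleftrightarrow> (\<forall>x\<in>topspace X. cmod (f x - g x) < B)"
  using assms by (simp add: C0_dist C0_norm_less_iff C0_diff_closed)

lemma C0_dist_le_iff:
  assumes "f \<in> cs_carrier (C0 X)" "g \<in> cs_carrier (C0 X)" "0 \<le> B"
  shows "cs_dist (C0 X) f g \<le> B \<longleftrightarrow> (\<forall>x\<in>topspace X. cmod (f x - g x) \<le> B)"
  using assms by (simp add: C0_dist C0_norm_le_iff C0_diff_closed)

lemma C0_dist_upper:
  assumes "f \<in> cs_carrier (C0 X)" "g \<in> cs_carrier (C0 X)" "x \<in> topspace X"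
  shows "cmod (f x - g x) \<le> cs_dist (C0 X) f g"
  using assms C0_norm_upper [OF C0_diff_closed] by (force simp: C0_dist)

lemma C0_dist_nonneg: "0 \<le> cs_dist (C0 X) f g"
  by (cases "f \<in> cs_carrier (C0 X) \<and> g \<in> cs_carrier (C0 X)")
     (simp add: C0_dist C0_norm_nonneg C0_diff_closed, auto simp: cs_dist_def)

lemma Metric_space_C0: "Metric_space (cs_carrier (C0 X)) (cs_dist (C0 X))"
proof
  fix f g h
  show "0 \<le> cs_dist (C0 X) f g" by (rule C0_dist_nonneg)
  show "cs_dist (C0 X) f g = cs_dist (C0 X) g f"
  proof (cases "f \<in> cs_carrier (C0 X) \<and> g \<in> cs_carrier (C0 X)")
    case True then show ?thesis
      by (auto simp: C0_dist norm_minus_commute intro: C0_norm_cong)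
  qed (auto simp: cs_dist_def)
  assume fg: "f \<in> cs_carrier (C0 X)" "g \<in> cs_carrier (C0 X)"
  have "cs_dist (C0 X) f g \<le> 0 \<longleftrightarrow> f = g"
    using C0_eqI [OF fg] by (auto simp: C0_dist_le_iff fg)
  then show "cs_dist (C0 X) f g = 0 \<longleftrightarrow> f = g"
    using C0_dist_nonneg by (metis order_antisym order_refl)
  assume h: "h \<in> cs_carrier (C0 X)"
  show "cs_dist (C0 X) f h \<le> cs_dist (C0 X) f g + cs_dist (C0 X) g h"
  proof (subst C0_dist_le_iff [OF fg(1) h], goal_cases)
    case 2
    show ?case
    proof
      fix x assume x: "x \<in> topspace X"
      have "cmod (f x - h x) \<le> cmod (f x - g x) + cmod (g x - h x)"
        using norm_triangle_ineq [of "f x - g x" "g x - h x"] by simp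
      then show "cmod (f x - h x) \<le> cs_dist (C0 X) f g + cs_dist (C0 X) g h"
        using C0_dist_upper [OF fg x] C0_dist_upper [OF fg(2) h x] by linarith
    qed
  qed (simp add: C0_dist_nonneg)
qed

text \<open>Only one good approximant per \<epsilon> is asked for. Three errors of \<epsilon>/3 give
  continuity; an approximant within \<epsilon>/2 confines the large values of \<open>g\<close> to
  one of its own compact superlevel sets.\<close>

lemma C0_uniform_limit:
  assumes f: "\<And>n. f n \<in> cs_carrier (C0 X)"
    and lim: "\<And>\<epsilon>. 0 < \<epsilon> \<Longrightarrow> \<exists>n. \<forall>x\<in>topspace X. cmod (f n x - g x) < \<epsilon>"
  shows "restrict g (topspace X) \<in> cs_carrier (C0 X)"
proof (rule C0_restrictI)
  show "continuous_map X euclidean g"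
    unfolding continuous_map_euclidean_tendsto
  proof (intro ballI tendstoI)
    fix x and \<epsilon> :: real assume x: "x \<in> topspace X" and e: "0 < \<epsilon>"
    obtain n where n: "\<forall>x\<in>topspace X. cmod (f n x - g x) < \<epsilon>/3" using lim [of "\<epsilon>/3"] e by auto
    have "\<forall>\<^sub>F y in atin X x. y \<in> topspace X"
      using x openin_subset by (auto simp: eventually_atin)
    moreover have "\<forall>\<^sub>F y in atin X x. dist (f n y) (f n x) < \<epsilon>/3"
      using C0_continuous [OF f, of n] x e by (intro tendstoD) (auto simp: continuous_map_euclidean_tendsto)
    ultimately show "\<forall>\<^sub>F y in atin X x. dist (g y) (g x) < \<epsilon>"
    proof eventually_elim
      case (elim y)
      have "dist (g y) (g x) \<le> dist (g y) (f n y) + dist (f n y) (f n x) + dist (f n x) (g x)"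
        by (metis dist_triangle dist_triangle_le add_right_mono order_trans)
      then show ?case using elim bspec [OF n x] bspec [OF n elim(1)]
        by (auto simp: dist_norm norm_minus_commute)
    qed
  qed
  fix \<epsilon> :: real assume e: "0 < \<epsilon>"
  obtain n where n: "\<forall>x\<in>topspace X. cmod (f n x - g x) < \<epsilon>/2" using lim [of "\<epsilon>/2"] e by auto
  have "\<epsilon>/2 \<le> cmod (f n x)" if "x \<in> topspace X" "\<epsilon> \<le> cmod (g x)" for x
    using n that norm_triangle_ineq3 [of "f n x" "g x"] by fastforce
  then show "\<exists>K. compactin X K \<and> (\<forall>x\<in>topspace X. \<epsilon> \<le> cmod (g x) \<longrightarrow> x \<in> K)"
    using C0_compactin [OF f, of "\<epsilon>/2" n] e
    by (intro exI [of _ "{x \<in> topspace X. \<epsilon>/2 \<le> cmod (f n x)}"]) auto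
qed

lemma mcomplete_C0: "Metric_space.mcomplete (cs_carrier (C0 X)) (cs_dist (C0 X))"
proof -
  interpret Metric_space "cs_carrier (C0 X)" "cs_dist (C0 X)" by (rule Metric_space_C0)
  show ?thesis
    unfolding mcomplete_def
  proof (intro allI impI)
    fix \<sigma> assume Cau: "MCauchy \<sigma>"
    then have s: "\<And>n. \<sigma> n \<in> cs_carrier (C0 X)" by (auto simp: MCauchy_def)
    have small: "\<exists>N. \<forall>m\<ge>N. \<forall>n\<ge>N. \<forall>x\<in>topspace X. cmod (\<sigma> m x - \<sigma> n x) < \<epsilon>" if e: "0 < \<epsilon>" for \<epsilon>
    proof -
      obtain N where "\<forall>n n'. N \<le> n \<longrightarrow> N \<le> n' \<longrightarrow> cs_dist (C0 X) (\<sigma> n) (\<sigma> n') < \<epsilon>"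
        using Cau e unfolding MCauchy_def by blast
      then show ?thesis by (auto simp: C0_dist_less_iff [OF s s e])
    qed
    have "convergent (\<lambda>n. \<sigma> n x)" if "x \<in> topspace X" for x
      unfolding Cauchy_convergent_iff [symmetric] Cauchy_def dist_norm
      using small that by meson
    then obtain g where g: "\<And>x. x \<in> topspace X \<Longrightarrow> (\<lambda>n. \<sigma> n x) \<longlonglongrightarrow> g x"
      unfolding convergent_def by metis
    have unif: "\<exists>N. \<forall>m\<ge>N. \<forall>x\<in>topspace X. cmod (\<sigma> m x - g x) < \<epsilon>" if e: "0 < \<epsilon>" for \<epsilon>
    proof -
      obtain N where N: "\<forall>m\<ge>N. \<forall>n\<ge>N. \<forall>x\<in>topspace X. cmod (\<sigma> m x - \<sigma> n x) < \<epsilon>/2"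
        using small [of "\<epsilon>/2"] e by auto
      \<comment> \<open>Passing to the limit in \<open>n\<close> keeps only a weak inequality, so
        the Cauchy bound is taken at \<epsilon>/2.\<close>
      have half: "cmod (\<sigma> m x - g x) \<le> \<epsilon>/2" if "m \<ge> N" "x \<in> topspace X" for m x
      proof (rule LIMSEQ_le_const2)
        show "(\<lambda>n. cmod (\<sigma> m x - \<sigma> n x)) \<longlonglongrightarrow> cmod (\<sigma> m x - g x)"
          using g [OF that(2)] by (intro tendsto_intros)
        show "\<exists>N'. \<forall>n\<ge>N'. cmod (\<sigma> m x - \<sigma> n x) \<le> \<epsilon>/2"
          using N that by (meson less_imp_le)
      qed
      then have "cmod (\<sigma> m x - g x) < \<epsilon>" if "m \<ge> N" "x \<in> topspace X" for m x
        using half [OF that] e by linarith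
      then show ?thesis by blast
    qed
    have gC: "restrict g (topspace X) \<in> cs_carrier (C0 X)"
      by (rule C0_uniform_limit [of \<sigma>]) (use s unif in blast)+
    have "limitin mtopology \<sigma> (restrict g (topspace X)) sequentially"
      unfolding limitin_metric
    proof (intro conjI allI impI gC)
      fix \<epsilon> :: real assume e: "0 < \<epsilon>"
      then obtain N where N: "\<forall>m\<ge>N. \<forall>x\<in>topspace X. cmod (\<sigma> m x - g x) < \<epsilon>" using unif by blast
      show "\<forall>\<^sub>F n in sequentially. \<sigma> n \<in> cs_carrier (C0 X) \<and>
          cs_dist (C0 X) (\<sigma> n) (restrict g (topspace X)) < \<epsilon>"
        using N by (intro eventually_sequentiallyI [of N] conjI s)
          (simp add: C0_dist_less_iff [OF s gC e])
    qed
    then show "\<exists>x. limitin mtopology \<sigma> x sequentially" by blast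
  qed
qed

theorem cstar_algebra_C0: "cstar_algebra (C0 X)"
  unfolding cstar_algebra_def star_subalgebra_def cs_subspace_def
proof (intro conjI ballI allI subset_refl)
  fix f g assume f: "f \<in> cs_carrier (C0 X)" and g: "g \<in> cs_carrier (C0 X)"
  show "cs_norm (C0 X) (cs_add (C0 X) f g) \<le> cs_norm (C0 X) f + cs_norm (C0 X) g"
    using C0_norm_upper [OF f] C0_norm_upper [OF g] C0_norm_nonneg [OF f] C0_norm_nonneg [OF g]
    by (intro C0_norm_le) (auto intro!: norm_triangle_mono)
  show "cs_norm (C0 X) (cs_mult (C0 X) f g) \<le> cs_norm (C0 X) f * cs_norm (C0 X) g"
    using C0_norm_upper [OF f] C0_norm_upper [OF g] C0_norm_nonneg [OF f] C0_norm_nonneg [OF g]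
    by (intro C0_norm_le) (auto simp: norm_mult intro!: mult_mono)
next
  fix f k assume f: "f \<in> cs_carrier (C0 X)"
  show "cs_norm (C0 X) (cs_scale (C0 X) k f) = cmod k * cs_norm (C0 X) f"
  proof (rule antisym)
    show "cs_norm (C0 X) (cs_scale (C0 X) k f) \<le> cmod k * cs_norm (C0 X) f"
      using C0_norm_upper [OF f] C0_norm_nonneg [OF f]
      by (intro C0_norm_le) (auto simp: norm_mult intro!: mult_left_mono)
    show "cmod k * cs_norm (C0 X) f \<le> cs_norm (C0 X) (cs_scale (C0 X) k f)"
    proof (cases "k = 0")
      case False
      have "cs_norm (C0 X) f \<le> cs_norm (C0 X) (cs_scale (C0 X) k f) / cmod k"
        using False C0_norm_upper [OF C0_scale_closed [OF f]] C0_norm_nonneg [OF C0_scale_closed [OF f]]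
        by (intro C0_norm_le) (force simp: norm_mult field_simps)+
      then show ?thesis using False by (simp add: field_simps)
    qed (use C0_norm_nonneg [OF C0_zero_closed] in simp)
  qed
  show "cs_norm (C0 X) (cs_mult (C0 X) (cs_star (C0 X) f) f) = (cs_norm (C0 X) f)\<^sup>2"
  proof (rule antisym)
    show "cs_norm (C0 X) (cs_mult (C0 X) (cs_star (C0 X) f) f) \<le> (cs_norm (C0 X) f)\<^sup>2"
      using C0_norm_upper [OF f] C0_norm_nonneg [OF f]
      by (intro C0_norm_le) (auto simp: norm_mult power2_eq_square intro!: mult_mono)
    have *: "cs_mult (C0 X) (cs_star (C0 X) f) f \<in> cs_carrier (C0 X)"
      using f by (simp add: C0_mult_closed C0_star_closed del: restrict_apply)
    \<comment> \<open>The lower bound in the C*-identity: |f x| is the square root of a value of the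
      product, so taking roots reduces it to a pointwise bound.\<close>
    have "cs_norm (C0 X) f \<le> sqrt (cs_norm (C0 X) (cs_mult (C0 X) (cs_star (C0 X) f) f))"
    proof (intro C0_norm_le)
      fix x assume "x \<in> topspace X"
      then show "cmod (f x) \<le> sqrt (cs_norm (C0 X) (cs_mult (C0 X) (cs_star (C0 X) f) f))"
        using C0_norm_upper [OF *, of x] by (intro real_le_rsqrt) (simp add: norm_mult power2_eq_square)
    qed (use C0_norm_nonneg [OF *] in simp)
    then have "(cs_norm (C0 X) f)\<^sup>2 \<le> (sqrt (cs_norm (C0 X) (cs_mult (C0 X) (cs_star (C0 X) f) f)))\<^sup>2"
      using C0_norm_nonneg [OF f] by (rule power_mono)
    then show "(cs_norm (C0 X) f)\<^sup>2 \<le> cs_norm (C0 X) (cs_mult (C0 X) (cs_star (C0 X) f) f)"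
      using C0_norm_nonneg [OF *] by simp
  qed
  show "cs_norm (C0 X) f = 0 \<longleftrightarrow> f = cs_zero (C0 X)" using C0_norm_eq_0_iff [OF f] by simp
  show "0 \<le> cs_norm (C0 X) f" using C0_norm_nonneg [OF f] .
  have "restrict f (topspace X) = f" using C0_extensional [OF f] by (simp add: extensional_restrict)
  then show "cs_add (C0 X) (cs_zero (C0 X)) f = f" "cs_scale (C0 X) 1 f = f"
    "cs_star (C0 X) (cs_star (C0 X) f) = f"
    by (simp_all cong: restrict_cong)
next
  show "Metric_space.mcomplete (cs_carrier (C0 X)) (cs_dist (C0 X))" by (rule mcomplete_C0)
qed (simp_all add: C0_closed distrib_left distrib_right ac_simps cong: restrict_cong)

section \<open>Extension of functions on locally compact Hausdorff spaces\<close>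

lemma continuous_map_euclidean_dist:
  "continuous_map T euclidean f \<longleftrightarrow>
     (\<forall>t\<in>topspace T. \<forall>\<epsilon>>0. \<exists>U. openin T U \<and> t \<in> U \<and> (\<forall>y\<in>U. dist (f y) (f t) < \<epsilon>))"
  using Met_TC.continuous_map_to_metric [of T f] by (simp add: dist_commute)

text \<open>Tietze's theorem in the one-point compactification, which is compact Hausdorff and hence
  normal. Since \<open>a\<close> vanishes at infinity, giving it the value 0 at \<open>None\<close>
  produces a continuous function on the closed set made up of \<open>S\<close> and
  \<open>None\<close>. The extension is then 0 at \<open>None\<close>, so its restriction to
  \<open>X\<close> vanishes at infinity.\<close>

lemma C0_extension:
  assumes X: "locally_compact_space X" "Hausdorff_space X" and S: "closedin X S"
    and a: "a \<in> cs_carrier (C0 (subtopology X S))"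
  obtains f where "f \<in> cs_carrier (C0 X)" "\<And>x. x \<in> S \<Longrightarrow> f x = a x"
proof -
  let ?E = "Alexandroff_compactification X"
  let ?S = "insert None (Some ` S)"
  have SX: "S \<subseteq> topspace X" using S closedin_subset by blast
  then have topS: "topspace (subtopology X S) = S" by auto
  define b where "b = case_option 0 a"
  have "normal_space ?E"
    using X by (intro compact_Hausdorff_or_regular_imp_normal_space)
      (auto simp: Hausdorff_space_Alexandroff_compactification)
  moreover have clS: "closedin ?E ?S"
  proof -
    have "?S = topspace ?E - Some ` (topspace X - S)" using SX by auto
    then show ?thesis using S unfolding closedin_Alexandroff_compactification by blast
  qed
  have contb: "continuous_map (subtopology ?E ?S) euclidean b"
    unfolding continuous_map_euclidean_dist
  proof (intro ballI allI impI)
    fix t and \<epsilon> :: real assume t: "t \<in> topspace (subtopology ?E ?S)" and e: "0 < \<epsilon>"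
    show "\<exists>U. openin (subtopology ?E ?S) U \<and> t \<in> U \<and> (\<forall>y\<in>U. dist (b y) (b t) < \<epsilon>)"
    proof (cases t)
      case None
      \<comment> \<open>Its complement is the neighbourhood of infinity on which |a| < \<epsilon>;
        it is open because compact subsets of the Hausdorff space \<open>X\<close> are
        closed.\<close>
      let ?C = "{x \<in> topspace (subtopology X S). \<epsilon> \<le> cmod (a x)}"
      have "compactin (subtopology X S) ?C" using C0_compactin [OF a e] .
      then have "compactin X ?C" by (simp add: compactin_subtopology)
      then have "openin ?E (insert None (Some ` (topspace X - ?C)))"
        using X compactin_imp_closedin openin_Alexandroff_compactification by blast
      then have "openin (subtopology ?E ?S) (?S \<inter> insert None (Some ` (topspace X - ?C)))"
        by (rule openin_subtopology_Int2)
      moreover have "\<forall>y\<in>?S \<inter> insert None (Some ` (topspace X - ?C)). dist (b y) (b t) < \<epsilon>"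
        using None e topS by (auto simp: b_def)
      ultimately show ?thesis using None by blast
    next
      case (Some x)
      then have x: "x \<in> S" using t by auto
      have "\<forall>t\<in>S. \<forall>\<epsilon>>0. \<exists>U. openin (subtopology X S) U \<and> t \<in> U \<and> (\<forall>y\<in>U. dist (a y) (a t) < \<epsilon>)"
        using C0_continuous [OF a] unfolding continuous_map_euclidean_dist topS .
      then obtain U where U: "openin (subtopology X S) U" "x \<in> U" "\<forall>y\<in>U. dist (a y) (a x) < \<epsilon>"
        using x e by meson
      then obtain V where V: "openin X V" "U = V \<inter> S" by (auto simp: openin_subtopology)
      then have "openin (subtopology ?E ?S) (?S \<inter> Some ` V)"
        by (intro openin_subtopology_Int2) simp
      moreover have "\<forall>y\<in>?S \<inter> Some ` V. dist (b y) (b t) < \<epsilon>"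
        using Some U V by (auto simp: b_def)
      ultimately show ?thesis using Some U V by blast
    qed
  qed
  have "continuous_map (subtopology ?E ?S) euclideanreal (\<lambda>t. Re (b t))"
    "continuous_map (subtopology ?E ?S) euclideanreal (\<lambda>t. Im (b t))"
    using contb by (auto simp: continuous_map_euclidean_tendsto intro: tendsto_Re tendsto_Im)
  then obtain g h where g: "continuous_map ?E euclideanreal g" "\<And>t. t \<in> ?S \<Longrightarrow> g t = Re (b t)"
    and h: "continuous_map ?E euclideanreal h" "\<And>t. t \<in> ?S \<Longrightarrow> h t = Im (b t)"
    using Tietze_extension_realinterval [OF \<open>normal_space ?E\<close> clS, of UNIV]
    by (metis empty_not_UNIV is_interval_univ subset_UNIV)
  define k where "k = (\<lambda>t. Complex (g t) (h t))"
  have k: "continuous_map ?E euclidean k"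
    using g(1) h(1) unfolding continuous_map_euclidean_tendsto k_def
    by (intro ballI tendsto_Complex) auto
  have kb: "k t = b t" if "t \<in> ?S" for t using that g h by (simp add: k_def)
  have "restrict (\<lambda>x. k (Some x)) (topspace X) \<in> cs_carrier (C0 X)"
  proof (rule C0_restrictI)
    show "continuous_map X euclidean (\<lambda>x. k (Some x))"
      using continuous_map_compose [OF continuous_map_Some k] by (simp add: o_def)
    fix \<epsilon> :: real assume e: "0 < \<epsilon>"
    let ?C = "{t \<in> topspace ?E. \<epsilon> \<le> cmod (k t)}"
    have "closedin ?E ?C" using k by (rule closedin_continuous_cmod_ge)
    \<comment> \<open>A closed set of the compactification that avoids \<open>None\<close> is a
      compact subset of \<open>X\<close>; this is the vanishing at infinity.\<close>
    moreover have "None \<notin> ?C" using kb [of None] e by (simp add: b_def)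
    ultimately obtain K where "compactin X K" "?C = Some ` K"
      unfolding closedin_Alexandroff_compactification by auto
    moreover have "Some x \<in> ?C" if "x \<in> topspace X" "\<epsilon> \<le> cmod (k (Some x))" for x
      using that by auto
    ultimately show "\<exists>K. compactin X K \<and> (\<forall>x\<in>topspace X. \<epsilon> \<le> cmod (k (Some x)) \<longrightarrow> x \<in> K)"
      by (intro exI [of _ K]) blast
  qed
  then show thesis
    by (rule that) (use SX kb in \<open>auto simp: b_def\<close>)
qed

section \<open>Compactly supported functions: approximation, cutoffs, extension from closed
  sets\<close>

lemma Cc_restrictI:
  assumes "Hausdorff_space X" "continuous_map X euclidean f" "compactin X K"
    and "\<And>x. x \<in> topspace X \<Longrightarrow> f x \<noteq> 0 \<Longrightarrow> x \<in> K"
  shows "restrict f (topspace X) \<in> Cc X"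
proof -
  have "X closure_of {x \<in> topspace X. restrict f (topspace X) x \<noteq> 0} \<subseteq> K"
    using assms by (intro closure_of_minimal compactin_imp_closedin) auto
  then show ?thesis
    using assms closed_compactin [OF assms(3) _ closedin_closure_of]
    by (auto simp: Cc_def continuous_map_restrict simp del: restrict_apply)
qed

lemma Cc_supp:
  assumes "f \<in> Cc X"
  obtains K where "compactin X K" "closedin X K" "\<And>x. x \<in> topspace X \<Longrightarrow> f x \<noteq> 0 \<Longrightarrow> x \<in> K"
proof (rule that)
  let ?K = "X closure_of {x \<in> topspace X. f x \<noteq> 0}"
  show "compactin X ?K" using assms by (simp add: Cc_def)
  show "closedin X ?K" by simp
  show "x \<in> ?K" if "x \<in> topspace X" "f x \<noteq> 0" for x
    using that closure_of_subset [of "{x \<in> topspace X. f x \<noteq> 0}" X] by blast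
qed

lemma Cc_continuous: "f \<in> Cc X \<Longrightarrow> continuous_map X euclidean f"
  by (simp add: Cc_def)

lemma Cc_subset_C0: "Cc X \<subseteq> cs_carrier (C0 X)"
proof
  fix f assume f: "f \<in> Cc X"
  then obtain K where "compactin X K" "\<And>x. x \<in> topspace X \<Longrightarrow> f x \<noteq> 0 \<Longrightarrow> x \<in> K"
    by (rule Cc_supp) blast
  then have "restrict f (topspace X) \<in> cs_carrier (C0 X)"
    using f by (intro C0_restrictI exI [of _ K]) (force simp: Cc_def)+
  then show "f \<in> cs_carrier (C0 X)" using f by (simp add: Cc_def extensional_restrict)
qed

text \<open>Soft thresholding: a value of modulus \<open>t\<close> is multiplied by 0 for t \<le>
  \<epsilon> and by (t - \<epsilon>) / t beyond, so every value moves by at most \<epsilon>. The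
  third conclusion names the set where |f| is at least \<epsilon> instead of a support; in this form
  it also serves on the orbit space, whose separation properties are not established here.\<close>

lemma C0_threshold:
  assumes f: "f \<in> cs_carrier (C0 X)" and e: "0 < \<epsilon>"
  obtains g where "g \<in> cs_carrier (C0 X)" "\<And>x. x \<in> topspace X \<Longrightarrow> cmod (g x - f x) \<le> \<epsilon>"
    "\<And>x. x \<in> topspace X \<Longrightarrow> g x \<noteq> 0 \<Longrightarrow> \<epsilon> \<le> cmod (f x)"
proof -
  define h where "h t = max 0 (t - \<epsilon>) / max t \<epsilon>" for t :: real
  have h: "0 \<le> h t" "h t \<le> 1" "t * (1 - h t) \<le> \<epsilon>" "h t \<noteq> 0 \<Longrightarrow> \<epsilon> \<le> t" if "0 \<le> t" for t
    using that e by (auto simp: h_def max_def field_simps split: if_splits)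
  have ne: "max t \<epsilon> \<noteq> 0" for t using e by auto
  let ?k = "\<lambda>x. complex_of_real (h (cmod (f x)))"
  have cont: "continuous_map X euclidean ?k"
    using C0_continuous [OF f] ne unfolding continuous_map_euclidean_tendsto h_def
    by (intro ballI tendsto_intros) auto
  show thesis
  proof (rule that)
    show "(\<lambda>x\<in>topspace X. ?k x * f x) \<in> cs_carrier (C0 X)"
      using h by (intro C0_mult_bounded_closed [OF cont _ f, of 1]) auto
    fix x assume x: "x \<in> topspace X"
    have "cmod (?k x * f x - f x) = cmod (f x * complex_of_real (1 - h (cmod (f x))))"
      by (simp add: algebra_simps norm_minus_commute)
    also have "\<dots> = cmod (f x) * (1 - h (cmod (f x)))"
      using h(2) [of "cmod (f x)"] by (simp only: norm_mult norm_of_real) simp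
    finally show "cmod ((\<lambda>x\<in>topspace X. ?k x * f x) x - f x) \<le> \<epsilon>" using x h(3) by simp
    show "\<epsilon> \<le> cmod (f x)" if "(\<lambda>x\<in>topspace X. ?k x * f x) x \<noteq> 0"
      using that x h(4) by auto
  qed
qed

lemma Cc_approx:
  assumes "Hausdorff_space X" and f: "f \<in> cs_carrier (C0 X)" and e: "0 < \<epsilon>"
  obtains g where "g \<in> Cc X" "\<And>x. x \<in> topspace X \<Longrightarrow> cmod (g x - f x) \<le> \<epsilon>"
proof -
  obtain g where g: "g \<in> cs_carrier (C0 X)" "\<And>x. x \<in> topspace X \<Longrightarrow> cmod (g x - f x) \<le> \<epsilon>"
    "\<And>x. x \<in> topspace X \<Longrightarrow> g x \<noteq> 0 \<Longrightarrow> \<epsilon> \<le> cmod (f x)"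
    using C0_threshold [OF f e] by metis
  have "restrict g (topspace X) \<in> Cc X"
    using assms(1) C0_continuous [OF g(1)] C0_compactin [OF f e] by (rule Cc_restrictI) (use g(3) in auto)
  then have "g \<in> Cc X" using C0_extensional [OF g(1)] by (simp add: extensional_restrict)
  then show thesis using g(2) that by blast
qed

text \<open>The constant 1 on \<open>K\<close> is extended to some \<open>f\<close> in C_0(X), and 2
  Re f - 1 is clipped to [0, 1]. The result is 1 where f = 1 and can be nonzero only where Re f >
  1/2, inside the compact set where |f| is at least 1/2.\<close>

lemma Urysohn_Cc:
  assumes X: "locally_compact_space X" "Hausdorff_space X" and K: "compactin X K"
  obtains \<kappa> :: "'x \<Rightarrow> real" and L where "continuous_map X euclideanreal \<kappa>" "\<And>x. 0 \<le> \<kappa> x" "\<And>x. \<kappa> x \<le> 1"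
    "\<And>x. x \<in> K \<Longrightarrow> \<kappa> x = 1" "compactin X L" "\<And>x. x \<in> topspace X \<Longrightarrow> \<kappa> x \<noteq> 0 \<Longrightarrow> x \<in> L"
proof -
  have KX: "K \<subseteq> topspace X" using K by (rule compactin_subset_topspace)
  have "restrict (\<lambda>x. 1) (topspace (subtopology X K)) \<in> cs_carrier (C0 (subtopology X K))"
    using K by (intro C0_restrictI exI [of _ K]) (auto simp: compactin_subtopology)
  then obtain f where f: "f \<in> cs_carrier (C0 X)"
    and fK: "\<And>x. x \<in> K \<Longrightarrow> f x = restrict (\<lambda>x. 1) (topspace (subtopology X K)) x"
    using C0_extension [OF X compactin_imp_closedin [OF X(2) K]] by blast
  define \<kappa> where "\<kappa> x = max 0 (min 1 (2 * Re (f x) - 1))" for x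
  show thesis
  proof (rule that)
    show "continuous_map X euclideanreal \<kappa>"
      using C0_continuous [OF f] unfolding continuous_map_euclidean_tendsto \<kappa>_def
      by (auto intro!: tendsto_intros)
    show "compactin X {x \<in> topspace X. 1/2 \<le> cmod (f x)}" by (rule C0_compactin [OF f]) simp
    show "x \<in> {x \<in> topspace X. 1/2 \<le> cmod (f x)}" if "x \<in> topspace X" "\<kappa> x \<noteq> 0" for x
      using that complex_Re_le_cmod [of "f x"] by (auto simp: \<kappa>_def max_def min_def split: if_splits)
    show "\<kappa> x = 1" if "x \<in> K" for x using that fK KX by (auto simp: \<kappa>_def)
  qed (auto simp: \<kappa>_def)
qed

text \<open>The extension supplied by \<open>C0_extension\<close> need not have compact support, so
  it is multiplied by a cutoff that is 1 on \<open>K\<close>. On \<open>S\<close> nothing changes,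
  since \<open>a\<close> is zero off \<open>K\<close>.\<close>

lemma Cc_extension:
  fixes a :: "'x \<Rightarrow> complex"
  assumes X: "locally_compact_space X" "Hausdorff_space X" and S: "closedin X S"
    and a: "continuous_map (subtopology X S) euclidean a"
    and K: "compactin X K" "\<And>x. x \<in> S \<Longrightarrow> a x \<noteq> 0 \<Longrightarrow> x \<in> K"
  obtains f where "f \<in> Cc X" "\<And>x. x \<in> S \<Longrightarrow> f x = a x"
proof -
  have SX: "S \<subseteq> topspace X" using S closedin_subset by blast
  then have topS: "topspace (subtopology X S) = S" by auto
  have "compactin (subtopology X S) (K \<inter> S)"
    using compact_Int_closedin [OF K(1) S] by (simp add: compactin_subtopology)
  then have "restrict a (topspace (subtopology X S)) \<in> cs_carrier (C0 (subtopology X S))"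
    using a K(2) topS by (intro C0_restrictI exI [of _ "K \<inter> S"]) force+
  then obtain f where f: "f \<in> cs_carrier (C0 X)" "\<And>x. x \<in> S \<Longrightarrow> f x = a x"
    using C0_extension [OF X S] topS by (metis restrict_apply')
  obtain \<kappa> L where \<kappa>: "continuous_map X euclideanreal \<kappa>" "\<And>x. x \<in> K \<Longrightarrow> \<kappa> x = 1"
    "compactin X L" "\<And>x. x \<in> topspace X \<Longrightarrow> \<kappa> x \<noteq> 0 \<Longrightarrow> x \<in> L"
    using Urysohn_Cc [OF X K(1)] by metis
  have "restrict (\<lambda>x. complex_of_real (\<kappa> x) * f x) (topspace X) \<in> Cc X"
  proof (rule Cc_restrictI [OF X(2) _ \<kappa>(3)])
    show "continuous_map X euclidean (\<lambda>x. complex_of_real (\<kappa> x) * f x)"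
      using \<kappa>(1) C0_continuous [OF f(1)] unfolding continuous_map_euclidean_tendsto
      by (auto intro!: tendsto_intros)
  qed (use \<kappa>(4) in auto)
  then show thesis
  proof (rule that)
    fix x assume "x \<in> S"
    then show "restrict (\<lambda>x. complex_of_real (\<kappa> x) * f x) (topspace X) x = a x"
      using SX f(2) \<kappa>(2) K(2) by (cases "a x = 0") auto
  qed
qed

lemma star_subalgebra_Cc:
  assumes "Hausdorff_space X"
  shows "star_subalgebra (C0 X) (Cc X)"
  unfolding star_subalgebra_def cs_subspace_def
proof (intro conjI ballI allI Cc_subset_C0)
  show "cs_zero (C0 X) \<in> Cc X"
    using assms by (simp, intro Cc_restrictI [of X _ "{}"]) auto
  fix f k assume f: "f \<in> Cc X"
  then obtain K where K: "compactin X K" "\<And>x. x \<in> topspace X \<Longrightarrow> f x \<noteq> 0 \<Longrightarrow> x \<in> K"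
    by (rule Cc_supp) blast
  show "cs_scale (C0 X) k f \<in> Cc X" unfolding C0_sel
    using assms Cc_continuous [OF f] K
    by (intro Cc_restrictI [of X _ K] continuous_map_mult) auto
  show "cs_star (C0 X) f \<in> Cc X" unfolding C0_sel
    using assms Cc_continuous [OF f] K
    by (intro Cc_restrictI [of X _ K])
       (auto simp: continuous_map_euclidean_tendsto intro: tendsto_cnj)
  fix g assume g: "g \<in> Cc X"
  then obtain L where L: "compactin X L" "\<And>x. x \<in> topspace X \<Longrightarrow> g x \<noteq> 0 \<Longrightarrow> x \<in> L"
    by (rule Cc_supp) blast
  show "cs_add (C0 X) f g \<in> Cc X" unfolding C0_sel
    using assms Cc_continuous [OF f] Cc_continuous [OF g] compactin_Un [OF K(1) L(1)] K(2) L(2)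
    by (intro Cc_restrictI [of X _ "K \<union> L"] continuous_map_add) force+
  show "cs_mult (C0 X) f g \<in> Cc X" unfolding C0_sel
    using assms Cc_continuous [OF f] Cc_continuous [OF g] K
    by (intro Cc_restrictI [of X _ K] continuous_map_mult) auto
qed

lemma closure_of_Cc:
  assumes "Hausdorff_space X"
  shows "cs_topology (C0 X) closure_of (Cc X) = cs_carrier (C0 X)"
proof -
  interpret Metric_space "cs_carrier (C0 X)" "cs_dist (C0 X)" by (rule Metric_space_C0)
  have "\<exists>g\<in>Cc X. g \<in> mball f r" if f: "f \<in> cs_carrier (C0 X)" and r: "0 < r" for f r
  proof -
    obtain g where g: "g \<in> Cc X" "\<And>x. x \<in> topspace X \<Longrightarrow> cmod (g x - f x) \<le> r/2"
      using Cc_approx [OF assms f, of "r/2"] r by auto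
    have gC: "g \<in> cs_carrier (C0 X)" using g(1) Cc_subset_C0 by blast
    have "cs_dist (C0 X) g f \<le> r/2" using g(2) r by (subst C0_dist_le_iff [OF gC f]) auto
    then show ?thesis using g(1) gC f r by (intro bexI [of _ g]) (auto simp: commute)
  qed
  then have "mtopology closure_of (Cc X) = cs_carrier (C0 X)"
    unfolding metric_closure_of by blast
  then show ?thesis by (simp add: cs_topology_def)
qed

section \<open>The bundle of a fibred space\<close>

text \<open>The bundle over a general Hausdorff base, without any groupoid; the base is later
  specialised to the unit space.\<close>

locale fibred_space =
  fixes Y :: "'g topology" and X :: "'x topology" and rX :: "'x \<Rightarrow> 'g"
  assumes Hausdorff_base: "Hausdorff_space Y"
    and locally_compact: "locally_compact_space X" and Hausdorff: "Hausdorff_space X"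
    and rX_continuous: "continuous_map X Y rX"
begin

abbreviation "fib \<equiv> fibre_space X rX"
abbreviation "res f u \<equiv> restrict f (topspace (fibre_space X rX u))"

definition tube :: "('x \<Rightarrow> complex) \<Rightarrow> 'g set \<Rightarrow> real \<Rightarrow> ('g \<times> ('x \<Rightarrow> complex)) set" where
  "tube f U \<epsilon> = {(u, a). u \<in> U \<and> a \<in> cs_carrier (C0 (fib u)) \<and> cs_dist (C0 (fib u)) (res f u) a < \<epsilon>}"

definition E :: "('g \<times> ('x \<Rightarrow> complex)) topology" where "E = C0_bundle_topology Y X rX"

lemma rX_in: "x \<in> topspace X \<Longrightarrow> rX x \<in> topspace Y"
  using rX_continuous by (auto simp: continuous_map_def)

lemma topspace_fib: "topspace (fib u) = {x \<in> topspace X. rX x = u}"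
  by (auto simp: fibre_space_def)

lemma closedin_fib: "u \<in> topspace Y \<Longrightarrow> closedin X {x \<in> topspace X. rX x = u}"
  using closedin_continuous_map_preimage [OF rX_continuous, of "{u}"] Hausdorff_base
  by (simp add: closedin_Hausdorff_singleton)

lemma res_C0:
  assumes f: "f \<in> cs_carrier (C0 X)" and u: "u \<in> topspace Y"
  shows "res f u \<in> cs_carrier (C0 (fib u))"
proof (rule C0_restrictI)
  show "continuous_map (fib u) euclidean f"
    using C0_continuous [OF f] by (simp add: fibre_space_def continuous_map_from_subtopology)
  fix \<epsilon> :: real assume "0 < \<epsilon>"
  then have "compactin X ({x \<in> topspace X. \<epsilon> \<le> cmod (f x)} \<inter> {x \<in> topspace X. rX x = u})"
    using C0_compactin [OF f] closedin_fib [OF u] by (intro compact_Int_closedin)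
  then show "\<exists>K. compactin (fib u) K \<and> (\<forall>x\<in>topspace (fib u). \<epsilon> \<le> cmod (f x) \<longrightarrow> x \<in> K)"
    unfolding topspace_fib by (intro exI conjI) (auto simp: fibre_space_def compactin_subtopology)
qed

text \<open>The fibre is a closed set, so \<open>C0_extension\<close> applies. This supplies a
  global section through any given point of the total space, and the arguments about the bundle
  topology start from one.\<close>

lemma lift_exists:
  assumes u: "u \<in> topspace Y" and a: "a \<in> cs_carrier (C0 (fib u))"
  obtains f where "f \<in> cs_carrier (C0 X)" "res f u = a"
proof -
  obtain f where f: "f \<in> cs_carrier (C0 X)" "\<And>x. x \<in> {x \<in> topspace X. rX x = u} \<Longrightarrow> f x = a x"
    by (rule C0_extension [OF locally_compact Hausdorff closedin_fib [OF u] a [unfolded fibre_space_def]]) blast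
  have "res f u = a"
    by (rule C0_eqI [OF res_C0 [OF f(1) u] a]) (use f(2) in \<open>auto simp: topspace_fib\<close>)
  then show thesis using f(1) that by blast
qed

lemma tube_iff:
  assumes "f \<in> cs_carrier (C0 X)" "u \<in> topspace Y" "0 < \<epsilon>"
  shows "(u, a) \<in> tube f U \<epsilon> \<longleftrightarrow> u \<in> U \<and> a \<in> cs_carrier (C0 (fib u)) \<and>
    (\<forall>x\<in>topspace X. rX x = u \<longrightarrow> cmod (f x - a x) < \<epsilon>)"
proof (cases "a \<in> cs_carrier (C0 (fib u))")
  case True
  then show ?thesis
    using C0_dist_less_iff [OF res_C0 [OF assms(1,2)] True assms(3)] by (auto simp: tube_def topspace_fib)
qed (simp add: tube_def)

lemma closedin_rX_image:
  assumes f: "f \<in> cs_carrier (C0 X)" and t: "0 < t"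
  shows "compactin Y (rX ` {x \<in> topspace X. t \<le> cmod (f x)})"
    "closedin Y (rX ` {x \<in> topspace X. t \<le> cmod (f x)})"
proof -
  show "compactin Y (rX ` {x \<in> topspace X. t \<le> cmod (f x)})"
    using image_compactin C0_compactin [OF f t] rX_continuous by blast
  then show "closedin Y (rX ` {x \<in> topspace X. t \<le> cmod (f x)})"
    by (rule compactin_imp_closedin [OF Hausdorff_base])
qed

text \<open>The points over which |f| reaches \<open>t\<close> form the image of a compact set under
  \<open>rX\<close>, hence a closed set. This is the source of upper semicontinuity; nothing similar
  bounds fibre norms from below, as a nonempty fibre may have empty ones next to it.\<close>

lemma fibre_norm_usc:
  assumes f: "f \<in> cs_carrier (C0 X)" and t: "0 < t"
  shows "openin Y {v \<in> topspace Y. \<forall>x\<in>topspace X. rX x = v \<longrightarrow> cmod (f x) < t}"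
proof -
  have "{v \<in> topspace Y. \<forall>x\<in>topspace X. rX x = v \<longrightarrow> cmod (f x) < t} =
      topspace Y - rX ` {x \<in> topspace X. t \<le> cmod (f x)}"
    by (auto simp: not_le)
  then show ?thesis using closedin_rX_image(2) [OF f t] by auto
qed

lemma E_eq: "E = topology_generated_by {tube f U \<epsilon> | f U \<epsilon>. f \<in> cs_carrier (C0 X) \<and> openin Y U \<and> 0 < \<epsilon>}"
  by (simp add: E_def C0_bundle_topology_def tube_def)

lemma openin_tube:
  "f \<in> cs_carrier (C0 X) \<Longrightarrow> openin Y U \<Longrightarrow> 0 < \<epsilon> \<Longrightarrow> openin E (tube f U \<epsilon>)"
  unfolding E_eq by (rule topology_generated_by_Basis) blast

lemma topspace_E: "topspace E = Sigma (topspace Y) (\<lambda>u. cs_carrier (C0 (fib u)))"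
proof
  show "topspace E \<subseteq> Sigma (topspace Y) (\<lambda>u. cs_carrier (C0 (fib u)))"
    by (auto simp: E_eq tube_def dest: openin_subset)
  show "Sigma (topspace Y) (\<lambda>u. cs_carrier (C0 (fib u))) \<subseteq> topspace E"
  proof clarify
    fix u a assume u: "u \<in> topspace Y" and a: "a \<in> cs_carrier (C0 (fib u))"
    obtain f where f: "f \<in> cs_carrier (C0 X)" "res f u = a" using lift_exists [OF u a] .
    then have "(u, a) \<in> tube f (topspace Y) 1"
      using u a by (auto simp: tube_iff topspace_fib)
    then show "(u, a) \<in> topspace E"
      using openin_subset [OF openin_tube [OF f(1), of "topspace Y" 1]] by auto
  qed
qed

text \<open>The topology is generated by tubes around all sections, but at the value of
  \<open>f\<close> over \<open>u\<close> the tubes around this one section suffice: by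
  \<open>fibre_norm_usc\<close> for g - f, a subbasic tube around \<open>g\<close> that contains the
  point contains a small tube around \<open>f\<close>.\<close>

lemma tube_neighbourhood_base:
  assumes W: "openin E W" and ua: "(u, res f u) \<in> W" and f: "f \<in> cs_carrier (C0 X)"
  obtains U \<epsilon> where "openin Y U" "u \<in> U" "0 < \<epsilon>" "tube f U \<epsilon> \<subseteq> W"
proof -
  have uY: "u \<in> topspace Y" using openin_subset [OF W] ua by (auto simp: topspace_E)
  have "generate_topology_on {tube f U \<epsilon> | f U \<epsilon>. f \<in> cs_carrier (C0 X) \<and> openin Y U \<and> 0 < \<epsilon>} W"
    using W unfolding E_eq openin_topology_generated_by_iff .
  then have "\<exists>U \<epsilon>. openin Y U \<and> u \<in> U \<and> 0 < \<epsilon> \<and> tube f U \<epsilon> \<subseteq> W" using ua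
  proof (induction W rule: generate_topology_on.induct)
    case (Int a b)
    then obtain U \<epsilon> V \<delta> where "openin Y U" "u \<in> U" "0 < \<epsilon>" "tube f U \<epsilon> \<subseteq> a"
      "openin Y V" "u \<in> V" "0 < \<delta>" "tube f V \<delta> \<subseteq> b" by blast
    moreover from this have "tube f (U \<inter> V) (min \<epsilon> \<delta>) \<subseteq> a \<inter> b"
      by (force simp: tube_def)
    ultimately show ?case by (intro exI [of _ "U \<inter> V"] exI [of _ "min \<epsilon> \<delta>"]) auto
  next
    case (UN K)
    then obtain k where k: "k \<in> K" "(u, res f u) \<in> k" by blast
    show ?case using UN.IH [OF k] k(1) by (meson Sup_upper order_trans)
  next
    case (Basis s)
    then obtain g V \<epsilon> where g: "g \<in> cs_carrier (C0 X)" and V: "openin Y V" and e: "0 < \<epsilon>"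
      and s: "s = tube g V \<epsilon>" by blast
    define m where "m = cs_dist (C0 (fib u)) (res g u) (res f u)"
    have m: "u \<in> V" "m < \<epsilon>" using Basis.prems unfolding s tube_def m_def by blast+
    have m0: "0 \<le> m" by (simp add: m_def C0_dist_nonneg)
    \<comment> \<open>The slack \<epsilon> - m is shared: one half for the growth of |g - f| on
      neighbouring fibres, the other for the radius of the tube around \<open>f\<close>.\<close>
    define \<delta> where "\<delta> = (\<epsilon> - m) / 2"
    have d: "0 < \<delta>" using m by (simp add: \<delta>_def)
    have gf: "(\<lambda>x\<in>topspace X. g x - f x) \<in> cs_carrier (C0 X)" using g f by (rule C0_diff_closed)
    define U where "U = V \<inter> {v \<in> topspace Y. \<forall>x\<in>topspace X. rX x = v \<longrightarrow> cmod (g x - f x) < m + \<delta>}"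
    have "openin Y {v \<in> topspace Y. \<forall>x\<in>topspace X. rX x = v \<longrightarrow> cmod (g x - f x) < m + \<delta>}"
      using fibre_norm_usc [OF gf, of "m + \<delta>"] m0 d by simp
    then have U: "openin Y U" using V by (auto simp: U_def)
    have "cmod (g x - f x) < m + \<delta>" if "x \<in> topspace X" "rX x = u" for x
      using C0_dist_upper [OF res_C0 [OF g uY] res_C0 [OF f uY], of x] that d
      by (simp add: m_def topspace_fib)
    then have uU: "u \<in> U" using m uY by (auto simp: U_def)
    have "tube f U \<delta> \<subseteq> s"
    proof clarify
      fix v a assume va: "(v, a) \<in> tube f U \<delta>"
      then have vY: "v \<in> topspace Y" by (auto simp: tube_def U_def)
      note va' = va [unfolded tube_iff [OF f vY d]]
      have "cmod (g x - a x) < \<epsilon>" if x: "x \<in> topspace X" "rX x = v" for x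
      proof -
        have "cmod (g x - a x) \<le> cmod (g x - f x) + cmod (f x - a x)"
          using norm_triangle_ineq [of "g x - f x" "f x - a x"] by simp
        also have "\<dots> < (m + \<delta>) + \<delta>" using va' x by (intro add_strict_mono) (auto simp: U_def)
        finally show ?thesis by (simp add: \<delta>_def field_simps)
      qed
      then show "(v, a) \<in> s" using va' unfolding s tube_iff [OF g vY e] by (auto simp: U_def)
    qed
    then show ?case using U uU d by blast
  qed simp
  then show thesis using that by blast
qed

text \<open>The section \<open>f\<close> through the image point may be chosen to suit the map;
  continuity then becomes a statement about tubes around this \<open>f\<close>, that is, a uniform
  pointwise estimate on nearby fibres.\<close>

lemma continuous_map_into_E:
  assumes into: "\<And>t. t \<in> topspace T \<Longrightarrow> \<phi> t \<in> topspace E"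
    and cont: "\<And>t. t \<in> topspace T \<Longrightarrow> \<exists>f\<in>cs_carrier (C0 X). res f (fst (\<phi> t)) = snd (\<phi> t) \<and>
      (\<forall>U \<epsilon>. openin Y U \<and> fst (\<phi> t) \<in> U \<and> 0 < \<epsilon> \<longrightarrow>
         (\<exists>V. openin T V \<and> t \<in> V \<and> (\<forall>t'\<in>V. \<phi> t' \<in> tube f U \<epsilon>)))"
  shows "continuous_map T E \<phi>"
  unfolding continuous_map_eq_topcontinuous_at topcontinuous_at_def
proof (intro ballI conjI allI impI)
  fix t W assume t: "t \<in> topspace T" and W: "openin E W \<and> \<phi> t \<in> W"
  obtain f where f: "f \<in> cs_carrier (C0 X)" and nb: "res f (fst (\<phi> t)) = snd (\<phi> t) \<and>
      (\<forall>U \<epsilon>. openin Y U \<and> fst (\<phi> t) \<in> U \<and> 0 < \<epsilon> \<longrightarrow>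
         (\<exists>V. openin T V \<and> t \<in> V \<and> (\<forall>t'\<in>V. \<phi> t' \<in> tube f U \<epsilon>)))"
    using cont [OF t] by (rule bexE)
  have "(fst (\<phi> t), res f (fst (\<phi> t))) \<in> W" using W nb by simp
  then obtain U \<epsilon> where U: "openin Y U" "fst (\<phi> t) \<in> U" "0 < \<epsilon>" "tube f U \<epsilon> \<subseteq> W"
    by (rule tube_neighbourhood_base [OF conjunct1 [OF W] _ f])
  then obtain V where "openin T V" "t \<in> V" "\<forall>t'\<in>V. \<phi> t' \<in> tube f U \<epsilon>"
    using nb by meson
  then show "\<exists>U. openin T U \<and> t \<in> U \<and> (\<forall>y\<in>U. \<phi> y \<in> W)" using U(4) by (meson subsetD)
qed (auto intro: into)

lemma section_continuous:
  assumes f: "f \<in> cs_carrier (C0 X)"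
  shows "continuous_map Y E (\<lambda>u. (u, res f u))"
proof (rule continuous_map_into_E)
  fix u assume u: "u \<in> topspace Y"
  have "\<exists>V. openin Y V \<and> u \<in> V \<and> (\<forall>t'\<in>V. (t', res f t') \<in> tube f U \<epsilon>)"
    if U: "openin Y U" "u \<in> U" and e: "0 < \<epsilon>" for U \<epsilon>
  proof (intro exI conjI ballI)
    show "openin Y U" "u \<in> U" by fact+
    fix v assume v: "v \<in> U"
    then have "v \<in> topspace Y" using U openin_subset by blast
    then show "(v, res f v) \<in> tube f U \<epsilon>" using v res_C0 [OF f] e by (simp add: tube_iff [OF f] topspace_fib)
  qed
  then show "\<exists>g\<in>cs_carrier (C0 X). res g (fst (u, res f u)) = snd (u, res f u) \<and>
      (\<forall>U \<epsilon>. openin Y U \<and> fst (u, res f u) \<in> U \<and> 0 < \<epsilon> \<longrightarrow>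
         (\<exists>V. openin Y V \<and> u \<in> V \<and> (\<forall>t'\<in>V. (t', res f t') \<in> tube g U \<epsilon>)))"
    using f by (intro bexI [of _ f]) auto
qed (use res_C0 [OF f] in \<open>simp add: topspace_E\<close>)

text \<open>A section through the point is mapped by \<open>p\<close> to a section through the
  image, and the Lipschitz bound carries tubes into tubes of a rescaled radius.\<close>

lemma fibrewise_unary_continuous:
  assumes P: "\<And>f. f \<in> cs_carrier (C0 X) \<Longrightarrow> (\<lambda>x\<in>topspace X. p (f x)) \<in> cs_carrier (C0 X)"
    and Pu: "\<And>u a. u \<in> topspace Y \<Longrightarrow> a \<in> cs_carrier (C0 (fib u)) \<Longrightarrow> (\<lambda>x\<in>topspace (fib u). p (a x)) \<in> cs_carrier (C0 (fib u))"
    and lip: "\<And>z w. cmod (p z - p w) \<le> B * cmod (z - w)"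
  shows "continuous_map E E (\<lambda>(u, a). (u, \<lambda>x\<in>topspace (fib u). p (a x)))"
proof (rule continuous_map_into_E)
  fix t assume "t \<in> topspace E"
  then obtain u a where t: "t = (u, a)" and u: "u \<in> topspace Y" and a: "a \<in> cs_carrier (C0 (fib u))"
    by (auto simp: topspace_E)
  obtain f where f: "f \<in> cs_carrier (C0 X)" "res f u = a" using lift_exists [OF u a] .
  let ?\<phi> = "\<lambda>(u, a). (u, \<lambda>x\<in>topspace (fib u). p (a x))"
  let ?F = "\<lambda>x\<in>topspace X. p (f x)"
  have "\<exists>V. openin E V \<and> t \<in> V \<and> (\<forall>t'\<in>V. ?\<phi> t' \<in> tube ?F U \<epsilon>)"
    if U: "openin Y U" "u \<in> U" and e: "0 < \<epsilon>" for U \<epsilon>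
  proof (intro exI conjI ballI)
    define \<delta> where "\<delta> = \<epsilon> / (\<bar>B\<bar> + 1)"
    have d: "0 < \<delta>" using e by (simp add: \<delta>_def)
    show "openin E (tube f U \<delta>)" using openin_tube [OF f(1) U(1) d] .
    show "t \<in> tube f U \<delta>" using U u a f d unfolding t by (auto simp: tube_iff topspace_fib)
    fix t' assume t': "t' \<in> tube f U \<delta>"
    then obtain v b where vb: "t' = (v, b)" "v \<in> topspace Y" using openin_subset [OF U(1)] by (auto simp: tube_def)
    have b: "v \<in> U" "b \<in> cs_carrier (C0 (fib v))" "\<forall>x\<in>topspace X. rX x = v \<longrightarrow> cmod (f x - b x) < \<delta>"
      using t' unfolding vb(1) tube_iff [OF f(1) vb(2) d] by auto
    have "cmod (p (f x) - p (b x)) < \<epsilon>" if "x \<in> topspace X" "rX x = v" for x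
    proof -
      have "cmod (p (f x) - p (b x)) \<le> B * cmod (f x - b x)" by (rule lip)
      also have "\<dots> \<le> \<bar>B\<bar> * cmod (f x - b x)" by (simp add: mult_right_mono)
      also have "\<dots> \<le> \<bar>B\<bar> * \<delta>" using b that by (intro mult_left_mono) (auto intro: less_imp_le)
      also have "\<dots> < \<epsilon>" using e by (simp add: \<delta>_def field_simps)
      finally show ?thesis .
    qed
    then show "?\<phi> t' \<in> tube ?F U \<epsilon>"
      using b Pu [OF vb(2)] by (simp add: vb(1) tube_iff [OF P [OF f(1)] vb(2) e] topspace_fib)
  qed
  moreover have "res ?F u = (\<lambda>x\<in>topspace (fib u). p (a x))" using f(2) by (auto simp: topspace_fib)
  ultimately show "\<exists>g\<in>cs_carrier (C0 X). res g (fst (?\<phi> t)) = snd (?\<phi> t) \<and>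
      (\<forall>U \<epsilon>. openin Y U \<and> fst (?\<phi> t) \<in> U \<and> 0 < \<epsilon> \<longrightarrow>
         (\<exists>V. openin E V \<and> t \<in> V \<and> (\<forall>t'\<in>V. ?\<phi> t' \<in> tube g U \<epsilon>)))"
    using P [OF f(1)] by (intro bexI [of _ ?F]) (auto simp: t simp del: restrict_apply)
qed (use Pu in \<open>auto simp: topspace_E\<close>)

text \<open>Multiplication is not uniformly continuous on all pairs of complex numbers, so
  uniformity is required only when one of the two pairs is bounded by \<open>B\<close>. That is
  enough, because the two chosen sections are bounded functions on \<open>X\<close>.\<close>

lemma fibrewise_binary_continuous:
  assumes P: "\<And>f g. f \<in> cs_carrier (C0 X) \<Longrightarrow> g \<in> cs_carrier (C0 X) \<Longrightarrow>
      (\<lambda>x\<in>topspace X. p (f x) (g x)) \<in> cs_carrier (C0 X)"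
    and Pu: "\<And>u a b. u \<in> topspace Y \<Longrightarrow> a \<in> cs_carrier (C0 (fib u)) \<Longrightarrow> b \<in> cs_carrier (C0 (fib u)) \<Longrightarrow>
      (\<lambda>x\<in>topspace (fib u). p (a x) (b x)) \<in> cs_carrier (C0 (fib u))"
    and uc: "\<And>B \<epsilon>. 0 < \<epsilon> \<Longrightarrow> 0 \<le> B \<Longrightarrow> \<exists>\<delta>>0. \<forall>z w z' w'. cmod z \<le> B \<and> cmod w \<le> B \<and>
      cmod (z - z') < \<delta> \<and> cmod (w - w') < \<delta> \<longrightarrow> cmod (p z w - p z' w') < \<epsilon>"
  shows "continuous_map (subtopology (prod_topology E E) {(a, b). fst a = fst b}) E
       (\<lambda>((u, a), (_, b)). (u, \<lambda>x\<in>topspace (fib u). p (a x) (b x)))"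
    (is "continuous_map ?T E ?\<phi>")
proof (rule continuous_map_into_E)
  fix t assume "t \<in> topspace ?T"
  then obtain u a b where t: "t = ((u, a), (u, b))" and u: "u \<in> topspace Y"
    and a: "a \<in> cs_carrier (C0 (fib u))" and b: "b \<in> cs_carrier (C0 (fib u))"
    by (auto simp: topspace_E)
  obtain f where f: "f \<in> cs_carrier (C0 X)" "res f u = a" using lift_exists [OF u a] .
  obtain g where g: "g \<in> cs_carrier (C0 X)" "res g u = b" using lift_exists [OF u b] .
  let ?F = "\<lambda>x\<in>topspace X. p (f x) (g x)"
  have "\<exists>V. openin ?T V \<and> t \<in> V \<and> (\<forall>t'\<in>V. ?\<phi> t' \<in> tube ?F U \<epsilon>)"
    if U: "openin Y U" "u \<in> U" and e: "0 < \<epsilon>" for U \<epsilon>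
  proof -
    define B where "B = max (cs_norm (C0 X) f) (cs_norm (C0 X) g)"
    have B: "cmod (f x) \<le> B" "cmod (g x) \<le> B" if "x \<in> topspace X" for x
      using C0_norm_upper [OF f(1) that] C0_norm_upper [OF g(1) that] by (auto simp: B_def)
    have "0 \<le> B" using C0_norm_nonneg [OF f(1)] by (auto simp: B_def)
    then obtain \<delta> where d: "0 < \<delta>" and
      \<delta>: "\<And>z w z' w'. cmod z \<le> B \<Longrightarrow> cmod w \<le> B \<Longrightarrow> cmod (z - z') < \<delta> \<Longrightarrow>
        cmod (w - w') < \<delta> \<Longrightarrow> cmod (p z w - p z' w') < \<epsilon>"
      using uc [OF e] by metis
    let ?V = "{(a, b). fst a = fst b} \<inter> (tube f U \<delta> \<times> tube g U \<delta>)"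
    have "openin ?T ?V"
      using openin_tube [OF f(1) U(1) d] openin_tube [OF g(1) U(1) d]
      by (intro openin_subtopology_Int2) (simp add: openin_prod_Times_iff)
    moreover have "t \<in> ?V" using U u a b f g d unfolding t by (auto simp: tube_iff topspace_fib)
    moreover have "?\<phi> t' \<in> tube ?F U \<epsilon>" if t': "t' \<in> ?V" for t'
    proof -
      obtain v a' b' where vb: "t' = ((v, a'), (v, b'))" and v: "v \<in> topspace Y"
        using t' openin_subset [OF U(1)] by (auto simp: tube_def)
      have vU: "v \<in> U" and a': "a' \<in> cs_carrier (C0 (fib v))" "\<forall>x\<in>topspace X. rX x = v \<longrightarrow> cmod (f x - a' x) < \<delta>"
        and b': "b' \<in> cs_carrier (C0 (fib v))" "\<forall>x\<in>topspace X. rX x = v \<longrightarrow> cmod (g x - b' x) < \<delta>"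
        using t' unfolding vb by (auto simp: tube_iff [OF f(1) v d] tube_iff [OF g(1) v d])
      have "cmod (p (f x) (g x) - p (a' x) (b' x)) < \<epsilon>" if "x \<in> topspace X" "rX x = v" for x
        using \<delta> B that a'(2) b'(2) by blast
      then show ?thesis
        using vU Pu [OF v a'(1) b'(1)] by (simp add: vb tube_iff [OF P [OF f(1) g(1)] v e] topspace_fib)
    qed
    ultimately show ?thesis by blast
  qed
  moreover have "res ?F u = (\<lambda>x\<in>topspace (fib u). p (a x) (b x))" using f(2) g(2) by (auto simp: topspace_fib)
  ultimately show "\<exists>h\<in>cs_carrier (C0 X). res h (fst (?\<phi> t)) = snd (?\<phi> t) \<and>
      (\<forall>U \<epsilon>. openin Y U \<and> fst (?\<phi> t) \<in> U \<and> 0 < \<epsilon> \<longrightarrow>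
         (\<exists>V. openin ?T V \<and> t \<in> V \<and> (\<forall>t'\<in>V. ?\<phi> t' \<in> tube h U \<epsilon>)))"
    using P [OF f(1) g(1)] by (intro bexI [of _ ?F]) (auto simp: t simp del: restrict_apply)
qed (use Pu in \<open>auto simp: topspace_E\<close>)

theorem usc_cstar_bundle_C0: "usc_cstar_bundle Y (\<lambda>u. C0 (fib u)) E"
  unfolding usc_cstar_bundle_def
proof (intro conjI ballI allI impI)
  show "cstar_algebra (C0 (fib u))" for u by (rule cstar_algebra_C0)
  show "topspace E = Sigma (topspace Y) (\<lambda>u. cs_carrier (C0 (fib u)))" by (rule topspace_E)
  have zero: "(u, \<lambda>x\<in>topspace (fib u). 0) \<in> topspace E" if "u \<in> topspace Y" for u
    using that by (simp add: topspace_E C0_zero_closed)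
  show "fst ` topspace E = topspace Y"
    using zero by (force simp: topspace_E)
  show "continuous_map E Y fst"
    unfolding continuous_map_def
  proof (intro conjI allI impI)
    fix U assume U: "openin Y U"
    have "\<exists>W. openin E W \<and> t \<in> W \<and> W \<subseteq> {t \<in> topspace E. fst t \<in> U}"
      if tE: "t \<in> topspace E" "fst t \<in> U" for t
    proof -
      obtain u a where t: "t = (u, a)" and u: "u \<in> topspace Y" and a: "a \<in> cs_carrier (C0 (fib u))"
        using tE by (auto simp: topspace_E)
      obtain f where f: "f \<in> cs_carrier (C0 X)" "res f u = a" using lift_exists [OF u a] .
      have "t \<in> tube f U 1" using t tE u a f by (auto simp: tube_iff topspace_fib)
      moreover have "tube f U 1 \<subseteq> {t \<in> topspace E. fst t \<in> U}"
        using openin_subset [OF U] by (auto simp: tube_def topspace_E)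
      ultimately show ?thesis using openin_tube [OF f(1) U, of 1] by auto
    qed
    then show "openin E {t \<in> topspace E. fst t \<in> U}"
      by (subst openin_subopen) blast
  qed (auto simp: topspace_E)
  show "open_map E Y fst"
    unfolding open_map_def
  proof (intro allI impI)
    fix W assume W: "openin E W"
    have "\<exists>U. openin Y U \<and> u \<in> U \<and> U \<subseteq> fst ` W" if uW: "u \<in> fst ` W" for u
    proof -
      obtain a where ua: "(u, a) \<in> W" using uW by auto
      then have u: "u \<in> topspace Y" and a: "a \<in> cs_carrier (C0 (fib u))"
        using openin_subset [OF W] by (auto simp: topspace_E)
      obtain f where f: "f \<in> cs_carrier (C0 X)" "res f u = a" using lift_exists [OF u a] .
      obtain U \<epsilon> where U: "openin Y U" "u \<in> U" "0 < \<epsilon>" "tube f U \<epsilon> \<subseteq> W"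
        by (rule tube_neighbourhood_base [OF W _ f(1)]) (use ua f(2) in auto)
      have "(v, res f v) \<in> tube f U \<epsilon>" if "v \<in> U" for v
        using that openin_subset [OF U(1)] U(3) res_C0 [OF f(1)] by (auto simp: tube_iff f(1) topspace_fib)
      then have "U \<subseteq> fst ` W" using U(4) by force
      then show ?thesis using U by blast
    qed
    then show "openin Y (fst ` W)" by (subst openin_subopen) blast
  qed
  fix t :: real
  show "openin E {(u, a) \<in> topspace E. cs_norm (C0 (fib u)) a < t}" (is "openin E ?W")
  proof (subst openin_subopen, clarify)
    fix u a assume ua: "(u, a) \<in> topspace E" and less: "cs_norm (C0 (fib u)) a < t"
    then have u: "u \<in> topspace Y" and a: "a \<in> cs_carrier (C0 (fib u))" by (auto simp: topspace_E)
    obtain f where f: "f \<in> cs_carrier (C0 X)" "res f u = a" using lift_exists [OF u a] .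
    define m where "m = cs_norm (C0 (fib u)) a"
    \<comment> \<open>One third for the values of \<open>f\<close> on nearby fibres, one for the
      radius of the tube; the remaining third keeps the final bound m + 2 \<delta> strictly below
      \<open>t\<close>.\<close>
    define \<delta> where "\<delta> = (t - m) / 3"
    have d: "0 < \<delta>" using less by (simp add: \<delta>_def m_def)
    have m: "0 \<le> m" using C0_norm_nonneg [OF a] by (simp add: m_def)
    define U where "U = {v \<in> topspace Y. \<forall>x\<in>topspace X. rX x = v \<longrightarrow> cmod (f x) < m + \<delta>}"
    have U: "openin Y U" unfolding U_def using m d by (intro fibre_norm_usc f(1)) simp
    have "cmod (f x) \<le> m" if "x \<in> topspace X" "rX x = u" for x
      using C0_norm_upper [OF a, of x] f(2) that by (auto simp: m_def topspace_fib)
    then have "u \<in> U" using u d by (force simp: U_def)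
    then have "(u, a) \<in> tube f U \<delta>" using u a f d by (auto simp: tube_iff topspace_fib)
    moreover have "tube f U \<delta> \<subseteq> ?W"
    proof clarify
      fix v b assume vb: "(v, b) \<in> tube f U \<delta>"
      then have v: "v \<in> topspace Y" by (auto simp: tube_def U_def)
      have b: "v \<in> U" "b \<in> cs_carrier (C0 (fib v))" "\<forall>x\<in>topspace X. rX x = v \<longrightarrow> cmod (f x - b x) < \<delta>"
        using vb unfolding tube_iff [OF f(1) v d] by auto
      have "cmod (b x) \<le> m + 2 * \<delta>" if "x \<in> topspace X" "rX x = v" for x
        using b that norm_triangle_ineq3 [of "f x" "b x"] by (fastforce simp: U_def)
      then have "cs_norm (C0 (fib v)) b \<le> m + 2 * \<delta>"
        using m d by (intro C0_norm_le) (auto simp: topspace_fib)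
      also have "\<dots> < t" using less by (simp add: \<delta>_def m_def field_simps)
      finally show "(v, b) \<in> topspace E \<and> cs_norm (C0 (fib v)) b < t"
        using v b by (simp add: topspace_E)
    qed
    ultimately show "\<exists>T. openin E T \<and> (u, a) \<in> T \<and> T \<subseteq> ?W"
      using openin_tube [OF f(1) U d] by blast
  qed
next
  have "continuous_map (subtopology (prod_topology E E) {(a, b). fst a = fst b}) E
       (\<lambda>((u, a), (_, b)). (u, \<lambda>x\<in>topspace (fib u). a x + b x))"
  proof (rule fibrewise_binary_continuous)
    fix B \<epsilon> :: real assume e: "0 < \<epsilon>"
    have "cmod (z + w - (z' + w')) < \<epsilon>" if "cmod (z - z') < \<epsilon>/2" "cmod (w - w') < \<epsilon>/2" for z z' w w'
      using that norm_triangle_ineq [of "z - z'" "w - w'"] by (simp add: algebra_simps)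
    then show "\<exists>\<delta>>0. \<forall>z w z' w'. cmod z \<le> B \<and> cmod w \<le> B \<and>
      cmod (z - z') < \<delta> \<and> cmod (w - w') < \<delta> \<longrightarrow> cmod (z + w - (z' + w')) < \<epsilon>"
      using e by (intro exI [of _ "\<epsilon>/2"]) auto
  qed (auto intro: C0_add_closed)
  then show "continuous_map (subtopology (prod_topology E E) {(a, b). fst a = fst b}) E
       (\<lambda>((u, a), (_, b)). (u, cs_add (C0 (fib u)) a b))" by simp
  have "continuous_map (subtopology (prod_topology E E) {(a, b). fst a = fst b}) E
       (\<lambda>((u, a), (_, b)). (u, \<lambda>x\<in>topspace (fib u). a x * b x))"
  proof (rule fibrewise_binary_continuous)
    fix B \<epsilon> :: real assume e: "0 < \<epsilon>" and B: "0 \<le> B"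
    \<comment> \<open>The cap 1 gives |w'| \<le> B + 1; then |z (w - w') + (z - z') w'| is at most
      \<delta> B + \<delta> (B + 1), which is less than 2 \<delta> (B + 1).\<close>
    define \<delta> where "\<delta> = min 1 (\<epsilon> / (2 * (B + 1)))"
    have d: "0 < \<delta>" "\<delta> \<le> 1" and "\<delta> \<le> \<epsilon> / (2 * (B + 1))"
      using e B by (auto simp: \<delta>_def)
    then have d2: "\<delta> * (2 * (B + 1)) \<le> \<epsilon>" using B by (subst (asm) pos_le_divide_eq) auto
    have "cmod (z * w - z' * w') < \<epsilon>"
      if "cmod z \<le> B" "cmod w \<le> B" "cmod (z - z') < \<delta>" "cmod (w - w') < \<delta>" for z z' w w'
    proof -
      have "cmod w' \<le> B + 1" using that d norm_triangle_ineq3 [of w w'] by linarith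
      have "cmod (z * w - z' * w') = cmod (z * (w - w') + (z - z') * w')" by (simp add: algebra_simps)
      also have "\<dots> \<le> cmod z * cmod (w - w') + cmod (z - z') * cmod w'"
        by (metis norm_mult norm_triangle_ineq)
      also have "\<dots> \<le> B * \<delta> + \<delta> * (B + 1)"
        using that \<open>cmod w' \<le> B + 1\<close> B d by (intro add_mono mult_mono) auto
      also have "\<dots> < \<delta> * (2 * (B + 1))" using d by (simp add: algebra_simps)
      finally show ?thesis using d2 by simp
    qed
    then show "\<exists>\<delta>>0. \<forall>z w z' w'. cmod z \<le> B \<and> cmod w \<le> B \<and>
      cmod (z - z') < \<delta> \<and> cmod (w - w') < \<delta> \<longrightarrow> cmod (z * w - z' * w') < \<epsilon>"
      using d by blast
  qed (auto intro: C0_mult_closed)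
  then show "continuous_map (subtopology (prod_topology E E) {(a, b). fst a = fst b}) E
       (\<lambda>((u, a), (_, b)). (u, cs_mult (C0 (fib u)) a b))" by simp
  have "continuous_map E E (\<lambda>(u, a). (u, \<lambda>x\<in>topspace (fib u). k * a x))" for k
    by (rule fibrewise_unary_continuous [where B = "cmod k"])
       (auto intro: C0_scale_closed simp: norm_mult simp flip: right_diff_distrib)
  then show "continuous_map E E (\<lambda>(u, a). (u, cs_scale (C0 (fib u)) k a))" for k by simp
  have "continuous_map E E (\<lambda>(u, a). (u, \<lambda>x\<in>topspace (fib u). cnj (a x)))"
    by (rule fibrewise_unary_continuous [where B = 1])
       (auto intro: C0_star_closed simp flip: complex_cnj_diff)
  then show "continuous_map E E (\<lambda>(u, a). (u, cs_star (C0 (fib u)) a))" by simp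
next
  fix \<Phi> u
  assume "eventually (\<lambda>e. e \<in> topspace E) \<Phi> \<and> limitin Y fst u \<Phi> \<and>
    ((\<lambda>(z, a). cs_norm (C0 (fib z)) a) \<longlongrightarrow> 0) \<Phi>"
  then have top: "eventually (\<lambda>e. e \<in> topspace E) \<Phi>" and lim: "limitin Y fst u \<Phi>"
    and norm: "((\<lambda>(z, a). cs_norm (C0 (fib z)) a) \<longlongrightarrow> 0) \<Phi>" by auto
  have u: "u \<in> topspace Y" using lim limitin_topspace by metis
  \<comment> \<open>The zero function is a section through every zero element, and lying in one of
    its tubes means having small fibre norm, so the filter condition can be read off.\<close>
  let ?z = "\<lambda>x\<in>topspace X. 0 :: complex"
  have res0: "res ?z v = cs_zero (C0 (fib v))" for v by (auto simp: topspace_fib)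
  show "limitin E (\<lambda>e. e) (u, cs_zero (C0 (fib u))) \<Phi>"
    unfolding limitin_def
  proof (intro conjI allI impI)
    show "(u, cs_zero (C0 (fib u))) \<in> topspace E"
      using u by (simp add: topspace_E C0_zero_closed)
    fix W assume W: "openin E W \<and> (u, cs_zero (C0 (fib u))) \<in> W"
    have "(u, res ?z u) \<in> W" using W unfolding res0 by blast
    then obtain U \<epsilon> where U: "openin Y U" "u \<in> U" "0 < \<epsilon>" "tube ?z U \<epsilon> \<subseteq> W"
      by (rule tube_neighbourhood_base [OF conjunct1 [OF W] _ C0_zero_closed])
    have "eventually (\<lambda>e. fst e \<in> U) \<Phi>" using lim U by (auto simp: limitin_def)
    moreover have "eventually (\<lambda>e. (case e of (z, a) \<Rightarrow> cs_norm (C0 (fib z)) a) < \<epsilon>) \<Phi>"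
      using order_tendstoD(2) [OF norm U(3)] .
    ultimately show "eventually (\<lambda>e. e \<in> W) \<Phi>" using top
    proof eventually_elim
      case (elim e)
      obtain v a where e: "e = (v, a)" by (cases e)
      have v: "v \<in> topspace Y" and a: "a \<in> cs_carrier (C0 (fib v))" using elim e by (auto simp: topspace_E)
      have "\<forall>x\<in>topspace (fib v). cmod (a x) < \<epsilon>"
        using elim(2) unfolding e by (simp add: C0_norm_less_iff [OF a U(3)])
      then have "e \<in> tube ?z U \<epsilon>"
        using elim a unfolding e tube_iff [OF C0_zero_closed v U(3)] by (auto simp: topspace_fib)
      then show ?case using U(4) by blast
    qed
  qed
qed

end

section \<open>The algebra of C_0-sections of the bundle is C_0(X)\<close>

context fibred_space
begin

lemma Gamma0_sel:
  "cs_carrier (Gamma0 Y (\<lambda>u. C0 (fib u)) E) = {a \<in> (\<Pi>\<^sub>E u\<in>topspace Y. cs_carrier (C0 (fib u))).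
     continuous_map Y E (\<lambda>u. (u, a u)) \<and>
     (\<forall>\<epsilon>>0. compactin Y {u \<in> topspace Y. \<epsilon> \<le> cs_norm (C0 (fib u)) (a u)})}"
  by (simp add: Gamma0_def)

lemma fibre_norm_ge_iff:
  assumes f: "f \<in> cs_carrier (C0 X)" and u: "u \<in> topspace Y" and e: "0 < \<epsilon>"
  shows "\<epsilon> \<le> cs_norm (C0 (fib u)) (res f u) \<longleftrightarrow> (\<exists>x\<in>topspace X. rX x = u \<and> \<epsilon> \<le> cmod (f x))"
  using C0_norm_less_iff [OF res_C0 [OF f u] e] by (auto simp: topspace_fib not_less simp flip: not_le)

lemma section_in_Gamma0:
  assumes f: "f \<in> cs_carrier (C0 X)"
  shows "(\<lambda>u\<in>topspace Y. res f u) \<in> cs_carrier (Gamma0 Y (\<lambda>u. C0 (fib u)) E)"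
  unfolding Gamma0_sel
proof (intro CollectI conjI allI impI)
  have "continuous_map Y E (\<lambda>u. (u, (\<lambda>u\<in>topspace Y. res f u) u)) \<longleftrightarrow> continuous_map Y E (\<lambda>u. (u, res f u))"
    by (rule continuous_map_on_topspace_cong) simp
  then show "continuous_map Y E (\<lambda>u. (u, (\<lambda>u\<in>topspace Y. res f u) u))"
    using section_continuous [OF f] by blast
  fix \<epsilon> :: real assume e: "0 < \<epsilon>"
  have "{u \<in> topspace Y. \<epsilon> \<le> cs_norm (C0 (fib u)) ((\<lambda>u\<in>topspace Y. res f u) u)} =
      rX ` {x \<in> topspace X. \<epsilon> \<le> cmod (f x)}"
    using fibre_norm_ge_iff [OF f _ e] rX_in by (auto simp del: restrict_apply simp: restrict_apply' image_iff)
  then show "compactin Y {u \<in> topspace Y. \<epsilon> \<le> cs_norm (C0 (fib u)) ((\<lambda>u\<in>topspace Y. res f u) u)}"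
    using closedin_rX_image(1) [OF f e] by simp
qed (use res_C0 [OF f] in auto)

text \<open>The values of a section glue to one function F(x) = a(rX x)(x). Near each base point the
  section lies in a tube around some \<open>g\<close> in C_0(X), so \<open>F\<close> is locally a
  uniform limit of continuous functions. Compactness of the set where the norm of \<open>a\<close>
  is at least \<epsilon> makes finitely many such \<open>g\<close> control \<open>F\<close> at
  infinity.\<close>

lemma Gamma0_section:
  assumes a: "a \<in> cs_carrier (Gamma0 Y (\<lambda>u. C0 (fib u)) E)"
  obtains f where "f \<in> cs_carrier (C0 X)" "a = (\<lambda>u\<in>topspace Y. res f u)"
proof -
  have aC: "a u \<in> cs_carrier (C0 (fib u))" if "u \<in> topspace Y" for u
    using a that by (auto simp: Gamma0_sel)
  have aext: "a \<in> extensional (topspace Y)" using a by (auto simp: Gamma0_sel PiE_def)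
  have acont: "continuous_map Y E (\<lambda>u. (u, a u))" using a by (simp add: Gamma0_sel)
  define F where "F x = a (rX x) x" for x
  have near: "\<exists>g U. g \<in> cs_carrier (C0 X) \<and> openin Y U \<and> u \<in> U \<and>
      (\<forall>x\<in>topspace X. rX x \<in> U \<longrightarrow> cmod (g x - F x) < \<epsilon>)" if u: "u \<in> topspace Y" and e: "0 < \<epsilon>" for u \<epsilon>
  proof -
    obtain g where g: "g \<in> cs_carrier (C0 X)" "res g u = a u" using lift_exists [OF u aC [OF u]] .
    let ?W = "tube g (topspace Y) \<epsilon>"
    let ?U = "{v \<in> topspace Y. (v, a v) \<in> ?W}"
    have "openin Y ?U"
      using openin_continuous_map_preimage [OF acont openin_tube [OF g(1) openin_topspace e]] .
    moreover have "cmod (g x - a u x) < \<epsilon>" if "x \<in> topspace X" "rX x = u" for x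
      using g(2) [THEN fun_cong, of x] that e by (simp add: topspace_fib)
    then have "u \<in> ?U" using u aC [OF u] by (simp add: tube_iff [OF g(1) u e])
    moreover have "cmod (g x - F x) < \<epsilon>" if x: "x \<in> topspace X" "rX x \<in> ?U" for x
      using x tube_iff [OF g(1) rX_in [OF x(1)] e] by (auto simp: F_def)
    ultimately show ?thesis using g(1) by blast
  qed
  have "restrict F (topspace X) \<in> cs_carrier (C0 X)"
  proof (rule C0_restrictI)
    show "continuous_map X euclidean F"
      unfolding continuous_map_euclidean_dist
    proof (intro ballI allI impI)
      fix x and \<epsilon> :: real assume x: "x \<in> topspace X" and e: "0 < \<epsilon>"
      obtain g U where g: "g \<in> cs_carrier (C0 X)" and U: "openin Y U" "rX x \<in> U"
        and gF: "\<And>y. y \<in> topspace X \<Longrightarrow> rX y \<in> U \<Longrightarrow> cmod (g y - F y) < \<epsilon>/3"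
        using near [OF rX_in [OF x], of "\<epsilon>/3"] e by auto
      have "\<forall>x\<in>topspace X. \<forall>\<epsilon>>0. \<exists>V. openin X V \<and> x \<in> V \<and> (\<forall>y\<in>V. dist (g y) (g x) < \<epsilon>)"
        using C0_continuous [OF g] unfolding continuous_map_euclidean_dist .
      then obtain V where V: "openin X V" "x \<in> V" "\<forall>y\<in>V. dist (g y) (g x) < \<epsilon>/3"
        using x e by (meson divide_pos_pos zero_less_numeral)
      let ?V = "V \<inter> {y \<in> topspace X. rX y \<in> U}"
      have "dist (F y) (F x) < \<epsilon>" if y: "y \<in> ?V" for y
      proof -
        have "dist (F y) (F x) \<le> dist (F y) (g y) + dist (g y) (g x) + dist (g x) (F x)"
          by (metis dist_triangle dist_triangle_le add_right_mono order_trans)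
        moreover have "dist (F y) (g y) < \<epsilon>/3" using gF [of y] y by (simp add: dist_norm norm_minus_commute)
        moreover have "dist (g x) (F x) < \<epsilon>/3" using gF [of x] x U(2) by (simp add: dist_norm)
        moreover have "dist (g y) (g x) < \<epsilon>/3" using V(3) y by blast
        ultimately show ?thesis by linarith
      qed
      moreover have "openin X ?V"
        using V(1) openin_continuous_map_preimage [OF rX_continuous U(1)] by blast
      ultimately show "\<exists>U. openin X U \<and> x \<in> U \<and> (\<forall>y\<in>U. dist (F y) (F x) < \<epsilon>)"
        using x U V by (intro exI [of _ ?V]) auto
    qed
    fix \<epsilon> :: real assume e: "0 < \<epsilon>"
    let ?C = "{u \<in> topspace Y. \<epsilon> \<le> cs_norm (C0 (fib u)) (a u)}"
    have C: "compactin Y ?C" using a e by (simp add: Gamma0_sel)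
    define Q where "Q u g U \<longleftrightarrow> g \<in> cs_carrier (C0 X) \<and> openin Y U \<and> u \<in> U \<and>
      (\<forall>x\<in>topspace X. rX x \<in> U \<longrightarrow> cmod (g x - F x) < \<epsilon>/2)" for u g U
    have "\<forall>u\<in>?C. \<exists>g U. Q u g U"
      unfolding Q_def by (intro ballI near) (use e in auto)
    then obtain g U where gU: "\<And>u. u \<in> ?C \<Longrightarrow> Q u (g u) (U u)" by metis
    then have g: "\<And>u. u \<in> ?C \<Longrightarrow> g u \<in> cs_carrier (C0 X)"
      and U: "\<And>u. u \<in> ?C \<Longrightarrow> openin Y (U u)" "\<And>u. u \<in> ?C \<Longrightarrow> u \<in> U u"
      and gF: "\<And>u x. u \<in> ?C \<Longrightarrow> x \<in> topspace X \<Longrightarrow> rX x \<in> U u \<Longrightarrow> cmod (g u x - F x) < \<epsilon>/2"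
      unfolding Q_def by blast+
    obtain \<F> where \<F>: "finite \<F>" "\<F> \<subseteq> U ` ?C" "?C \<subseteq> \<Union>\<F>"
      using compactinD [OF C, of "U ` ?C"] U by blast
    obtain D where D: "finite D" "D \<subseteq> ?C" "\<F> = U ` D" using finite_subset_image [OF \<F>(1,2)] by blast
    \<comment> \<open>Where |F| \<ge> \<epsilon>, the approximant belonging to the neighbourhood has
      modulus at least \<epsilon>/2, so finitely many compact superlevel sets contain the superlevel
      set of \<open>F\<close>.\<close>
    let ?K = "\<Union>u\<in>D. {x \<in> topspace X. \<epsilon>/2 \<le> cmod (g u x)}"
    have "compactin X {x \<in> topspace X. \<epsilon>/2 \<le> cmod (g u x)}" if "u \<in> D" for u
      by (rule C0_compactin) (use g D that e in auto)
    then have "compactin X ?K" using D(1) by (intro compactin_Union) auto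
    moreover have "x \<in> ?K" if x: "x \<in> topspace X" "\<epsilon> \<le> cmod (F x)" for x
    proof -
      have "cmod (F x) \<le> cs_norm (C0 (fib (rX x))) (a (rX x))"
        unfolding F_def by (rule C0_norm_upper [OF aC [OF rX_in [OF x(1)]]]) (simp add: topspace_fib x)
      then have "rX x \<in> ?C" using x rX_in by force
      then obtain u where u: "u \<in> D" "rX x \<in> U u" using \<F>(3) D(3) by blast
      then have "cmod (g u x - F x) < \<epsilon>/2" using gF D(2) x by blast
      then have "\<epsilon>/2 \<le> cmod (g u x)" using x(2) norm_triangle_ineq3 [of "g u x" "F x"] by linarith
      then show ?thesis using u x by blast
    qed
    ultimately show "\<exists>K. compactin X K \<and> (\<forall>x\<in>topspace X. \<epsilon> \<le> cmod (F x) \<longrightarrow> x \<in> K)" by blast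
  qed
  moreover have "a = (\<lambda>u\<in>topspace Y. res (restrict F (topspace X)) u)"
  proof (rule extensionalityI [OF aext restrict_extensional])
    fix u assume u: "u \<in> topspace Y"
    have "a u = res (restrict F (topspace X)) u"
      by (rule C0_eqI [OF aC [OF u] res_C0 [OF calculation u]]) (auto simp: F_def topspace_fib)
    then show "a u = (\<lambda>u\<in>topspace Y. res (restrict F (topspace X)) u) u" using u by simp
  qed
  ultimately show thesis using that by blast
qed

theorem star_isomorphism_Gamma0:
  "star_isomorphism (C0 X) (Gamma0 Y (\<lambda>u. C0 (fib u)) E) (\<lambda>f. \<lambda>u\<in>topspace Y. res f u)"
  unfolding star_isomorphism_def
proof (intro conjI ballI allI)
  show "bij_betw (\<lambda>f. \<lambda>u\<in>topspace Y. res f u) (cs_carrier (C0 X)) (cs_carrier (Gamma0 Y (\<lambda>u. C0 (fib u)) E))"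
    unfolding bij_betw_def
  proof
    show "inj_on (\<lambda>f. \<lambda>u\<in>topspace Y. res f u) (cs_carrier (C0 X))"
    proof (rule inj_onI)
      fix f g assume fg: "f \<in> cs_carrier (C0 X)" "g \<in> cs_carrier (C0 X)"
        and eq: "(\<lambda>u\<in>topspace Y. res f u) = (\<lambda>u\<in>topspace Y. res g u)"
      show "f = g"
      proof (rule C0_eqI [OF fg])
        fix x assume x: "x \<in> topspace X"
        have "res f (rX x) x = res g (rX x) x"
          using eq [THEN fun_cong, of "rX x"] rX_in [OF x] by (simp del: restrict_apply add: restrict_apply')
        then show "f x = g x" using x by (simp add: topspace_fib)
      qed
    qed
    show "(\<lambda>f. \<lambda>u\<in>topspace Y. res f u) ` cs_carrier (C0 X) = cs_carrier (Gamma0 Y (\<lambda>u. C0 (fib u)) E)"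
    proof (intro equalityI subsetI)
      fix a assume "a \<in> cs_carrier (Gamma0 Y (\<lambda>u. C0 (fib u)) E)"
      then obtain f where "f \<in> cs_carrier (C0 X)" "a = (\<lambda>u\<in>topspace Y. res f u)"
        by (rule Gamma0_section)
      then show "a \<in> (\<lambda>f. \<lambda>u\<in>topspace Y. res f u) ` cs_carrier (C0 X)" by (intro image_eqI)
    qed (use section_in_Gamma0 in \<open>elim imageE, simp only:\<close>)
  qed
qed (auto simp: Gamma0_def topspace_fib restrict_def fun_eq_iff)

end

section \<open>Groupoids acting on spaces\<close>

text \<open>The continuous left inverse \<open>k\<close> carries the compact superlevel set of
  \<open>f\<close> to a compact set that contains the superlevel set of the composite.\<close>

lemma C0_compose_homeomorphism:
  assumes f: "f \<in> cs_carrier (C0 T')" and h: "continuous_map T T' h" and k: "continuous_map T' T k"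
    and kh: "\<And>x. x \<in> topspace T \<Longrightarrow> k (h x) = x"
  shows "(\<lambda>x\<in>topspace T. f (h x)) \<in> cs_carrier (C0 T)"
proof (rule C0_restrictI)
  show "continuous_map T euclidean (\<lambda>x. f (h x))"
    using continuous_map_compose [OF h C0_continuous [OF f]] by (simp add: o_def)
  fix \<epsilon> :: real assume e: "0 < \<epsilon>"
  have "x \<in> k ` {y \<in> topspace T'. \<epsilon> \<le> cmod (f y)}" if "x \<in> topspace T" "\<epsilon> \<le> cmod (f (h x))" for x
    using that kh [OF that(1)] h by (intro image_eqI [of _ _ "h x"]) (auto simp: continuous_map_def)
  then show "\<exists>K. compactin T K \<and> (\<forall>x\<in>topspace T. \<epsilon> \<le> cmod (f (h x)) \<longrightarrow> x \<in> K)"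
    using image_compactin [OF C0_compactin [OF f e] k] by blast
qed

locale groupoid_space =
  fixes G :: "'g groupoid" and lam :: "'g \<Rightarrow> 'g measure"
    and X :: "'x topology" and rX :: "'x \<Rightarrow> 'g" and act :: "'g \<Rightarrow> 'x \<Rightarrow> 'x"
  assumes topological_groupoid: "topological_groupoid G"
    and second_countable: "second_countable (g_top G)"
    and locally_compact_groupoid: "locally_compact_space (g_top G)"
    and Hausdorff_groupoid: "Hausdorff_space (g_top G)"
    and haar_system: "haar_system G lam"
    and locally_compact_X: "locally_compact_space X" and Hausdorff_X: "Hausdorff_space X"
    and proper_action: "proper_action G X rX act"
begin

abbreviation "r \<equiv> g_range G"
abbreviation "s \<equiv> g_source G"
abbreviation "iv \<equiv> g_inv G"
abbreviation "TG \<equiv> g_top G"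
abbreviation "carr \<equiv> topspace (g_top G)"

lemma groupoid: "groupoid G"
  using topological_groupoid by (simp add: topological_groupoid_def)

lemma groupoid_closed [simp]:
  assumes "\<gamma> \<in> carr"
  shows "r \<gamma> \<in> carr" "s \<gamma> \<in> carr" "iv \<gamma> \<in> carr" "r (r \<gamma>) = r \<gamma>" "s (r \<gamma>) = r \<gamma>" "r (s \<gamma>) = s \<gamma>" "s (s \<gamma>) = s \<gamma>"
    "r (iv \<gamma>) = s \<gamma>" "s (iv \<gamma>) = r \<gamma>" "g_mult G \<gamma> (iv \<gamma>) = r \<gamma>" "g_mult G (iv \<gamma>) \<gamma> = s \<gamma>"
  using groupoid assms by (auto simp: groupoid_def)

lemma groupoid_mult [simp]:
  assumes "\<gamma> \<in> carr" "\<eta> \<in> carr" "s \<gamma> = r \<eta>"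
  shows "g_mult G \<gamma> \<eta> \<in> carr" "r (g_mult G \<gamma> \<eta>) = r \<gamma>" "s (g_mult G \<gamma> \<eta>) = s \<eta>"
  using groupoid assms by (auto simp: groupoid_def)

lemma r_units [simp]: "\<gamma> \<in> carr \<Longrightarrow> r \<gamma> \<in> units G"
  by (auto simp: units_def)

lemma s_units [simp]: "\<gamma> \<in> carr \<Longrightarrow> s \<gamma> \<in> units G"
  using r_units [of "s \<gamma>"] by simp

lemma units_carr: "u \<in> units G \<Longrightarrow> u \<in> carr"
  and units_r: "u \<in> units G \<Longrightarrow> r u = u"
  and units_s: "u \<in> units G \<Longrightarrow> s u = u"
  by (auto simp: units_def)

lemma topspace_unit_space: "topspace (unit_space G) = units G"
  using units_carr by (auto simp: unit_space_def)

lemma continuous_iv: "continuous_map TG TG iv"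
  using topological_groupoid by (simp add: topological_groupoid_def)

text \<open>The axioms mention continuity of multiplication and inversion; range and source inherit
  it from r(\<gamma>) = \<gamma> \<gamma>^-1 and s(\<gamma>) = \<gamma>^-1 \<gamma>.\<close>

lemma continuous_r: "continuous_map TG TG r"
  and continuous_s: "continuous_map TG TG s"
proof -
  have m: "continuous_map (subtopology (prod_topology TG TG) {(\<gamma>, \<eta>). s \<gamma> = r \<eta>}) TG (\<lambda>(\<gamma>, \<eta>). g_mult G \<gamma> \<eta>)"
    using topological_groupoid by (simp add: topological_groupoid_def)
  have "continuous_map TG (subtopology (prod_topology TG TG) {(\<gamma>, \<eta>). s \<gamma> = r \<eta>}) (\<lambda>\<gamma>. (\<gamma>, iv \<gamma>))"
    "continuous_map TG (subtopology (prod_topology TG TG) {(\<gamma>, \<eta>). s \<gamma> = r \<eta>}) (\<lambda>\<gamma>. (iv \<gamma>, \<gamma>))"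
    using continuous_iv by (auto simp: continuous_map_in_subtopology continuous_map_pairwise o_def)
  from this [THEN continuous_map_compose [OF _ m]]
  have mr: "continuous_map TG TG (\<lambda>\<gamma>. g_mult G \<gamma> (iv \<gamma>))"
    and ms: "continuous_map TG TG (\<lambda>\<gamma>. g_mult G (iv \<gamma>) \<gamma>)"
    by (simp_all add: o_def)
  show "continuous_map TG TG r" using mr by (rule continuous_map_eq) simp
  show "continuous_map TG TG s" using ms by (rule continuous_map_eq) simp
qed

lemma continuous_r_unit: "continuous_map TG (unit_space G) r"
  and continuous_s_unit: "continuous_map TG (unit_space G) s"
  using continuous_r continuous_s by (auto simp: unit_space_def continuous_map_in_subtopology)

lemma groupoid_action: "groupoid_action G X rX act"
  using proper_action by (simp add: proper_action_def)

lemma Hausdorff_unit_space: "Hausdorff_space (unit_space G)"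
  using Hausdorff_groupoid by (simp add: unit_space_def Hausdorff_space_subtopology)

sublocale fibred_space "unit_space G" X rX
  by standard (use Hausdorff_unit_space locally_compact_X Hausdorff_X groupoid_action in
      \<open>auto simp: groupoid_action_def\<close>)

lemma rX_units [simp]: "x \<in> topspace X \<Longrightarrow> rX x \<in> units G"
  using rX_in topspace_unit_space by auto

lemma rX_carr [simp]: "x \<in> topspace X \<Longrightarrow> rX x \<in> carr"
  using rX_units units_carr by blast

section \<open>Fibred products of \<open>G\<close> and \<open>X\<close> and their compact
  subsets\<close>

definition GX :: "('g \<times> 'x) topology" where
  "GX = subtopology (prod_topology TG X) {(\<gamma>, x). s \<gamma> = rX x}"

text \<open>The pairs for which \<gamma>^-1 x is defined. Translated functions and integrals over
  range fibres live here, while the action itself lives on \<open>GX\<close>.\<close>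

definition XG :: "('g \<times> 'x) topology" where
  "XG = subtopology (prod_topology TG X) {(\<gamma>, x). r \<gamma> = rX x}"

lemma topspace_GX: "(\<gamma>, x) \<in> topspace GX \<longleftrightarrow> \<gamma> \<in> carr \<and> x \<in> topspace X \<and> s \<gamma> = rX x"
  and topspace_XG: "(\<gamma>, x) \<in> topspace XG \<longleftrightarrow> \<gamma> \<in> carr \<and> x \<in> topspace X \<and> r \<gamma> = rX x"
  by (auto simp: GX_def XG_def)

lemma continuous_act: "continuous_map GX X (\<lambda>(\<gamma>, x). act \<gamma> x)"
  using groupoid_action by (simp add: groupoid_action_def GX_def)

lemma act_closed [simp]:
  assumes "\<gamma> \<in> carr" "x \<in> topspace X" "s \<gamma> = rX x"
  shows "act \<gamma> x \<in> topspace X" "rX (act \<gamma> x) = r \<gamma>"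
proof -
  have "(\<gamma>, x) \<in> topspace GX" using assms by (simp add: topspace_GX)
  then show "act \<gamma> x \<in> topspace X" using funcset_mem [OF continuous_map_funspace [OF continuous_act]] by fastforce
  show "rX (act \<gamma> x) = r \<gamma>" using groupoid_action assms by (auto simp: groupoid_action_def)
qed

lemma act_mult:
  assumes "\<gamma> \<in> carr" "\<eta> \<in> carr" "s \<eta> = r \<gamma>" "x \<in> topspace X" "s \<gamma> = rX x"
  shows "act (g_mult G \<eta> \<gamma>) x = act \<eta> (act \<gamma> x)"
  using groupoid_action assms by (auto simp: groupoid_action_def)

lemma act_unit: "x \<in> topspace X \<Longrightarrow> act (rX x) x = x"
  using groupoid_action by (auto simp: groupoid_action_def)

lemma act_iv_act [simp]:
  "\<gamma> \<in> carr \<Longrightarrow> x \<in> topspace X \<Longrightarrow> s \<gamma> = rX x \<Longrightarrow> act (iv \<gamma>) (act \<gamma> x) = x"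
  using act_mult [of \<gamma> "iv \<gamma>" x] by (simp add: act_unit)

lemma act_act_iv [simp]:
  "\<gamma> \<in> carr \<Longrightarrow> x \<in> topspace X \<Longrightarrow> r \<gamma> = rX x \<Longrightarrow> act \<gamma> (act (iv \<gamma>) x) = x"
  using act_mult [of "iv \<gamma>" \<gamma> x] by (simp add: act_unit)

text \<open>No formula for the inverse of a product is derived in \<open>G\<close>: the point
  \<eta>^-1 (\<gamma>^-1 x) is moved to \<open>x\<close> by \<gamma> \<eta>, and acting by the
  inverse moves it back.\<close>

lemma act_iv_mult:
  assumes "\<gamma> \<in> carr" "\<eta> \<in> carr" "s \<gamma> = r \<eta>" "x \<in> topspace X" "r \<gamma> = rX x"
  shows "act (iv (g_mult G \<gamma> \<eta>)) x = act (iv \<eta>) (act (iv \<gamma>) x)"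
proof -
  let ?y = "act (iv \<eta>) (act (iv \<gamma>) x)"
  have y: "?y \<in> topspace X" "rX ?y = s \<eta>" using assms by auto
  have "act (g_mult G \<gamma> \<eta>) ?y = x" using assms y by (simp add: act_mult)
  then show ?thesis using act_iv_act [of "g_mult G \<gamma> \<eta>" ?y] assms y by simp
qed

lemma continuous_act_pair: "continuous_map GX XG (\<lambda>(\<gamma>, x). (\<gamma>, act \<gamma> x))"
  and continuous_act_iv_pair: "continuous_map XG GX (\<lambda>(\<gamma>, x). (iv \<gamma>, x))"
proof -
  have "continuous_map GX TG fst" "continuous_map XG TG fst" "continuous_map XG X snd"
    by (auto simp: GX_def XG_def intro: continuous_map_from_subtopology continuous_map_fst continuous_map_snd)
  then show "continuous_map GX XG (\<lambda>(\<gamma>, x). (\<gamma>, act \<gamma> x))"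
    "continuous_map XG GX (\<lambda>(\<gamma>, x). (iv \<gamma>, x))"
    using continuous_act continuous_map_compose [OF _ continuous_iv]
    by (auto simp: XG_def GX_def continuous_map_in_subtopology continuous_map_pairwise o_def case_prod_unfold)
qed

lemma continuous_act_iv: "continuous_map XG X (\<lambda>(\<gamma>, x). act (iv \<gamma>) x)"
  using continuous_map_compose [OF continuous_act_iv_pair continuous_act]
  by (simp add: o_def case_prod_unfold)

lemma continuous_flip: "continuous_map XG GX (\<lambda>(\<gamma>, x). (\<gamma>, act (iv \<gamma>) x))"
proof -
  have "continuous_map XG TG fst"
    by (auto simp: XG_def intro: continuous_map_from_subtopology continuous_map_fst)
  then show ?thesis
    using continuous_act_iv
    by (auto simp: GX_def continuous_map_in_subtopology continuous_map_pairwise o_def case_prod_unfold topspace_XG)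
qed

lemma continuous_fst_GX: "continuous_map GX TG fst"
  and continuous_fst_XG: "continuous_map XG TG fst"
  and continuous_snd_GX: "continuous_map GX X snd"
  and continuous_snd_XG: "continuous_map XG X snd"
  by (auto simp: GX_def XG_def intro: continuous_map_from_subtopology continuous_map_fst continuous_map_snd)

text \<open>Properness of the action enters here and nowhere else: the set is the preimage of
  \<open>L \<times> K\<close> under (\<gamma>, x) \<mapsto> (\<gamma> x, x).\<close>

lemma compactin_GX:
  assumes "compactin X K" "compactin X L"
  shows "compactin GX {(\<gamma>, x) \<in> topspace GX. x \<in> K \<and> act \<gamma> x \<in> L}"
proof -
  have "proper_map GX (prod_topology X X) (\<lambda>(\<gamma>, x). (act \<gamma> x, x))"
    using proper_action by (simp add: proper_action_def GX_def)
  moreover have "compactin (prod_topology X X) (L \<times> K)" using assms by (simp add: compactin_Times)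
  ultimately have "compactin GX {z \<in> topspace GX. (case z of (\<gamma>, x) \<Rightarrow> (act \<gamma> x, x)) \<in> L \<times> K}"
    by (rule compactin_proper_map_preimage)
  moreover have "{z \<in> topspace GX. (case z of (\<gamma>, x) \<Rightarrow> (act \<gamma> x, x)) \<in> L \<times> K} =
    {(\<gamma>, x) \<in> topspace GX. x \<in> K \<and> act \<gamma> x \<in> L}" by auto
  ultimately show ?thesis by simp
qed

text \<open>The continuous map (\<gamma>, x) \<mapsto> (\<gamma>, \<gamma> x) carries the compact
  set of \<open>compactin_GX\<close>, with the roles of \<open>K\<close> and \<open>L\<close>
  exchanged, onto this one.\<close>

lemma compactin_XG:
  assumes "compactin X K" "compactin X L"
  shows "compactin XG {(\<gamma>, x) \<in> topspace XG. x \<in> K \<and> act (iv \<gamma>) x \<in> L}"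
proof -
  have "{(\<gamma>, x) \<in> topspace XG. x \<in> K \<and> act (iv \<gamma>) x \<in> L} =
      (\<lambda>(\<gamma>, x). (\<gamma>, act \<gamma> x)) ` {(\<gamma>, x) \<in> topspace GX. x \<in> L \<and> act \<gamma> x \<in> K}"
  proof (intro equalityI subsetI)
    fix z assume "z \<in> {(\<gamma>, x) \<in> topspace XG. x \<in> K \<and> act (iv \<gamma>) x \<in> L}"
    then obtain \<gamma> x where z: "z = (\<gamma>, x)" "\<gamma> \<in> carr" "x \<in> topspace X" "r \<gamma> = rX x" "x \<in> K" "act (iv \<gamma>) x \<in> L"
      by (auto simp: topspace_XG)
    then show "z \<in> (\<lambda>(\<gamma>, x). (\<gamma>, act \<gamma> x)) ` {(\<gamma>, x) \<in> topspace GX. x \<in> L \<and> act \<gamma> x \<in> K}"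
      by (intro image_eqI [of _ _ "(\<gamma>, act (iv \<gamma>) x)"]) (auto simp: topspace_GX)
  qed (auto simp: topspace_GX topspace_XG)
  then show ?thesis using image_compactin [OF compactin_GX [OF assms(2,1)] continuous_act_pair] by simp
qed

text \<open>The fibred products are closed in the full product because the unit space is Hausdorff,
  so they meet a product of compact sets in a compact set. Here compactness comes from a bound on
  \<gamma> and not from properness.\<close>

lemma compactin_GX_Times:
  assumes N: "compactin TG N" and K: "compactin X K"
  shows "compactin GX {(\<gamma>, x) \<in> topspace GX. \<gamma> \<in> N \<and> x \<in> K}"
    and "compactin XG {(\<gamma>, x) \<in> topspace XG. \<gamma> \<in> N \<and> x \<in> K}"
proof -
  let ?P = "prod_topology TG X"
  have c: "continuous_map ?P (unit_space G) (\<lambda>z. s (fst z))" "continuous_map ?P (unit_space G) (\<lambda>z. r (fst z))"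
    "continuous_map ?P (unit_space G) (\<lambda>z. rX (snd z))"
    using continuous_map_compose [OF continuous_map_fst continuous_s_unit]
      continuous_map_compose [OF continuous_map_fst continuous_r_unit]
      continuous_map_compose [OF continuous_map_snd rX_continuous] by (auto simp: o_def)
  have cl: "closedin ?P {z \<in> topspace ?P. s (fst z) = rX (snd z)}" "closedin ?P {z \<in> topspace ?P. r (fst z) = rX (snd z)}"
    by (rule closedin_continuous_maps_eq [OF Hausdorff_unit_space]; rule c)+
  have NK: "compactin ?P (N \<times> K)" using N K by (simp add: compactin_Times)
  have sub: "N \<subseteq> carr" "K \<subseteq> topspace X" using N K compactin_subset_topspace by auto
  have "{(\<gamma>, x) \<in> topspace GX. \<gamma> \<in> N \<and> x \<in> K} = (N \<times> K) \<inter> {z \<in> topspace ?P. s (fst z) = rX (snd z)}"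
    "{(\<gamma>, x) \<in> topspace XG. \<gamma> \<in> N \<and> x \<in> K} = (N \<times> K) \<inter> {z \<in> topspace ?P. r (fst z) = rX (snd z)}"
    using sub by (auto simp: topspace_GX topspace_XG)
  then show "compactin GX {(\<gamma>, x) \<in> topspace GX. \<gamma> \<in> N \<and> x \<in> K}"
    "compactin XG {(\<gamma>, x) \<in> topspace XG. \<gamma> \<in> N \<and> x \<in> K}"
    using compact_Int_closedin [OF NK cl(1)] compact_Int_closedin [OF NK cl(2)]
    by (auto simp: GX_def XG_def compactin_subtopology)
qed

lemma compactin_GX_act:
  assumes N: "compactin TG N" and K: "compactin X K"
  shows "compactin GX {(\<gamma>, x) \<in> topspace GX. \<gamma> \<in> N \<and> act \<gamma> x \<in> K}"
proof -
  have "{(\<gamma>, x) \<in> topspace GX. \<gamma> \<in> N \<and> act \<gamma> x \<in> K} =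
      (\<lambda>(\<gamma>, x). (\<gamma>, act (iv \<gamma>) x)) ` {(\<gamma>, x) \<in> topspace XG. \<gamma> \<in> N \<and> x \<in> K}"
  proof (intro equalityI subsetI)
    fix z assume "z \<in> {(\<gamma>, x) \<in> topspace GX. \<gamma> \<in> N \<and> act \<gamma> x \<in> K}"
    then obtain \<gamma> x where z: "z = (\<gamma>, x)" "\<gamma> \<in> carr" "x \<in> topspace X" "s \<gamma> = rX x" "\<gamma> \<in> N" "act \<gamma> x \<in> K"
      by (auto simp: topspace_GX)
    then show "z \<in> (\<lambda>(\<gamma>, x). (\<gamma>, act (iv \<gamma>) x)) ` {(\<gamma>, x) \<in> topspace XG. \<gamma> \<in> N \<and> x \<in> K}"
      by (intro image_eqI [of _ _ "(\<gamma>, act \<gamma> x)"]) (auto simp: topspace_XG)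
  qed (auto simp: topspace_GX topspace_XG)
  then show ?thesis using image_compactin [OF compactin_GX_Times(2) [OF assms] continuous_flip] by simp
qed

section \<open>Translation between the fibres and its continuity on the bundle\<close>

definition lt :: "'g \<Rightarrow> ('x \<Rightarrow> complex) \<Rightarrow> 'x \<Rightarrow> complex" where
  "lt \<gamma> a = (\<lambda>x\<in>topspace (fib (r \<gamma>)). a (act (iv \<gamma>) x))"

lemma continuous_act_fibre:
  assumes "\<gamma> \<in> carr"
  shows "continuous_map (fib (s \<gamma>)) (fib (r \<gamma>)) (act \<gamma>)"
proof -
  have "continuous_map (fib (s \<gamma>)) GX (\<lambda>x. (\<gamma>, x))"
    using assms by (auto simp: GX_def fibre_space_def continuous_map_in_subtopology continuous_map_pairwise o_def
        intro: continuous_map_from_subtopology)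
  from continuous_map_compose [OF this continuous_act] have "continuous_map (fib (s \<gamma>)) X (act \<gamma>)"
    by (simp add: o_def)
  then show ?thesis
    using assms by (auto simp: fibre_space_def [of _ _ "r \<gamma>"] continuous_map_in_subtopology topspace_fib)
qed

lemma lt_C0:
  assumes g: "\<gamma> \<in> carr" and a: "a \<in> cs_carrier (C0 (fib (s \<gamma>)))"
  shows "lt \<gamma> a \<in> cs_carrier (C0 (fib (r \<gamma>)))"
  unfolding lt_def
  by (rule C0_compose_homeomorphism [OF a, of _ _ "act \<gamma>"])
     (use continuous_act_fibre [of \<gamma>] continuous_act_fibre [of "iv \<gamma>"] g in \<open>auto simp: topspace_fib\<close>)

lemma lt_star_isomorphism:
  assumes g: "\<gamma> \<in> carr"
  shows "star_isomorphism (C0 (fib (s \<gamma>))) (C0 (fib (r \<gamma>))) (lt \<gamma>)"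
  unfolding star_isomorphism_def
proof (intro conjI ballI allI)
  show "bij_betw (lt \<gamma>) (cs_carrier (C0 (fib (s \<gamma>)))) (cs_carrier (C0 (fib (r \<gamma>))))"
  proof (rule bij_betw_byWitness [where f' = "\<lambda>b. \<lambda>x\<in>topspace (fib (s \<gamma>)). b (act \<gamma> x)"])
    have inv: "(\<lambda>x\<in>topspace (fib (s \<gamma>)). b (act \<gamma> x)) \<in> cs_carrier (C0 (fib (s \<gamma>)))"
      if "b \<in> cs_carrier (C0 (fib (r \<gamma>)))" for b
      by (rule C0_compose_homeomorphism [OF that, of _ _ "act (iv \<gamma>)"])
         (use continuous_act_fibre [of \<gamma>] continuous_act_fibre [of "iv \<gamma>"] g in \<open>auto simp: topspace_fib\<close>)
    then show "(\<lambda>b. \<lambda>x\<in>topspace (fib (s \<gamma>)). b (act \<gamma> x)) ` cs_carrier (C0 (fib (r \<gamma>))) \<subseteq> cs_carrier (C0 (fib (s \<gamma>)))"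
      by blast
    show "lt \<gamma> ` cs_carrier (C0 (fib (s \<gamma>))) \<subseteq> cs_carrier (C0 (fib (r \<gamma>)))"
      using lt_C0 [OF g] by blast
    show "\<forall>a\<in>cs_carrier (C0 (fib (s \<gamma>))). (\<lambda>x\<in>topspace (fib (s \<gamma>)). lt \<gamma> a (act \<gamma> x)) = a"
    proof
      fix a assume a: "a \<in> cs_carrier (C0 (fib (s \<gamma>)))"
      show "(\<lambda>x\<in>topspace (fib (s \<gamma>)). lt \<gamma> a (act \<gamma> x)) = a"
        by (rule C0_eqI [OF inv [OF lt_C0 [OF g a]] a]) (use g in \<open>auto simp: lt_def topspace_fib\<close>)
    qed
    show "\<forall>b\<in>cs_carrier (C0 (fib (r \<gamma>))). lt \<gamma> (\<lambda>x\<in>topspace (fib (s \<gamma>)). b (act \<gamma> x)) = b"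
    proof
      fix b assume b: "b \<in> cs_carrier (C0 (fib (r \<gamma>)))"
      show "lt \<gamma> (\<lambda>x\<in>topspace (fib (s \<gamma>)). b (act \<gamma> x)) = b"
        by (rule C0_eqI [OF lt_C0 [OF g inv [OF b]] b]) (use g in \<open>auto simp: lt_def topspace_fib\<close>)
    qed
  qed
qed (use g in \<open>auto simp: lt_def topspace_fib fun_eq_iff\<close>)

text \<open>Let \<open>f\<close> be a section through \<open>a\<close> and \<open>h\<close> one
  through its translate. The function D(\<gamma>', x) = f(x) - h(\<gamma>' x) is zero over \<gamma>;
  over a compact neighbourhood of \<gamma> it is large only on a compact set, whose projection to
  \<open>G\<close> can be removed from the neighbourhood. The other half of the error is the radius
  \<epsilon>/2 of a tube around \<open>f\<close>.\<close>

lemma lt_continuous: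
  "continuous_map (subtopology (prod_topology TG E) {(\<gamma>, (y, a)). s \<gamma> = y}) E (\<lambda>(\<gamma>, (y, a)). (r \<gamma>, lt \<gamma> a))"
  (is "continuous_map ?T E ?\<phi>")
proof (rule continuous_map_into_E)
  fix t assume "t \<in> topspace ?T"
  then obtain \<gamma> a where t: "t = (\<gamma>, (s \<gamma>, a))" and g: "\<gamma> \<in> carr" and a: "a \<in> cs_carrier (C0 (fib (s \<gamma>)))"
    by (auto simp: topspace_E)
  have sg: "s \<gamma> \<in> topspace (unit_space G)" "r \<gamma> \<in> topspace (unit_space G)"
    using g by (auto simp: topspace_unit_space)
  show "?\<phi> t \<in> topspace E" using lt_C0 [OF g a] g by (simp add: t topspace_E topspace_unit_space)
  obtain f where f: "f \<in> cs_carrier (C0 X)" "res f (s \<gamma>) = a" using lift_exists [OF sg(1) a] .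
  obtain h where h: "h \<in> cs_carrier (C0 X)" "res h (r \<gamma>) = lt \<gamma> a" using lift_exists [OF sg(2) lt_C0 [OF g a]] .
  have fx: "f x = a x" if "x \<in> topspace X" "rX x = s \<gamma>" for x
    using f(2) [THEN fun_cong, of x] that by (simp add: topspace_fib)
  have hx: "h x = a (act (iv \<gamma>) x)" if "x \<in> topspace X" "rX x = r \<gamma>" for x
    using h(2) [THEN fun_cong, of x] that by (simp add: topspace_fib lt_def)
  have "\<exists>V. openin ?T V \<and> t \<in> V \<and> (\<forall>t'\<in>V. ?\<phi> t' \<in> tube h U \<epsilon>)"
    if U: "openin (unit_space G) U" "r \<gamma> \<in> U" and e: "0 < \<epsilon>" for U \<epsilon>
  proof -
    obtain W N where W: "openin TG W" "compactin TG N" "\<gamma> \<in> W" "W \<subseteq> N"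
      using locally_compact_groupoid g unfolding locally_compact_space_def by blast
    define D where "D z = f (snd z) - h (act (fst z) (snd z))" for z
    have contD: "continuous_map GX euclidean D"
      using continuous_map_compose [OF continuous_snd_GX C0_continuous [OF f(1)]]
        continuous_map_compose [OF continuous_act C0_continuous [OF h(1)]]
      unfolding D_def by (intro continuous_map_diff) (auto simp: o_def case_prod_unfold)
    \<comment> \<open>The threshold \<epsilon>/4 is such that |D| \<ge> \<epsilon>/2 forces |f| or
      |h| to reach it; both sets are compact since \<gamma>' stays in the compact set
      \<open>N\<close>.\<close>
    let ?Kf = "{(\<gamma>', x) \<in> topspace GX. \<gamma>' \<in> N \<and> x \<in> {x \<in> topspace X. \<epsilon>/4 \<le> cmod (f x)}}"
    let ?Kh = "{(\<gamma>', x) \<in> topspace GX. \<gamma>' \<in> N \<and> act \<gamma>' x \<in> {x \<in> topspace X. \<epsilon>/4 \<le> cmod (h x)}}"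
    have K: "compactin GX (?Kf \<union> ?Kh)"
      using e by (intro compactin_Un compactin_GX_Times(1) compactin_GX_act W(2) C0_compactin f(1) h(1)) auto
    have "closedin GX {z \<in> topspace GX. \<epsilon>/2 \<le> cmod (D z)}"
      using contD by (rule closedin_continuous_cmod_ge)
    then have C: "compactin GX ((?Kf \<union> ?Kh) \<inter> {z \<in> topspace GX. \<epsilon>/2 \<le> cmod (D z)})" (is "compactin GX ?C")
      by (rule compact_Int_closedin [OF K])
    have inC: "z \<in> ?C" if "z \<in> topspace GX" "fst z \<in> N" "\<epsilon>/2 \<le> cmod (D z)" for z
    proof -
      have "cmod (D z) \<le> cmod (f (snd z)) + cmod (h (act (fst z) (snd z)))"
        unfolding D_def by (rule norm_triangle_ineq4)
      then have "\<epsilon>/4 \<le> cmod (f (snd z)) \<or> \<epsilon>/4 \<le> cmod (h (act (fst z) (snd z)))"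
        using that(3) by linarith
      then show ?thesis using that by (cases z) (auto simp: topspace_GX)
    qed
    have "closedin TG (fst ` ?C)"
      using image_compactin [OF C continuous_fst_GX] compactin_imp_closedin [OF Hausdorff_groupoid] by blast
    then have W': "openin TG (W - fst ` ?C)" using W(1) by blast
    have "\<gamma> \<notin> fst ` ?C"
    proof
      assume "\<gamma> \<in> fst ` ?C"
      then obtain x where "(\<gamma>, x) \<in> topspace GX" "\<epsilon>/2 \<le> cmod (D (\<gamma>, x))" by auto
      then show False using e g by (auto simp: topspace_GX D_def fx hx)
    qed
    let ?U' = "{\<gamma> \<in> carr. r \<gamma> \<in> U}"
    have U': "openin TG ?U'" using openin_continuous_map_preimage [OF continuous_r_unit U(1)] .
    let ?tu = "tube f (units G) (\<epsilon>/2)"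
    have "openin E ?tu"
      using openin_tube [OF f(1), of "units G" "\<epsilon>/2"] e topspace_unit_space by (metis half_gt_zero openin_topspace)
    then have V1: "openin ?T ({(\<gamma>, (y, a)). s \<gamma> = y} \<inter> (((W - fst ` ?C) \<inter> ?U') \<times> ?tu))" (is "openin ?T ?V")
      using W' U' by (intro openin_subtopology_Int2) (auto simp: openin_prod_Times_iff)
    have V2: "t \<in> ?V"
      using W(3) \<open>\<gamma> \<notin> fst ` ?C\<close> g U(2) a fx e sg
      by (simp add: t tube_iff [OF f(1) sg(1), of "\<epsilon>/2"])
    have V3: "?\<phi> t' \<in> tube h U \<epsilon>" if t': "t' \<in> ?V" for t'
    proof -
      obtain \<gamma>' a' where tt: "t' = (\<gamma>', (s \<gamma>', a'))" and g': "\<gamma>' \<in> carr" "\<gamma>' \<in> W" "\<gamma>' \<notin> fst ` ?C" "r \<gamma>' \<in> U"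
        and tu: "(s \<gamma>', a') \<in> ?tu" using t' by auto
      have sg': "s \<gamma>' \<in> topspace (unit_space G)" "r \<gamma>' \<in> topspace (unit_space G)"
        using g' by (auto simp: topspace_unit_space)
      have a': "a' \<in> cs_carrier (C0 (fib (s \<gamma>')))"
        "\<And>x. x \<in> topspace X \<Longrightarrow> rX x = s \<gamma>' \<Longrightarrow> cmod (f x - a' x) < \<epsilon>/2"
        using tu e by (auto simp: tube_iff [OF f(1) sg'(1)])
      have "cmod (h x - lt \<gamma>' a' x) < \<epsilon>" if x: "x \<in> topspace X" "rX x = r \<gamma>'" for x
      proof -
        let ?y = "act (iv \<gamma>') x"
        have y: "?y \<in> topspace X" "rX ?y = s \<gamma>'" "act \<gamma>' ?y = x" using g' x by auto
        have nC: "(\<gamma>', ?y) \<notin> ?C" using g'(3) by force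
        have z: "(\<gamma>', ?y) \<in> topspace GX" "fst (\<gamma>', ?y) \<in> N" using g' W(4) y by (auto simp: topspace_GX)
        have "cmod (D (\<gamma>', ?y)) < \<epsilon>/2"
        proof (rule ccontr)
          assume "\<not> ?thesis"
          then have "\<epsilon>/2 \<le> cmod (D (\<gamma>', ?y))" by simp
          from inC [OF z this] nC show False by contradiction
        qed
        then have "cmod (f ?y - h x) < \<epsilon>/2" by (simp add: D_def y)
        moreover have "cmod (f ?y - a' ?y) < \<epsilon>/2" by (rule a'(2) [OF y(1,2)])
        moreover have "cmod (h x - a' ?y) \<le> cmod (f ?y - h x) + cmod (f ?y - a' ?y)"
          using norm_triangle_ineq [of "h x - f ?y" "f ?y - a' ?y"] by (simp add: norm_minus_commute)
        ultimately show ?thesis using x by (simp add: lt_def topspace_fib)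
      qed
      then show ?thesis using g' lt_C0 [OF g'(1) a'(1)]
        by (simp add: tt tube_iff [OF h(1) sg'(2) e])
    qed
    show ?thesis by (intro exI [of _ ?V] conjI ballI V1 V2 V3)
  qed
  then show "\<exists>f\<in>cs_carrier (C0 X). res f (fst (?\<phi> t)) = snd (?\<phi> t) \<and>
      (\<forall>U \<epsilon>. openin (unit_space G) U \<and> fst (?\<phi> t) \<in> U \<and> 0 < \<epsilon> \<longrightarrow>
         (\<exists>V. openin ?T V \<and> t \<in> V \<and> (\<forall>t'\<in>V. ?\<phi> t' \<in> tube f U \<epsilon>)))"
    using h by (intro bexI [of _ h]) (auto simp: t simp del: restrict_apply)
qed

abbreviation "Sys \<equiv> C0_system G X rX act"

lemma C0_system_sel:
  "sys_alg Sys = C0 X" "sys_fibre Sys = (\<lambda>u. C0 (fib u))" "sys_total Sys = E"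
  "sys_eval Sys = (\<lambda>f. \<lambda>u\<in>units G. res f u)" "sys_act Sys = lt"
  by (auto simp: C0_system_def E_def lt_def fun_eq_iff)

theorem groupoid_dynamical_system_C0:
  assumes "separable_space (cs_topology (C0 X))"
  shows "groupoid_dynamical_system G Sys"
  unfolding groupoid_dynamical_system_def C0_system_sel
proof (intro conjI ballI impI)
  show "star_isomorphism (C0 X) (Gamma0 (unit_space G) (\<lambda>u. C0 (fib u)) E) (\<lambda>f. \<lambda>u\<in>units G. res f u)"
    using star_isomorphism_Gamma0 unfolding topspace_unit_space .
  fix \<gamma> \<eta> a assume "\<gamma> \<in> carr" "\<eta> \<in> carr" "s \<gamma> = r \<eta>"
  then show "lt (g_mult G \<gamma> \<eta>) a = lt \<gamma> (lt \<eta> a)"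
    by (auto simp: lt_def topspace_fib fun_eq_iff act_iv_mult)
qed (use usc_cstar_bundle_C0 cstar_algebra_C0 assms lt_star_isomorphism lt_continuous in blast)+

end

section \<open>Integration along the orbits\<close>

lemma space_borel_of: "space (borel_of T) = topspace T"
  by (simp add: borel_of_def space_measure_of_conv)

lemma sets_borel_of_openin: "openin T U \<Longrightarrow> U \<in> sets (borel_of T)"
  unfolding borel_of_def by (subst sets_measure_of) (auto dest: openin_subset)

lemma sets_borel_of_closedin:
  assumes "closedin T C"
  shows "C \<in> sets (borel_of T)"
proof -
  have "space (borel_of T) - (topspace T - C) \<in> sets (borel_of T)"
    using assms by (intro sets.compl_sets sets_borel_of_openin) auto
  moreover have "space (borel_of T) - (topspace T - C) = C"
    using closedin_subset [OF assms] by (auto simp: space_borel_of)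
  ultimately show ?thesis by simp
qed

lemma borel_measurable_continuous_map:
  fixes f :: "'x \<Rightarrow> 'b::topological_space"
  assumes "continuous_map T euclidean f" "sets M = sets (borel_of T)" "space M = topspace T"
  shows "f \<in> borel_measurable M"
proof (rule borel_measurableI)
  fix S :: "'b set" assume "open S"
  then have "openin T {x \<in> topspace T. f x \<in> S}"
    using assms(1) by (intro openin_continuous_map_preimage [where Y = euclidean]) auto
  moreover have "f -` S \<inter> space M = {x \<in> topspace T. f x \<in> S}" using assms(3) by auto
  ultimately show "f -` S \<inter> space M \<in> sets M" using assms(2) sets_borel_of_openin by auto
qed

section \<open>The norm of the kernel \<open>E_inner\<close> and its semicontinuity\<close>

context groupoid_space
begin

text \<open>The common scalar form of the kernel \<open>E_inner\<close> (with \<open>b\<close>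
  conjugated) and of the integrand that defines the inner product with values in the
  multipliers.\<close>

definition corr :: "('x \<Rightarrow> complex) \<Rightarrow> ('x \<Rightarrow> complex) \<Rightarrow> 'g \<times> 'x \<Rightarrow> complex" where
  "corr a b z = a (snd z) * b (act (iv (fst z)) (snd z))"

lemma continuous_corr:
  assumes "continuous_map X euclidean a" "continuous_map X euclidean b"
  shows "continuous_map XG euclidean (corr a b)"
  using continuous_map_compose [OF continuous_snd_XG assms(1)]
    continuous_map_compose [OF continuous_act_iv assms(2)]
  unfolding corr_def by (intro continuous_map_mult) (auto simp: o_def case_prod_unfold)

lemma corr_support:
  assumes a: "a \<in> Cc X" and b: "b \<in> Cc X"
  obtains P where "compactin XG P" "\<And>z. z \<in> topspace XG \<Longrightarrow> corr a b z \<noteq> 0 \<Longrightarrow> z \<in> P"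
proof -
  obtain K where K: "compactin X K" "\<And>x. x \<in> topspace X \<Longrightarrow> a x \<noteq> 0 \<Longrightarrow> x \<in> K"
    using a by (rule Cc_supp) blast
  obtain L where L: "compactin X L" "\<And>x. x \<in> topspace X \<Longrightarrow> b x \<noteq> 0 \<Longrightarrow> x \<in> L"
    using b by (rule Cc_supp) blast
  show thesis
    by (rule that [OF compactin_XG [OF K(1) L(1)]])
       (use K(2) L(2) in \<open>auto simp: corr_def topspace_XG\<close>)
qed

lemma compactin_fst_XG_closed:
  assumes "compactin XG P"
  shows "compactin TG (fst ` P)" "closedin TG (fst ` P)"
proof -
  show "compactin TG (fst ` P)" by (rule image_compactin [OF assms continuous_fst_XG])
  then show "closedin TG (fst ` P)" by (rule compactin_imp_closedin [OF Hausdorff_groupoid])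
qed

lemma compactin_snd_XG_closed:
  assumes "compactin XG P"
  shows "compactin X (snd ` P)" "closedin X (snd ` P)"
proof -
  show "compactin X (snd ` P)" by (rule image_compactin [OF assms continuous_snd_XG])
  then show "closedin X (snd ` P)" by (rule compactin_imp_closedin [OF Hausdorff_X])
qed

text \<open>The projection of \<open>XG\<close> to \<open>G\<close> is the pullback of
  \<open>rX\<close> along \<open>r\<close>, and pullbacks of open maps are open.\<close>

lemma open_map_fst_XG:
  assumes rX: "open_map X (unit_space G) rX"
  shows "open_map XG TG fst"
  unfolding open_map_def
proof (intro allI impI)
  fix W assume "openin XG W"
  then obtain W' where W': "openin (prod_topology TG X) W'" "W = W' \<inter> {(\<gamma>, x). r \<gamma> = rX x}"
    by (auto simp: XG_def openin_subtopology)
  have "\<exists>T. openin TG T \<and> \<gamma> \<in> T \<and> T \<subseteq> fst ` W" if gW: "\<gamma> \<in> fst ` W" for \<gamma>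
  proof -
    obtain x where x: "(\<gamma>, x) \<in> W'" "r \<gamma> = rX x" using gW W'(2) by auto
    then obtain U V where UV: "openin TG U" "openin X V" "\<gamma> \<in> U" "x \<in> V" "U \<times> V \<subseteq> W'"
      using W'(1) unfolding openin_prod_topology_alt by metis
    have "openin (unit_space G) (rX ` V)" using rX UV(2) by (simp add: open_map_def)
    then have "openin TG {\<gamma> \<in> carr. r \<gamma> \<in> rX ` V}"
      by (rule openin_continuous_map_preimage [OF continuous_r_unit])
    then have "openin TG (U \<inter> {\<gamma> \<in> carr. r \<gamma> \<in> rX ` V})" using UV(1) by blast
    moreover have "\<gamma> \<in> U \<inter> {\<gamma> \<in> carr. r \<gamma> \<in> rX ` V}"
      using UV x openin_subset [OF UV(1)] by auto
    moreover have "U \<inter> {\<gamma> \<in> carr. r \<gamma> \<in> rX ` V} \<subseteq> fst ` W"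
    proof clarify
      fix \<eta> y assume "\<eta> \<in> U" "r \<eta> = rX y" "y \<in> V"
      then have "(\<eta>, y) \<in> W" using UV(5) W'(2) by auto
      then show "\<eta> \<in> fst ` W" by force
    qed
    ultimately show ?thesis by blast
  qed
  then show "openin TG (fst ` W)" by (subst openin_subopen) blast
qed

definition inner_norm :: "('x \<Rightarrow> complex) \<Rightarrow> ('x \<Rightarrow> complex) \<Rightarrow> 'g \<Rightarrow> real" where
  "inner_norm a b \<gamma> = cs_norm (sys_fibre Sys (r \<gamma>)) (E_inner G Sys a b \<gamma>)"

lemma E_inner_C0:
  assumes a: "a \<in> Cc X" and b: "b \<in> Cc X" and g: "\<gamma> \<in> carr"
  shows "E_inner G Sys a b \<gamma> \<in> cs_carrier (C0 (fib (r \<gamma>)))"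
    and "x \<in> topspace (fib (r \<gamma>)) \<Longrightarrow> E_inner G Sys a b \<gamma> x = corr a (\<lambda>x. cnj (b x)) (\<gamma>, x)"
proof -
  have u: "r \<gamma> \<in> topspace (unit_space G)" "s \<gamma> \<in> topspace (unit_space G)"
    using g by (auto simp: topspace_unit_space)
  have aC: "a \<in> cs_carrier (C0 X)" and bC: "b \<in> cs_carrier (C0 X)" using a b Cc_subset_C0 by auto
  have eq: "E_inner G Sys a b \<gamma> = (\<lambda>x\<in>topspace (fib (r \<gamma>)). res a (r \<gamma>) x *
      lt \<gamma> (\<lambda>x\<in>topspace (fib (s \<gamma>)). cnj (res b (s \<gamma>) x)) x)"
    using g by (simp add: E_inner_def C0_system_sel)
  show "E_inner G Sys a b \<gamma> \<in> cs_carrier (C0 (fib (r \<gamma>)))"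
    unfolding eq by (intro C0_mult_closed lt_C0 C0_star_closed res_C0 aC bC g u)
  show "x \<in> topspace (fib (r \<gamma>)) \<Longrightarrow> E_inner G Sys a b \<gamma> x = corr a (\<lambda>x. cnj (b x)) (\<gamma>, x)"
    unfolding eq using g by (auto simp: topspace_fib lt_def corr_def)
qed

lemma inner_norm_nonneg: "a \<in> Cc X \<Longrightarrow> b \<in> Cc X \<Longrightarrow> \<gamma> \<in> carr \<Longrightarrow> 0 \<le> inner_norm a b \<gamma>"
  unfolding inner_norm_def C0_system_sel by (intro C0_norm_nonneg E_inner_C0)

lemma inner_norm_less_iff:
  assumes a: "a \<in> Cc X" and b: "b \<in> Cc X" and g: "\<gamma> \<in> carr" and t: "0 < t"
  shows "inner_norm a b \<gamma> < t \<longleftrightarrow>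
    (\<forall>x. (\<gamma>, x) \<in> topspace XG \<longrightarrow> cmod (corr a (\<lambda>x. cnj (b x)) (\<gamma>, x)) < t)"
  unfolding inner_norm_def C0_system_sel C0_norm_less_iff [OF E_inner_C0(1) [OF a b g] t]
  using E_inner_C0(2) [OF a b g] g by (auto simp: topspace_fib topspace_XG)

lemma Cc_cnj: "b \<in> Cc X \<Longrightarrow> (\<lambda>x\<in>topspace X. cnj (b x)) \<in> Cc X"
  using star_subalgebra_Cc [OF Hausdorff_X] by (simp add: star_subalgebra_def)

lemma inner_norm_support:
  assumes a: "a \<in> Cc X" and b: "b \<in> Cc X"
  obtains K where "compactin TG K" "closedin TG K" "\<And>\<gamma>. \<gamma> \<in> carr \<Longrightarrow> inner_norm a b \<gamma> \<noteq> 0 \<Longrightarrow> \<gamma> \<in> K"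
proof -
  \<comment> \<open>\<open>corr_support\<close> requires members of \<open>Cc X\<close>, hence the
    restricted conjugate; the two versions agree on \<open>XG\<close>.\<close>
  obtain P where P: "compactin XG P" "\<And>z. z \<in> topspace XG \<Longrightarrow> corr a (\<lambda>x\<in>topspace X. cnj (b x)) z \<noteq> 0 \<Longrightarrow> z \<in> P"
    using corr_support [OF a Cc_cnj [OF b]] by blast
  have "\<gamma> \<in> fst ` P" if g: "\<gamma> \<in> carr" and n: "inner_norm a b \<gamma> \<noteq> 0" for \<gamma>
  proof (rule ccontr)
    assume nP: "\<gamma> \<notin> fst ` P"
    have "corr a (\<lambda>x. cnj (b x)) (\<gamma>, x) = 0" if "(\<gamma>, x) \<in> topspace XG" for x
    proof -
      have "(\<gamma>, x) \<notin> P" using nP by force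
      then have "corr a (\<lambda>x\<in>topspace X. cnj (b x)) (\<gamma>, x) = 0" using P(2) that by blast
      then show ?thesis using that by (auto simp: corr_def topspace_XG)
    qed
    \<comment> \<open>\<open>inner_norm_less_iff\<close> speaks of positive thresholds only, so the
      value 0 is reached by letting \<open>t\<close> tend to 0.\<close>
    then have "inner_norm a b \<gamma> < t" if "0 < t" for t
      using inner_norm_less_iff [OF a b g that] that by auto
    then have "inner_norm a b \<gamma> \<le> 0" by (meson dense_ge less_imp_le)
    then show False using n inner_norm_nonneg [OF a b g] by linarith
  qed
  then show thesis using that compactin_fst_XG_closed [OF P(1)] by blast
qed

text \<open>For positive \<open>t\<close>, the set where the norm is at least \<open>t\<close> is
  the projection to \<open>G\<close> of the set where the kernel has modulus at least
  \<open>t\<close>, which is compact because the kernel has compact support on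
  \<open>XG\<close>.\<close>

lemma inner_norm_usc:
  assumes a: "a \<in> Cc X" and b: "b \<in> Cc X"
  shows "openin TG {\<gamma> \<in> carr. inner_norm a b \<gamma> < t}"
proof (cases "0 < t")
  case True
  let ?k = "corr a (\<lambda>x. cnj (b x))"
  obtain P where P: "compactin XG P" "\<And>z. z \<in> topspace XG \<Longrightarrow> corr a (\<lambda>x\<in>topspace X. cnj (b x)) z \<noteq> 0 \<Longrightarrow> z \<in> P"
    using corr_support [OF a Cc_cnj [OF b]] by blast
  have "continuous_map XG euclidean (corr a (\<lambda>x\<in>topspace X. cnj (b x)))"
    by (intro continuous_corr Cc_continuous a Cc_cnj b)
  then have "continuous_map XG euclidean ?k"
    by (rule continuous_map_eq) (auto simp: corr_def topspace_XG)
  then have "closedin XG {z \<in> topspace XG. t \<le> cmod (?k z)}"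
    by (rule closedin_continuous_cmod_ge)
  then have "compactin XG (P \<inter> {z \<in> topspace XG. t \<le> cmod (?k z)})"
    by (rule compact_Int_closedin [OF P(1)])
  moreover have "P \<inter> {z \<in> topspace XG. t \<le> cmod (?k z)} = {z \<in> topspace XG. t \<le> cmod (?k z)}"
    using P(2) True by (force simp: corr_def topspace_XG)
  ultimately have "closedin TG (fst ` {z \<in> topspace XG. t \<le> cmod (?k z)})"
    using compactin_fst_XG_closed by metis
  moreover have "{\<gamma> \<in> carr. inner_norm a b \<gamma> < t} = carr - fst ` {z \<in> topspace XG. t \<le> cmod (?k z)}"
    using inner_norm_less_iff [OF a b _ True] by (force simp: image_iff)
  ultimately show ?thesis by auto
next
  case False
  then have "{\<gamma> \<in> carr. inner_norm a b \<gamma> < t} = {}"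
    using inner_norm_nonneg [OF a b] by force
  then show ?thesis using openin_empty by metis
qed

text \<open>For nonnegative \<open>t\<close>, a fibre norm exceeds \<open>t\<close> exactly when
  some value of the kernel does, so the set is the projection of an open subset of
  \<open>XG\<close>; this is where openness of \<open>rX\<close> is used.\<close>

lemma inner_norm_lsc:
  assumes a: "a \<in> Cc X" and b: "b \<in> Cc X" and rX: "open_map X (unit_space G) rX"
  shows "openin TG {\<gamma> \<in> carr. t < inner_norm a b \<gamma>}"
proof (cases "0 \<le> t")
  case True
  let ?k = "corr a (\<lambda>x\<in>topspace X. cnj (b x))"
  have k: "continuous_map XG euclidean ?k"
    by (intro continuous_corr Cc_continuous a Cc_cnj b)
  have val: "?k (\<gamma>, x) = corr a (\<lambda>x. cnj (b x)) (\<gamma>, x)" if "(\<gamma>, x) \<in> topspace XG" for \<gamma> x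
    using that by (auto simp: corr_def topspace_XG)
  have "openin XG {z \<in> topspace XG. cmod (?k z) \<in> {t<..}}"
    using k by (intro openin_continuous_map_preimage [where Y = euclidean] continuous_map_norm) auto
  then have "openin TG (fst ` {z \<in> topspace XG. t < cmod (?k z)})"
    using open_map_fst_XG [OF rX] by (simp add: open_map_def)
  moreover have "t < inner_norm a b \<gamma> \<longleftrightarrow> (\<exists>x. (\<gamma>, x) \<in> topspace XG \<and> t < cmod (?k (\<gamma>, x)))"
    if g: "\<gamma> \<in> carr" for \<gamma>
  proof
    assume "t < inner_norm a b \<gamma>"
    \<comment> \<open>The norm criterion has a strict upper bound, so its negation yields only a
      weak lower bound; passing to a larger \<open>t'\<close> restores strictness.\<close>
    then obtain t' where t': "t < t'" "t' < inner_norm a b \<gamma>" using dense by blast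
    then have "\<not> inner_norm a b \<gamma> < t'" "0 < t'" using True by auto
    then obtain x where "(\<gamma>, x) \<in> topspace XG" "t' \<le> cmod (?k (\<gamma>, x))"
      using inner_norm_less_iff [OF a b g, of t'] val by (metis not_le)
    then show "\<exists>x. (\<gamma>, x) \<in> topspace XG \<and> t < cmod (?k (\<gamma>, x))" using t'(1) by force
  next
    assume "\<exists>x. (\<gamma>, x) \<in> topspace XG \<and> t < cmod (?k (\<gamma>, x))"
    then obtain x where x: "(\<gamma>, x) \<in> topspace XG" "t < cmod (?k (\<gamma>, x))" by blast
    have "0 < cmod (?k (\<gamma>, x))" using x(2) True by linarith
    then have "\<not> inner_norm a b \<gamma> < cmod (?k (\<gamma>, x))"
      using inner_norm_less_iff [OF a b g] x(1) val [OF x(1)] by (metis less_irrefl)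
    then show "t < inner_norm a b \<gamma>" using x(2) by linarith
  qed
  then have "{\<gamma> \<in> carr. t < inner_norm a b \<gamma>} = fst ` {z \<in> topspace XG. t < cmod (?k z)}"
    by (force simp: image_iff topspace_XG simp del: restrict_apply)
  ultimately show ?thesis by simp
next
  case False
  then have "{\<gamma> \<in> carr. t < inner_norm a b \<gamma>} = carr"
    using inner_norm_nonneg [OF a b] by force
  then show ?thesis by simp
qed

text \<open>Members of \<open>Cc\<close> are extensional, while the norm function takes arbitrary
  values off the groupoid. The I-norm integrates over the groupoid only, so the difference has norm
  0.\<close>

lemma I_closure_superset:
  assumes h: "h \<in> borel_measurable (borel_of TG)" and f: "f \<in> T" and eq: "\<And>\<gamma>. \<gamma> \<in> carr \<Longrightarrow> f \<gamma> = h \<gamma>"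
  shows "h \<in> I_closure G lam T"
proof -
  have sp: "space (lam u) = carr" if "u \<in> units G" for u
    using haar_system that by (auto simp: haar_system_def)
  have "(\<integral>\<^sup>+ \<gamma>. ennreal (cmod (h \<gamma> - f \<gamma>)) \<partial>lam u) = (\<integral>\<^sup>+ \<gamma>. 0 \<partial>lam u)" if "u \<in> units G" for u
    using sp [OF that] eq by (intro nn_integral_cong) auto
  moreover have "(\<integral>\<^sup>+ \<gamma>. ennreal (cmod (h \<gamma> - f \<gamma>)) \<partial>distr (lam u) (borel_of TG) iv) =
      (\<integral>\<^sup>+ \<gamma>. 0 \<partial>distr (lam u) (borel_of TG) iv)" for u
    using eq by (intro nn_integral_cong) (auto simp: space_borel_of)
  ultimately have "I_norm G lam (\<lambda>\<gamma>. h \<gamma> - f \<gamma>) \<le> 0"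
    unfolding I_norm_def by (intro max.boundedI SUP_least) auto
  then have "I_norm G lam (\<lambda>\<gamma>. h \<gamma> - f \<gamma>) < \<epsilon>" if "0 < \<epsilon>" for \<epsilon>
    using that by simp
  then show ?thesis unfolding I_closure_def using h f by blast
qed

lemma inner_norm_measurable:
  assumes a: "a \<in> Cc X" and b: "b \<in> Cc X"
  shows "(\<lambda>\<gamma>. complex_of_real (inner_norm a b \<gamma>)) \<in> borel_measurable (borel_of TG)"
proof -
  have "inner_norm a b \<in> borel_measurable (borel_of TG)"
    unfolding borel_measurable_iff_less space_borel_of
    using sets_borel_of_openin [OF inner_norm_usc [OF a b]] by blast
  then show ?thesis by measurable
qed

lemma inner_norm_L_I_usc:
  assumes a: "a \<in> Cc X" and b: "b \<in> Cc X"
  shows "(\<lambda>\<gamma>. complex_of_real (inner_norm a b \<gamma>)) \<in> L_I_usc G lam"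
  unfolding L_I_usc_def
proof (rule I_closure_superset [OF inner_norm_measurable [OF a b] _ refl])
  obtain K where K: "compactin TG K" "closedin TG K"
    "\<And>\<gamma>. \<gamma> \<in> carr \<Longrightarrow> inner_norm a b \<gamma> \<noteq> 0 \<Longrightarrow> \<gamma> \<in> K"
    using inner_norm_support [OF a b] by blast
  have "TG closure_of {\<gamma> \<in> carr. inner_norm a b \<gamma> \<noteq> 0} \<subseteq> K"
    using K by (intro closure_of_minimal) auto
  then have "compactin TG (TG closure_of {\<gamma> \<in> carr. inner_norm a b \<gamma> \<noteq> 0})"
    using closed_compactin [OF K(1) _ closedin_closure_of] by blast
  then show "(\<lambda>\<gamma>. complex_of_real (inner_norm a b \<gamma>)) \<in> Usc_c TG"
    unfolding Usc_c_def using inner_norm_usc [OF a b] inner_norm_nonneg [OF a b] by blast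
qed

text \<open>Both semicontinuities together make the norm function continuous, so its restriction
  lies in \<open>Cc\<close> itself and no approximation takes place.\<close>

lemma inner_norm_L_I:
  assumes a: "a \<in> Cc X" and b: "b \<in> Cc X" and rX: "open_map X (unit_space G) rX"
  shows "(\<lambda>\<gamma>. complex_of_real (inner_norm a b \<gamma>)) \<in> L_I G lam"
  unfolding L_I_def
proof (rule I_closure_superset [OF inner_norm_measurable [OF a b]])
  obtain K where K: "compactin TG K" "closedin TG K"
    "\<And>\<gamma>. \<gamma> \<in> carr \<Longrightarrow> inner_norm a b \<gamma> \<noteq> 0 \<Longrightarrow> \<gamma> \<in> K"
    using inner_norm_support [OF a b] by blast
  have "continuous_map TG euclideanreal (inner_norm a b)"
    unfolding continuous_map_upper_lower_semicontinuous_lt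
    using inner_norm_usc [OF a b] inner_norm_lsc [OF a b rX] by blast
  then have "continuous_map TG euclidean (\<lambda>\<gamma>. complex_of_real (inner_norm a b \<gamma>))"
    unfolding continuous_map_euclidean_tendsto by (auto intro: tendsto_of_real)
  then show "restrict (\<lambda>\<gamma>. complex_of_real (inner_norm a b \<gamma>)) carr \<in> Cc TG"
    by (rule Cc_restrictI [OF Hausdorff_groupoid _ K(1)]) (use K(3) in auto)
qed auto

end

section \<open>Haar integrals over range fibres and the averaging map \<open>Psi\<close>\<close>

context groupoid_space
begin

lemma haar:
  assumes "u \<in> units G"
  shows "space (lam u) = carr" "sets (lam u) = sets (borel_of TG)"
    "\<And>K. compactin TG K \<Longrightarrow> emeasure (lam u) K < \<infinity>"
    "measure_support TG (lam u) = range_fibre G u"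
  using haar_system assms by (auto simp: haar_system_def)

lemma haar_continuous: "f \<in> Cc TG \<Longrightarrow> continuous_map (unit_space G) euclidean (\<lambda>u. LINT \<gamma>|lam u. f \<gamma>)"
  and haar_invariant: "f \<in> Cc TG \<Longrightarrow> \<gamma> \<in> carr \<Longrightarrow>
    (LINT \<eta>:range_fibre G (s \<gamma>)|lam (s \<gamma>). f (g_mult G \<gamma> \<eta>)) = (LINT \<eta>|lam (r \<gamma>). f \<eta>)"
  using haar_system by (auto simp: haar_system_def)

lemma closedin_range_fibre:
  assumes "u \<in> units G"
  shows "closedin TG (range_fibre G u)"
proof -
  have "closedin TG {\<gamma> \<in> carr. r \<gamma> \<in> {u}}"
    using units_carr [OF assms] Hausdorff_groupoid
    by (intro closedin_continuous_map_preimage [OF continuous_r]) (simp add: closedin_Hausdorff_singleton)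
  then show ?thesis by (simp add: range_fibre_def)
qed

lemma range_fibre_sets: "u \<in> units G \<Longrightarrow> range_fibre G u \<in> sets (lam u)"
  using haar(2) sets_borel_of_closedin closedin_range_fibre by blast

text \<open>The Haar axiom describes the support of the measure. Points off the support have null
  open neighbourhoods, which may be taken from a countable base; the union of these is a null set
  containing everything off the fibre.\<close>

lemma AE_range_fibre:
  assumes u: "u \<in> units G"
  shows "AE \<gamma> in lam u. \<gamma> \<in> range_fibre G u"
proof -
  obtain \<B> where B: "countable \<B> \<and> (\<forall>V\<in>\<B>. openin TG V) \<and>
      (\<forall>U x. openin TG U \<and> x \<in> U \<longrightarrow> (\<exists>V\<in>\<B>. x \<in> V \<and> V \<subseteq> U))"
    using second_countable unfolding second_countable_def by (rule exE)
  then have \<B>: "countable \<B>" "\<And>V. V \<in> \<B> \<Longrightarrow> openin TG V"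
    "\<And>U x. openin TG U \<Longrightarrow> x \<in> U \<Longrightarrow> \<exists>V\<in>\<B>. x \<in> V \<and> V \<subseteq> U"
    by simp_all
  let ?N = "\<Union>{V \<in> \<B>. emeasure (lam u) V = 0}"
  have op: "V \<in> sets (lam u)" if "openin TG V" for V
    using haar(2) [OF u] sets_borel_of_openin [OF that] by simp
  have "(\<Union>V\<in>{V \<in> \<B>. emeasure (lam u) V = 0}. V) \<in> null_sets (lam u)"
    using \<B>(1,2) op by (intro null_sets_UN') (auto simp: null_sets_def)
  then have N: "?N \<in> null_sets (lam u)" by simp
  show ?thesis
  proof (rule AE_I' [OF N], clarify)
    fix \<gamma> assume g: "\<gamma> \<in> space (lam u)" "\<gamma> \<notin> range_fibre G u"
    then have "\<gamma> \<notin> measure_support TG (lam u)" "\<gamma> \<in> carr" using haar [OF u] by auto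
    then obtain U where U: "openin TG U" "\<gamma> \<in> U" "\<not> 0 < emeasure (lam u) U"
      unfolding measure_support_def by blast
    then have U0: "emeasure (lam u) U = 0" by simp
    obtain V where V: "V \<in> \<B>" "\<gamma> \<in> V" "V \<subseteq> U" using \<B>(3) [OF U(1,2)] by blast
    have "emeasure (lam u) V \<le> emeasure (lam u) U" using V(3) op [OF U(1)] by (rule emeasure_mono)
    then have "emeasure (lam u) V = 0" using U0 by simp
    then show "\<gamma> \<in> ?N" using V by blast
  qed
qed

lemma borel_measurable_haar:
  fixes f :: "'g \<Rightarrow> 'b::topological_space"
  shows "u \<in> units G \<Longrightarrow> continuous_map TG euclidean f \<Longrightarrow> f \<in> borel_measurable (lam u)"
  by (rule borel_measurable_continuous_map) (auto simp: haar)

lemma Cc_integrable: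
  assumes f: "f \<in> Cc TG" and u: "u \<in> units G"
  shows "integrable (lam u) f"
proof -
  obtain K where K: "compactin TG K" "closedin TG K" "\<And>x. x \<in> carr \<Longrightarrow> f x \<noteq> 0 \<Longrightarrow> x \<in> K"
    using f by (rule Cc_supp) blast
  show ?thesis
  proof (rule integrableI_bounded_set [where A = K and B = "cs_norm (C0 TG) f"])
    show "K \<in> sets (lam u)" using haar(2) [OF u] sets_borel_of_closedin [OF K(2)] by simp
    show "f \<in> borel_measurable (lam u)" by (rule borel_measurable_haar [OF u Cc_continuous [OF f]])
    show "emeasure (lam u) K < \<infinity>" using haar(3) [OF u K(1)] .
    have "f \<in> cs_carrier (C0 TG)" using f Cc_subset_C0 by blast
    then show "AE x in lam u. x \<in> K \<longrightarrow> cmod (f x) \<le> cs_norm (C0 TG) f"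
      using C0_norm_upper haar(1) [OF u] by (intro AE_I2) auto
    show "AE x in lam u. x \<notin> K \<longrightarrow> f x = 0" using K(3) haar(1) [OF u] by (intro AE_I2) auto
  qed
qed

text \<open>The axioms of a Haar system speak about C_c(G), but \<gamma> \<mapsto>
  \<phi>(\<gamma>^-1 x) makes sense on one range fibre only. This fibre is closed, and properness
  confines the nonzero values to a compact set, so \<open>Cc_extension\<close> applies. Which
  extension is taken does not affect the integral, as the measure lives on the fibre.\<close>

lemma fibre_function_extends:
  assumes \<phi>: "\<phi> \<in> Cc X" and x: "x \<in> topspace X"
  obtains f where "f \<in> Cc TG" "\<And>\<gamma>. \<gamma> \<in> range_fibre G (rX x) \<Longrightarrow> f \<gamma> = \<phi> (act (iv \<gamma>) x)"
proof -
  obtain K where K: "compactin X K" "\<And>x. x \<in> topspace X \<Longrightarrow> \<phi> x \<noteq> 0 \<Longrightarrow> x \<in> K"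
    using \<phi> by (rule Cc_supp) blast
  let ?F = "range_fibre G (rX x)"
  have cl: "closedin TG ?F" using closedin_range_fibre x by simp
  have "continuous_map (subtopology TG ?F) XG (\<lambda>\<gamma>. (\<gamma>, x))"
    using x by (auto simp: XG_def continuous_map_in_subtopology continuous_map_pairwise o_def range_fibre_def
        intro: continuous_map_from_subtopology)
  from continuous_map_compose [OF continuous_map_compose [OF this continuous_act_iv] Cc_continuous [OF \<phi>]]
  have cont: "continuous_map (subtopology TG ?F) euclidean (\<lambda>\<gamma>. \<phi> (act (iv \<gamma>) x))"
    by (simp add: o_def)
  have P: "compactin XG {(\<gamma>, y) \<in> topspace XG. y \<in> {x} \<and> act (iv \<gamma>) y \<in> K}" (is "compactin XG ?P")
    using x K(1) by (intro compactin_XG) auto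
  show thesis
  proof (rule Cc_extension [OF locally_compact_groupoid Hausdorff_groupoid cl cont compactin_fst_XG_closed(1) [OF P]])
    fix \<gamma> assume g: "\<gamma> \<in> ?F" "\<phi> (act (iv \<gamma>) x) \<noteq> 0"
    then have "(\<gamma>, x) \<in> ?P" using x K(2) by (auto simp: range_fibre_def topspace_XG)
    then show "\<gamma> \<in> fst ` ?P" by force
  qed (use that in blast)
qed

text \<open>A set integral, since off the fibre over \<open>rX x\<close> the term
  \<open>act (iv \<gamma>) x\<close> has no meaning.\<close>

definition Psi :: "('x \<Rightarrow> complex) \<Rightarrow> 'x \<Rightarrow> complex" where
  "Psi \<phi> x = (LINT \<gamma>:range_fibre G (rX x)|lam (rX x). \<phi> (act (iv \<gamma>) x))"

lemma set_integral_fibre: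
  assumes f: "f \<in> Cc TG" and u: "u \<in> units G" and eq: "\<And>\<gamma>. \<gamma> \<in> range_fibre G u \<Longrightarrow> h \<gamma> = f \<gamma>"
  shows "(LINT \<gamma>:range_fibre G u|lam u. h \<gamma>) = (LINT \<gamma>|lam u. f \<gamma>)"
proof -
  have m: "f \<in> borel_measurable (lam u)" by (rule borel_measurable_haar [OF u Cc_continuous [OF f]])
  have "(LINT \<gamma>:range_fibre G u|lam u. h \<gamma>) = (LINT \<gamma>:range_fibre G u|lam u. f \<gamma>)"
    using eq range_fibre_sets [OF u] by (intro set_lebesgue_integral_cong) auto
  also have "\<dots> = (LINT \<gamma>|lam u. f \<gamma>)"
    unfolding set_lebesgue_integral_def
  proof (rule integral_cong_AE)
    show "(\<lambda>\<gamma>. indicator (range_fibre G u) \<gamma> *\<^sub>R f \<gamma>) \<in> borel_measurable (lam u)"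
      using m range_fibre_sets [OF u] by measurable
    show "AE \<gamma> in lam u. indicator (range_fibre G u) \<gamma> *\<^sub>R f \<gamma> = f \<gamma>"
      using AE_range_fibre [OF u] by eventually_elim simp
  qed (rule m)
  finally show ?thesis .
qed

lemma Psi_eq_integral:
  assumes "f \<in> Cc TG" "x \<in> topspace X" "\<And>\<gamma>. \<gamma> \<in> range_fibre G (rX x) \<Longrightarrow> f \<gamma> = \<phi> (act (iv \<gamma>) x)"
  shows "Psi \<phi> x = (LINT \<gamma>|lam (rX x). f \<gamma>)"
  unfolding Psi_def using assms by (intro set_integral_fibre) auto

text \<open>Left invariance is applied to an extension \<open>f\<close> of the function that belongs
  to the point \<gamma> x; the translation by \<gamma> cancels because (\<gamma> \<eta>)^-1
  (\<gamma> x) = \<eta>^-1 x.\<close>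

lemma Psi_invariant:
  assumes \<phi>: "\<phi> \<in> Cc X" and x: "x \<in> topspace X" and g: "\<gamma> \<in> carr" "s \<gamma> = rX x"
  shows "Psi \<phi> (act \<gamma> x) = Psi \<phi> x"
proof -
  have y: "act \<gamma> x \<in> topspace X" "rX (act \<gamma> x) = r \<gamma>" using x g by auto
  obtain f where f: "f \<in> Cc TG" "\<And>\<eta>. \<eta> \<in> range_fibre G (r \<gamma>) \<Longrightarrow> f \<eta> = \<phi> (act (iv \<eta>) (act \<gamma> x))"
    using fibre_function_extends [OF \<phi> y(1)] y(2) by auto
  have "Psi \<phi> (act \<gamma> x) = (LINT \<eta>|lam (r \<gamma>). f \<eta>)"
    using Psi_eq_integral [OF f(1) y(1)] f(2) y(2) by simp
  also have "\<dots> = (LINT \<eta>:range_fibre G (s \<gamma>)|lam (s \<gamma>). f (g_mult G \<gamma> \<eta>))"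
    using haar_invariant [OF f(1) g(1)] by simp
  also have "\<dots> = (LINT \<eta>:range_fibre G (s \<gamma>)|lam (s \<gamma>). \<phi> (act (iv \<eta>) x))"
  proof (rule set_lebesgue_integral_cong)
    show "range_fibre G (s \<gamma>) \<in> sets (lam (s \<gamma>))" using range_fibre_sets [OF s_units [OF g(1)]] .
    show "\<forall>\<eta>. \<eta> \<in> range_fibre G (s \<gamma>) \<longrightarrow> f (g_mult G \<gamma> \<eta>) = \<phi> (act (iv \<eta>) x)"
    proof (intro allI impI)
      fix \<eta> assume "\<eta> \<in> range_fibre G (s \<gamma>)"
      then have e: "\<eta> \<in> carr" "s \<gamma> = r \<eta>" by (auto simp: range_fibre_def)
      then have "g_mult G \<gamma> \<eta> \<in> range_fibre G (r \<gamma>)" using g by (simp add: range_fibre_def)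
      then have "f (g_mult G \<gamma> \<eta>) = \<phi> (act (iv (g_mult G \<gamma> \<eta>)) (act \<gamma> x))" by (rule f(2))
      also have "act (iv (g_mult G \<gamma> \<eta>)) (act \<gamma> x) = act (iv \<eta>) x"
        using g e x y by (simp add: act_iv_mult)
      finally show "f (g_mult G \<gamma> \<eta>) = \<phi> (act (iv \<eta>) x)" .
    qed
  qed
  also have "\<dots> = Psi \<phi> x" using g by (simp add: Psi_def)
  finally show ?thesis .
qed

text \<open>The average of \<phi> lives on the orbits that meet the support of \<phi>. This gives
  its boundedness on \<open>X\<close> and its compact support on the orbit space.\<close>

lemma Psi_nonzero_orbit:
  assumes x: "x \<in> topspace X" and n: "Psi \<phi> x \<noteq> 0"
  obtains \<gamma> where "\<gamma> \<in> carr" "r \<gamma> = rX x" "\<phi> (act (iv \<gamma>) x) \<noteq> 0"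
proof -
  have "\<exists>\<gamma>\<in>range_fibre G (rX x). \<phi> (act (iv \<gamma>) x) \<noteq> 0"
  proof (rule ccontr)
    assume "\<not> ?thesis"
    then have "Psi \<phi> x = (LINT \<gamma>:range_fibre G (rX x)|lam (rX x). 0)"
      unfolding Psi_def using range_fibre_sets x by (intro set_lebesgue_integral_cong) auto
    then show False using n by (simp add: set_lebesgue_integral_def)
  qed
  then show thesis using that by (auto simp: range_fibre_def)
qed

text \<open>Near \<open>x\<^sub>0\<close> the function \<open>\<phi>(\<gamma>\<^sup>-\<^sup>1x)\<close> on the fibre over \<open>r(x)\<close> is uniformly close to a fixed
  \<open>f \<in> C\<^sub>c(G)\<close> that extends the one for \<open>x\<^sub>0\<close>, because properness keeps everything in one compact
  subset of \<open>G\<close>. This reduces continuity to the continuity axiom of the Haar system for \<open>f\<close>.\<close>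

lemma continuous_Psi:
  assumes \<phi>: "\<phi> \<in> Cc X"
  shows "continuous_map X euclidean (Psi \<phi>)"
  unfolding continuous_map_euclidean_dist
proof (intro ballI allI impI)
  fix x0 and \<epsilon> :: real assume x0: "x0 \<in> topspace X" and e: "0 < \<epsilon>"
  obtain K where K: "compactin X K" "\<And>x. x \<in> topspace X \<Longrightarrow> \<phi> x \<noteq> 0 \<Longrightarrow> x \<in> K"
    using \<phi> by (rule Cc_supp) blast
  obtain U N where U: "openin X U" "compactin X N" "x0 \<in> U" "U \<subseteq> N"
    using locally_compact_X x0 unfolding locally_compact_space_def by blast
  obtain f where f: "f \<in> Cc TG" "\<And>\<gamma>. \<gamma> \<in> range_fibre G (rX x0) \<Longrightarrow> f \<gamma> = \<phi> (act (iv \<gamma>) x0)"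
    using fibre_function_extends [OF \<phi> x0] by blast
  obtain Kf where Kf: "compactin TG Kf" "\<And>\<gamma>. \<gamma> \<in> carr \<Longrightarrow> f \<gamma> \<noteq> 0 \<Longrightarrow> \<gamma> \<in> Kf"
    using f(1) by (rule Cc_supp) blast
  let ?P = "{(\<gamma>, x) \<in> topspace XG. x \<in> N \<and> act (iv \<gamma>) x \<in> K}"
  let ?C = "fst ` ?P \<union> Kf"
  have C: "compactin TG ?C"
    by (intro compactin_Un compactin_fst_XG_closed(1) compactin_XG U K Kf)
  \<comment> \<open>The cutoff is 1 wherever \<open>f\<close> or, for some \<open>x\<close> in
    \<open>N\<close>, the function \<phi>(\<gamma>^-1 x) can be nonzero. It serves as an integrable
    majorant whose integrals depend continuously on the unit.\<close>
  obtain \<kappa> L where \<kappa>: "continuous_map TG euclideanreal \<kappa>" "\<And>\<gamma>. 0 \<le> \<kappa> \<gamma>" "\<And>\<gamma>. \<kappa> \<gamma> \<le> 1"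
    "\<And>\<gamma>. \<gamma> \<in> ?C \<Longrightarrow> \<kappa> \<gamma> = 1" "compactin TG L" "\<And>\<gamma>. \<gamma> \<in> carr \<Longrightarrow> \<kappa> \<gamma> \<noteq> 0 \<Longrightarrow> \<gamma> \<in> L"
    by (rule Urysohn_Cc [OF locally_compact_groupoid Hausdorff_groupoid C]) (rule that)
  define k where "k = restrict (\<lambda>\<gamma>. complex_of_real (\<kappa> \<gamma>)) carr"
  have k: "k \<in> Cc TG"
    unfolding k_def
  proof (rule Cc_restrictI [OF Hausdorff_groupoid _ \<kappa>(5)])
    show "continuous_map TG euclidean (\<lambda>\<gamma>. complex_of_real (\<kappa> \<gamma>))"
      using \<kappa>(1) unfolding continuous_map_euclidean_tendsto by (auto intro: tendsto_of_real)
  qed (use \<kappa>(6) in auto)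
  \<comment> \<open>Bounds the integral of the cutoff near \<open>x0\<close>: the value there plus 1
    for its variation on \<open>V1\<close>. With \<delta> = \<epsilon> / (3 B) the error \<delta> B
    is a third of \<epsilon>.\<close>
  define B where "B = cmod (LINT \<gamma>|lam (rX x0). k \<gamma>) + 1"
  have B: "0 < B" by (simp add: B_def add_nonneg_pos)
  define \<delta> where "\<delta> = \<epsilon> / (3 * B)"
  have d: "0 < \<delta>" using e B by (simp add: \<delta>_def)
  let ?D = "\<lambda>z. \<phi> (act (iv (fst z)) (snd z)) - f (fst z)"
  have contD: "continuous_map XG euclidean ?D"
    using continuous_map_compose [OF continuous_act_iv Cc_continuous [OF \<phi>]]
      continuous_map_compose [OF continuous_fst_XG Cc_continuous [OF f(1)]]
    by (intro continuous_map_diff) (auto simp: o_def case_prod_unfold)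
  \<comment> \<open>The pairs over \<open>N\<close>, with \<gamma> in the compact set, at which
    \<phi>(\<gamma>^-1 x) and f(\<gamma>) differ by \<delta> or more. This set is compact, and
    \<open>x0\<close> is not in its projection because \<open>f\<close> extends the function that
    belongs to \<open>x0\<close>.\<close>
  let ?Z = "{(\<gamma>, x) \<in> topspace XG. \<gamma> \<in> ?C \<and> x \<in> N} \<inter> {z \<in> topspace XG. \<delta> \<le> cmod (?D z)}"
  have "compactin XG ?Z"
    by (rule compact_Int_closedin [OF compactin_GX_Times(2) [OF C U(2)] closedin_continuous_cmod_ge [OF contD]])
  then have Z: "closedin X (snd ` ?Z)" by (rule compactin_snd_XG_closed)
  have x0Z: "x0 \<notin> snd ` ?Z"
    using f(2) d by (auto simp: range_fibre_def topspace_XG)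
  have dist_k: "cmod (Psi \<phi> x - (LINT \<gamma>|lam (rX x). f \<gamma>)) \<le> \<delta> * cmod (LINT \<gamma>|lam (rX x). k \<gamma>)"
    if x: "x \<in> U" "x \<notin> snd ` ?Z" for x
  proof -
    have xX: "x \<in> topspace X" using x(1) openin_subset [OF U(1)] by blast
    then have u: "rX x \<in> units G" by simp
    obtain h where h: "h \<in> Cc TG" "\<And>\<gamma>. \<gamma> \<in> range_fibre G (rX x) \<Longrightarrow> h \<gamma> = \<phi> (act (iv \<gamma>) x)"
      using fibre_function_extends [OF \<phi> xX] by blast
    have le: "cmod (h \<gamma> - f \<gamma>) \<le> \<delta> * \<kappa> \<gamma>" if g: "\<gamma> \<in> range_fibre G (rX x)" for \<gamma>
    proof -
      have z: "(\<gamma>, x) \<in> topspace XG" and gc: "\<gamma> \<in> carr"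
        using g xX by (auto simp: range_fibre_def topspace_XG)
      show ?thesis
      proof (cases "\<gamma> \<in> ?C")
        case True
        have "(\<gamma>, x) \<notin> ?Z" using x(2) by force
        then have "\<not> \<delta> \<le> cmod (\<phi> (act (iv \<gamma>) x) - f \<gamma>)"
          using True z x(1) U(4) by auto
        then show ?thesis using \<kappa>(4) [OF True] h(2) [OF g] by simp
      next
        case False
        then have "(\<gamma>, x) \<notin> ?P" by force
        then have "act (iv \<gamma>) x \<notin> K" using z x(1) U(4) by auto
        then have "\<phi> (act (iv \<gamma>) x) = 0" using K(2) [of "act (iv \<gamma>) x"] z by (auto simp: topspace_XG)
        moreover have "f \<gamma> = 0" using False Kf(2) gc by blast
        ultimately show ?thesis using h(2) [OF g] \<kappa>(2) d by simp
      qed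
    qed
    have ih: "integrable (lam (rX x)) h" and if': "integrable (lam (rX x)) f" and ik: "integrable (lam (rX x)) k"
      by (rule Cc_integrable [OF _ u]; fact)+
    have kk: "k \<gamma> = complex_of_real (\<kappa> \<gamma>)" if "\<gamma> \<in> space (lam (rX x))" for \<gamma>
      using that haar(1) [OF u] by (simp add: k_def)
    then have "integrable (lam (rX x)) (\<lambda>\<gamma>. complex_of_real (\<kappa> \<gamma>))"
      using ik by (subst Bochner_Integration.integrable_cong [OF refl, of _ _ k]) auto
    then have i\<kappa>: "integrable (lam (rX x)) \<kappa>"
      using integrable_Re by fastforce
    have "cmod (Psi \<phi> x - (LINT \<gamma>|lam (rX x). f \<gamma>)) = cmod (LINT \<gamma>|lam (rX x). h \<gamma> - f \<gamma>)"
      using Psi_eq_integral [OF h(1) xX] h(2) ih if' by simp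
    also have "\<dots> \<le> (LINT \<gamma>|lam (rX x). cmod (h \<gamma> - f \<gamma>))"
      by (rule integral_norm_bound)
    also have "\<dots> \<le> (LINT \<gamma>|lam (rX x). \<delta> * \<kappa> \<gamma>)"
    proof (rule integral_mono_AE)
      show "AE \<gamma> in lam (rX x). cmod (h \<gamma> - f \<gamma>) \<le> \<delta> * \<kappa> \<gamma>"
        using AE_range_fibre [OF u] by eventually_elim (rule le)
    qed (use ih if' i\<kappa> in auto)
    also have "\<dots> = \<delta> * (LINT \<gamma>|lam (rX x). \<kappa> \<gamma>)" by simp
    also have "\<dots> \<le> \<delta> * cmod (LINT \<gamma>|lam (rX x). k \<gamma>)"
    proof (rule mult_left_mono)
      have "(LINT \<gamma>|lam (rX x). k \<gamma>) = (LINT \<gamma>|lam (rX x). complex_of_real (\<kappa> \<gamma>))"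
        using kk by (intro Bochner_Integration.integral_cong) auto
      then show "(LINT \<gamma>|lam (rX x). \<kappa> \<gamma>) \<le> cmod (LINT \<gamma>|lam (rX x). k \<gamma>)" by simp
    qed (use d in simp)
    finally show ?thesis .
  qed
  have near: "\<exists>V. openin X V \<and> x0 \<in> V \<and> (\<forall>x\<in>V. dist (LINT \<gamma>|lam (rX x). h \<gamma>) (LINT \<gamma>|lam (rX x0). h \<gamma>) < \<eta>)"
    if "h \<in> Cc TG" "0 < \<eta>" for h :: "'g \<Rightarrow> complex" and \<eta> :: real
  proof -
    have "continuous_map X euclidean (\<lambda>x. LINT \<gamma>|lam (rX x). h \<gamma>)"
      using continuous_map_compose [OF rX_continuous haar_continuous [OF that(1)]] by (simp add: o_def)
    from this [unfolded continuous_map_euclidean_dist, rule_format, OF x0 that(2)] show ?thesis .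
  qed
  obtain V1 where V1: "openin X V1" "x0 \<in> V1"
    "\<And>x. x \<in> V1 \<Longrightarrow> dist (LINT \<gamma>|lam (rX x). k \<gamma>) (LINT \<gamma>|lam (rX x0). k \<gamma>) < 1"
    using near [OF k zero_less_one] by blast
  obtain V2 where V2: "openin X V2" "x0 \<in> V2"
    "\<And>x. x \<in> V2 \<Longrightarrow> dist (LINT \<gamma>|lam (rX x). f \<gamma>) (LINT \<gamma>|lam (rX x0). f \<gamma>) < \<epsilon>/3"
    using near [OF f(1), of "\<epsilon>/3"] e by auto
  let ?V = "(U - snd ` ?Z) \<inter> V1 \<inter> V2"
  have "dist (Psi \<phi> x) (Psi \<phi> x0) < \<epsilon>" if x: "x \<in> ?V" for x
  proof -
    have "cmod (LINT \<gamma>|lam (rX x). k \<gamma>) \<le> B"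
      using V1(3) [of x] x norm_triangle_ineq3 [of "LINT \<gamma>|lam (rX x). k \<gamma>" "LINT \<gamma>|lam (rX x0). k \<gamma>"]
      by (simp add: B_def dist_norm)
    then have "\<delta> * cmod (LINT \<gamma>|lam (rX x). k \<gamma>) \<le> \<delta> * B" using d by (intro mult_left_mono) auto
    also have "\<dots> = \<epsilon>/3" using B by (simp add: \<delta>_def)
    finally have "dist (Psi \<phi> x) (LINT \<gamma>|lam (rX x). f \<gamma>) \<le> \<epsilon>/3"
      using dist_k [of x] x by (simp add: dist_norm)
    moreover have "dist (LINT \<gamma>|lam (rX x). f \<gamma>) (Psi \<phi> x0) < \<epsilon>/3"
      using V2(3) x Psi_eq_integral [OF f(1) x0 f(2)] by simp
    ultimately show ?thesis
      using dist_triangle [of "Psi \<phi> x" "Psi \<phi> x0" "LINT \<gamma>|lam (rX x). f \<gamma>"] e by linarith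
  qed
  moreover have "openin X ?V" using U(1) Z V1(1) V2(1) by blast
  moreover have "x0 \<in> ?V" using U(3) x0Z V1(2) V2(2) by blast
  ultimately show "\<exists>V. openin X V \<and> x0 \<in> V \<and> (\<forall>y\<in>V. dist (Psi \<phi> y) (Psi \<phi> x0) < \<epsilon>)"
    by (intro exI [of _ ?V]) blast
qed

text \<open>Strict positivity comes from the unit \<open>rX x\<close>: it fixes \<open>x\<close> and
  lies in the range fibre, which is the support of the measure, so the integrand has positive real
  part on an open set of positive measure.\<close>

lemma Psi_nonneg_pos:
  assumes \<phi>: "\<phi> \<in> Cc X" and nn: "\<And>x. x \<in> topspace X \<Longrightarrow> \<phi> x = complex_of_real (g x) \<and> 0 \<le> g x"
    and x: "x \<in> topspace X"
  shows "Psi \<phi> x = complex_of_real (Re (Psi \<phi> x))" "0 \<le> Re (Psi \<phi> x)"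
    "0 < g x \<Longrightarrow> 0 < Re (Psi \<phi> x)"
proof -
  have u: "rX x \<in> units G" using x by simp
  obtain f where f: "f \<in> Cc TG" "\<And>\<gamma>. \<gamma> \<in> range_fibre G (rX x) \<Longrightarrow> f \<gamma> = \<phi> (act (iv \<gamma>) x)"
    using fibre_function_extends [OF \<phi> x] by blast
  have if': "integrable (lam (rX x)) f" by (rule Cc_integrable [OF f(1) u])
  then have iRe: "integrable (lam (rX x)) (\<lambda>\<gamma>. Re (f \<gamma>))" by (rule integrable_Re)
  have fib: "f \<gamma> = complex_of_real (Re (f \<gamma>)) \<and> 0 \<le> Re (f \<gamma>)" if "\<gamma> \<in> range_fibre G (rX x)" for \<gamma>
    using f(2) [OF that] nn [of "act (iv \<gamma>) x"] that x by (simp add: range_fibre_def)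
  have AE: "AE \<gamma> in lam (rX x). f \<gamma> = complex_of_real (Re (f \<gamma>))" "AE \<gamma> in lam (rX x). 0 \<le> Re (f \<gamma>)"
    using AE_range_fibre [OF u] by (auto elim!: eventually_mono dest: fib)
  have P: "Psi \<phi> x = (LINT \<gamma>|lam (rX x). f \<gamma>)" using Psi_eq_integral [OF f(1) x f(2)] .
  also have "\<dots> = (LINT \<gamma>|lam (rX x). complex_of_real (Re (f \<gamma>)))"
    using AE(1) if' iRe by (intro integral_cong_AE) auto
  finally have P': "Psi \<phi> x = complex_of_real (LINT \<gamma>|lam (rX x). Re (f \<gamma>))" by simp
  then show "Psi \<phi> x = complex_of_real (Re (Psi \<phi> x))" by simp
  have nonneg: "0 \<le> (LINT \<gamma>|lam (rX x). Re (f \<gamma>))" using AE(2) by (rule integral_nonneg_AE)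
  then show "0 \<le> Re (Psi \<phi> x)" using P' by simp
  assume pos: "0 < g x"
  have unit: "rX x \<in> range_fibre G (rX x)" using u units_carr units_r by (auto simp: range_fibre_def)
  have iu: "act (iv (rX x)) x = x"
    using act_iv_act [of "rX x" x] x u by (simp add: act_unit units_s)
  have fu: "0 < Re (f (rX x))" using f(2) [OF unit] iu nn [OF x] pos by simp
  show "0 < Re (Psi \<phi> x)"
  proof (rule ccontr)
    assume "\<not> 0 < Re (Psi \<phi> x)"
    then have "(LINT \<gamma>|lam (rX x). Re (f \<gamma>)) = 0" using nonneg P' by simp
    then have zero: "AE \<gamma> in lam (rX x). Re (f \<gamma>) = 0"
      using integral_nonneg_eq_0_iff_AE [OF iRe AE(2)] by simp
    let ?U = "{\<gamma> \<in> carr. f \<gamma> \<in> {z. 0 < Re z}}"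
    have U: "openin TG ?U"
      by (rule openin_continuous_map_preimage [OF Cc_continuous [OF f(1)]]) (simp add: open_halfspace_Re_gt)
    have "rX x \<in> measure_support TG (lam (rX x))" using haar(4) [OF u] unit by simp
    then have "0 < emeasure (lam (rX x)) ?U"
      using U fu x unfolding measure_support_def by auto
    moreover have "emeasure (lam (rX x)) {\<gamma> \<in> space (lam (rX x)). 0 < Re (f \<gamma>)} = 0"
      using zero by (intro emeasure_eq_0_AE) (auto elim: eventually_mono)
    then have "emeasure (lam (rX x)) ?U = 0" using haar(1) [OF u] by simp
    ultimately show False by simp
  qed
qed

end

section \<open>Multiplication operators\<close>

definition mult_op :: "'x topology \<Rightarrow> ('x \<Rightarrow> complex) \<Rightarrow> ('x \<Rightarrow> complex) \<Rightarrow> 'x \<Rightarrow> complex" where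
  "mult_op T h = (\<lambda>f\<in>cs_carrier (C0 T). \<lambda>x\<in>topspace T. h x * f x)"

text \<open>Over a commutative algebra the left and right components of a double centralizer
  coincide (\<open>DC_commutative\<close>), so one operator serves as both.\<close>

definition multiplier :: "'x topology \<Rightarrow> ('x \<Rightarrow> complex) \<Rightarrow> (('x \<Rightarrow> complex) \<Rightarrow> 'x \<Rightarrow> complex) \<times> (('x \<Rightarrow> complex) \<Rightarrow> 'x \<Rightarrow> complex)" where
  "multiplier T h = (mult_op T h, mult_op T h)"

section \<open>Double centralizers of C_0(T)\<close>

lemma DC_D:
  assumes d: "d \<in> double_centralizers (C0 T)" and L: "L = fst d \<or> L = snd d"
  shows "L \<in> cs_carrier (C0 T) \<rightarrow>\<^sub>E cs_carrier (C0 T)"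
    "\<And>a b. a \<in> cs_carrier (C0 T) \<Longrightarrow> b \<in> cs_carrier (C0 T) \<Longrightarrow>
      L (\<lambda>x\<in>topspace T. a x + b x) = (\<lambda>x\<in>topspace T. L a x + L b x)"
    "\<And>k a. a \<in> cs_carrier (C0 T) \<Longrightarrow> L (\<lambda>x\<in>topspace T. k * a x) = (\<lambda>x\<in>topspace T. k * L a x)"
    "\<exists>B. \<forall>a\<in>cs_carrier (C0 T). cs_norm (C0 T) (L a) \<le> B * cs_norm (C0 T) a"
proof -
  have "\<forall>L\<in>{fst d, snd d}. L \<in> cs_carrier (C0 T) \<rightarrow>\<^sub>E cs_carrier (C0 T) \<and>
      (\<forall>a\<in>cs_carrier (C0 T). \<forall>b\<in>cs_carrier (C0 T). L (cs_add (C0 T) a b) = cs_add (C0 T) (L a) (L b)) \<and>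
      (\<forall>k. \<forall>a\<in>cs_carrier (C0 T). L (cs_scale (C0 T) k a) = cs_scale (C0 T) k (L a)) \<and>
      (\<exists>K. \<forall>a\<in>cs_carrier (C0 T). cs_norm (C0 T) (L a) \<le> K * cs_norm (C0 T) a)"
    using d unfolding double_centralizers_def mem_Collect_eq case_prod_unfold by (rule conjunct1)
  from bspec [OF this, of L] L show "L \<in> cs_carrier (C0 T) \<rightarrow>\<^sub>E cs_carrier (C0 T)"
    "\<And>a b. a \<in> cs_carrier (C0 T) \<Longrightarrow> b \<in> cs_carrier (C0 T) \<Longrightarrow>
      L (\<lambda>x\<in>topspace T. a x + b x) = (\<lambda>x\<in>topspace T. L a x + L b x)"
    "\<And>k a. a \<in> cs_carrier (C0 T) \<Longrightarrow> L (\<lambda>x\<in>topspace T. k * a x) = (\<lambda>x\<in>topspace T. k * L a x)"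
    "\<exists>B. \<forall>a\<in>cs_carrier (C0 T). cs_norm (C0 T) (L a) \<le> B * cs_norm (C0 T) a"
    unfolding C0_sel by simp_all
qed

lemma DC_mult:
  assumes d: "d \<in> double_centralizers (C0 T)" and a: "a \<in> cs_carrier (C0 T)" "b \<in> cs_carrier (C0 T)"
  shows "snd d (\<lambda>x\<in>topspace T. a x * b x) = (\<lambda>x\<in>topspace T. a x * snd d b x)"
    "(\<lambda>x\<in>topspace T. a x * fst d b x) = (\<lambda>x\<in>topspace T. snd d a x * b x)"
  using assms unfolding double_centralizers_def mem_Collect_eq case_prod_unfold C0_sel by simp_all

text \<open>With a = L b - R b, the centralizer identities give a (L b) = (R a) b = a (R b), so a^2
  = 0 and hence a = 0. Equality of multipliers can thus be checked on one component.\<close>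

lemma DC_commutative:
  assumes d: "d \<in> double_centralizers (C0 T)"
  shows "fst d = snd d"
proof (rule PiE_ext [OF DC_D(1) [OF d disjI1 [OF refl]] DC_D(1) [OF d disjI2 [OF refl]]])
  fix b assume b: "b \<in> cs_carrier (C0 T)"
  have LC: "fst d b \<in> cs_carrier (C0 T)" and RC: "snd d b \<in> cs_carrier (C0 T)"
    using DC_D(1) [OF d] b by (auto dest: PiE_mem)
  let ?a = "\<lambda>x\<in>topspace T. fst d b x - snd d b x"
  have a: "?a \<in> cs_carrier (C0 T)" using LC RC by (rule C0_diff_closed)
  show "fst d b = snd d b"
  proof (rule C0_eqI [OF LC RC])
    fix x assume x: "x \<in> topspace T"
    have "?a x * fst d b x = snd d ?a x * b x"
      using DC_mult(2) [OF d a b, THEN fun_cong, of x] x by simp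
    moreover have "?a x * snd d b x = b x * snd d ?a x"
    proof -
      have "(\<lambda>x\<in>topspace T. ?a x * b x) = (\<lambda>x\<in>topspace T. b x * ?a x)" by (simp add: mult.commute)
      then have "(\<lambda>x\<in>topspace T. ?a x * snd d b x) = (\<lambda>x\<in>topspace T. b x * snd d ?a x)"
        using DC_mult(1) [OF d a b] DC_mult(1) [OF d b a] by metis
      from this [THEN fun_cong, of x] x show ?thesis by simp
    qed
    ultimately have "?a x * (fst d b x - snd d b x) = 0" by (simp add: right_diff_distrib)
    then show "fst d b x = snd d b x" using x by simp
  qed
qed

lemma DC_eqI:
  assumes d: "d \<in> double_centralizers (C0 T)" and d': "d' \<in> double_centralizers (C0 T)"
    and eq: "\<And>a. a \<in> cs_carrier (C0 T) \<Longrightarrow> snd d a = snd d' a"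
  shows "d = d'"
proof -
  have "snd d = snd d'"
    by (rule PiE_ext [OF DC_D(1) [OF d disjI2 [OF refl]] DC_D(1) [OF d' disjI2 [OF refl]] eq])
  then show ?thesis using DC_commutative [OF d] DC_commutative [OF d'] by (metis prod.collapse)
qed

text \<open>Both operators are bounded, so agreement on a dense subspace is enough.
  \<open>Cc\<close> is where \<open>is_D_inner\<close> prescribes the values of a candidate.\<close>

lemma DC_eqI_dense:
  assumes d: "d \<in> double_centralizers (C0 T)" and d': "d' \<in> double_centralizers (C0 T)"
    and T: "Hausdorff_space T" and eq: "\<And>a. a \<in> Cc T \<Longrightarrow> snd d a = snd d' a"
  shows "d = d'"
proof (rule DC_eqI [OF d d'])
  fix a assume a: "a \<in> cs_carrier (C0 T)"
  let ?L = "snd d" and ?R = "snd d'"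
  have LC: "?L f \<in> cs_carrier (C0 T)" and RC: "?R f \<in> cs_carrier (C0 T)" if "f \<in> cs_carrier (C0 T)" for f
    using DC_D(1) [OF d] DC_D(1) [OF d'] that by (auto dest: PiE_mem)
  obtain B where B: "\<forall>a\<in>cs_carrier (C0 T). cs_norm (C0 T) (?L a) \<le> B * cs_norm (C0 T) a"
    using DC_D(4) [OF d disjI2 [OF refl]] by blast
  obtain B' where B': "\<forall>a\<in>cs_carrier (C0 T). cs_norm (C0 T) (?R a) \<le> B' * cs_norm (C0 T) a"
    using DC_D(4) [OF d' disjI2 [OF refl]] by blast
  show "?L a = ?R a"
  proof (rule C0_eqI [OF LC [OF a] RC [OF a]])
    fix x assume x: "x \<in> topspace T"
    have "cmod (?L a x - ?R a x) \<le> \<epsilon>" if e: "0 < \<epsilon>" for \<epsilon>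
    proof -
      \<comment> \<open>The bounds given by \<open>double_centralizers\<close> carry no sign, hence
        the absolute values; the 1 keeps the divisor positive.\<close>
      define \<delta> where "\<delta> = \<epsilon> / (\<bar>B\<bar> + \<bar>B'\<bar> + 1)"
      have d0: "0 < \<delta>" using e by (simp add: \<delta>_def)
      obtain g where g: "g \<in> Cc T" "\<And>x. x \<in> topspace T \<Longrightarrow> cmod (g x - a x) \<le> \<delta>"
        using Cc_approx [OF T a d0] by blast
      have gC: "g \<in> cs_carrier (C0 T)" using g(1) Cc_subset_C0 by blast
      let ?h = "\<lambda>x\<in>topspace T. a x - g x"
      have h: "?h \<in> cs_carrier (C0 T)" using a gC by (rule C0_diff_closed)
      have hn: "cs_norm (C0 T) ?h \<le> \<delta>" using g(2) d0 by (intro C0_norm_le) (auto simp: norm_minus_commute)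
      have "a = (\<lambda>x\<in>topspace T. ?h x + g x)"
        by (rule C0_eqI [OF a C0_add_closed [OF h gC]]) simp
      then have "?L a = ?L (\<lambda>x\<in>topspace T. ?h x + g x)" "?R a = ?R (\<lambda>x\<in>topspace T. ?h x + g x)"
        by (rule arg_cong)+
      then have "?L a = (\<lambda>x\<in>topspace T. ?L ?h x + ?L g x)" "?R a = (\<lambda>x\<in>topspace T. ?R ?h x + ?R g x)"
        unfolding DC_D(2) [OF d disjI2 [OF refl] h gC] DC_D(2) [OF d' disjI2 [OF refl] h gC] .
      from this [THEN fun_cong, of x] x have eqa: "?L a x = ?L ?h x + ?L g x" "?R a x = ?R ?h x + ?R g x"
        by (simp_all only: restrict_apply')
      have bound: "t * cs_norm (C0 T) ?h \<le> \<bar>t\<bar> * \<delta>" for t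
      proof -
        have "t * cs_norm (C0 T) ?h \<le> \<bar>t\<bar> * cs_norm (C0 T) ?h"
          using C0_norm_nonneg [OF h] by (intro mult_right_mono) auto
        also have "\<dots> \<le> \<bar>t\<bar> * \<delta>" using hn by (intro mult_left_mono) auto
        finally show ?thesis .
      qed
      have "cmod (?L a x - ?R a x) = cmod (?L ?h x - ?R ?h x)"
        using eqa eq [OF g(1)] by simp
      also have "\<dots> \<le> cmod (?L ?h x) + cmod (?R ?h x)" by (rule norm_triangle_ineq4)
      also have "\<dots> \<le> cs_norm (C0 T) (?L ?h) + cs_norm (C0 T) (?R ?h)"
        by (intro add_mono C0_norm_upper LC RC h x)
      also have "\<dots> \<le> \<bar>B\<bar> * \<delta> + \<bar>B'\<bar> * \<delta>"
        by (intro add_mono order_trans [OF bspec [OF B h] bound] order_trans [OF bspec [OF B' h] bound])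
      also have "\<dots> \<le> (\<bar>B\<bar> + \<bar>B'\<bar> + 1) * \<delta>" using d0 by (simp add: algebra_simps)
      also have "\<dots> = \<epsilon>" by (simp add: \<delta>_def)
      finally show ?thesis .
    qed
    then have "cmod (?L a x - ?R a x) \<le> 0" by (rule field_le_epsilon) simp
    then show "?L a x = ?R a x" by simp
  qed
qed

lemma mult_op_apply: "f \<in> cs_carrier (C0 T) \<Longrightarrow> mult_op T h f = (\<lambda>x\<in>topspace T. h x * f x)"
  by (simp add: mult_op_def)

lemma multiplier_DC:
  assumes h: "continuous_map T euclidean h" and B: "\<And>x. x \<in> topspace T \<Longrightarrow> cmod (h x) \<le> B"
  shows "multiplier T h \<in> double_centralizers (C0 T)"
proof -
  have C: "(\<lambda>x\<in>topspace T. h x * f x) \<in> cs_carrier (C0 T)" if "f \<in> cs_carrier (C0 T)" for f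
    by (rule C0_mult_bounded_closed [OF h B that])
  have "cs_norm (C0 T) (\<lambda>x\<in>topspace T. h x * f x) \<le> \<bar>B\<bar> * cs_norm (C0 T) f" if f: "f \<in> cs_carrier (C0 T)" for f
  proof (rule C0_norm_le)
    fix x assume x: "x \<in> topspace T"
    have "cmod (h x * f x) \<le> \<bar>B\<bar> * cs_norm (C0 T) f"
      unfolding norm_mult using B [OF x] C0_norm_upper [OF f x] by (intro mult_mono) auto
    then show "cmod ((\<lambda>x\<in>topspace T. h x * f x) x) \<le> \<bar>B\<bar> * cs_norm (C0 T) f" using x by simp
  qed (simp add: C0_norm_nonneg [OF f])
  then show ?thesis
    using C C0_closed unfolding double_centralizers_def multiplier_def
    by (auto simp: mult_op_apply C0_add_closed C0_mult_closed C0_scale_closed distrib_left ac_simps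
        cong: restrict_cong intro!: exI [of _ "\<bar>B\<bar>"]) (simp add: mult_op_def)
qed

section \<open>Bochner integrals of functions with values in \<open>C\<^sub>0\<close>\<close>

lemma has_cs_integral_cong:
  assumes "\<And>w. w \<in> space M \<Longrightarrow> f w = g w"
  shows "has_cs_integral A M f z \<longleftrightarrow> has_cs_integral A M g z"
proof -
  have "f \<in> space M \<rightarrow> cs_carrier A \<longleftrightarrow> g \<in> space M \<rightarrow> cs_carrier A" using assms by (simp add: Pi_iff)
  moreover have "(\<lambda>w. cs_dist A (f w) (h w)) \<in> borel_measurable M \<longleftrightarrow> (\<lambda>w. cs_dist A (g w) (h w)) \<in> borel_measurable M" for h
    using assms by (intro measurable_cong) simp
  moreover have "(\<integral>\<^sup>+ w. ennreal (cs_dist A (f w) (h w)) \<partial>M) = (\<integral>\<^sup>+ w. ennreal (cs_dist A (g w) (h w)) \<partial>M)" for h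
    using assms by (intro nn_integral_cong) simp
  ultimately show ?thesis unfolding has_cs_integral_def by simp
qed

lemma simple_value_C0:
  assumes "\<forall>(S, v)\<in>set l. v \<in> cs_carrier (C0 T)"
  shows "simple_value (C0 T) l w \<in> cs_carrier (C0 T)" "simple_int (C0 T) M l \<in> cs_carrier (C0 T)"
  using assms
  by (induction l) (auto simp: simple_value_def simple_int_def simp del: restrict_apply
      intro!: C0_zero_closed C0_add_closed C0_scale_closed)

lemma has_bochner_integral_simple_value:
  assumes l: "\<forall>(S, v)\<in>set l. S \<in> sets M \<and> emeasure M S < \<infinity> \<and> v \<in> cs_carrier (C0 T)" and x: "x \<in> topspace T"
  shows "has_bochner_integral M (\<lambda>w. simple_value (C0 T) l w x) (simple_int (C0 T) M l x)"
  using l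
proof (induction l)
  case Nil
  then show ?case using x by (simp add: simple_value_def simple_int_def has_bochner_integral_zero)
next
  case (Cons p l)
  obtain S v where p: "p = (S, v)" by (cases p)
  have S: "S \<in> sets M" "emeasure M S < \<infinity>" using Cons.prems by (auto simp: p)
  have "has_bochner_integral M (\<lambda>w. indicator S w *\<^sub>R v x + simple_value (C0 T) l w x)
      (measure M S *\<^sub>R v x + simple_int (C0 T) M l x)"
    using S Cons by (intro has_bochner_integral_add has_bochner_integral_scaleR_left
        has_bochner_integral_real_indicator) auto
  moreover have "simple_value (C0 T) (p # l) w x = indicator S w *\<^sub>R v x + simple_value (C0 T) l w x" for w
    using x by (auto simp: p simple_value_def indicator_def)
  moreover have "simple_int (C0 T) M (p # l) x = measure M S *\<^sub>R v x + simple_int (C0 T) M l x"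
    using x by (simp add: p simple_int_def scaleR_conv_of_real)
  ultimately show ?case by simp
qed

text \<open>Evaluation at \<open>x\<close> does not increase distances, so simple functions
  approximating in the mean become scalar simple functions that approximate in L^1. This forces the
  values of any \<open>z\<close> that satisfies the integral condition, and with them the inner
  product.\<close>

lemma has_cs_integral_C0_eval:
  assumes int: "has_cs_integral (C0 T) M F z" and x: "x \<in> topspace T"
    and m: "(\<lambda>w. F w x) \<in> borel_measurable M"
  shows "(LINT w|M. F w x) = z x"
proof -
  obtain l where l: "\<And>n. \<forall>(S, v)\<in>set (l n). S \<in> sets M \<and> emeasure M S < \<infinity> \<and> v \<in> cs_carrier (C0 T)"
    and nn: "(\<lambda>n. \<integral>\<^sup>+ w. ennreal (cs_dist (C0 T) (F w) (simple_value (C0 T) (l n) w)) \<partial>M) \<longlonglongrightarrow> 0"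
    and si: "(\<lambda>n. cs_dist (C0 T) (simple_int (C0 T) M (l n)) z) \<longlonglongrightarrow> 0"
    and F: "F \<in> space M \<rightarrow> cs_carrier (C0 T)" and z: "z \<in> cs_carrier (C0 T)"
    using int unfolding has_cs_integral_def by auto
  define s where "s n w = simple_value (C0 T) (l n) w x" for n w
  define I where "I n = simple_int (C0 T) M (l n) x" for n
  have lC: "\<forall>(S, v)\<in>set (l n). v \<in> cs_carrier (C0 T)" for n using l [of n] by auto
  have s: "has_bochner_integral M (s n) (I n)" for n
    unfolding s_def I_def by (rule has_bochner_integral_simple_value [OF l x])
  have bound: "(\<integral>\<^sup>+ w. ennreal (cmod (F w x - s n w)) \<partial>M) \<le>
      (\<integral>\<^sup>+ w. ennreal (cs_dist (C0 T) (F w) (simple_value (C0 T) (l n) w)) \<partial>M)" for n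
    using F x simple_value_C0(1) [OF lC] unfolding s_def
    by (intro nn_integral_mono ennreal_leI C0_dist_upper) auto
  have small: "\<forall>\<^sub>F n in sequentially. (\<integral>\<^sup>+ w. ennreal (cmod (F w x - s n w)) \<partial>M) < ennreal \<epsilon>" if "0 < \<epsilon>" for \<epsilon>
    using order_tendstoD(2) [OF nn, of "ennreal \<epsilon>"] that
    by (auto elim!: eventually_mono intro: le_less_trans [OF bound])
  \<comment> \<open>One approximant at finite distance is enough to make the evaluated function
    integrable.\<close>
  obtain N where N: "(\<integral>\<^sup>+ w. ennreal (cmod (F w x - s N w)) \<partial>M) < ennreal 1"
    using small [of 1] by (auto simp: eventually_sequentially)
  have sN: "integrable M (s n)" for n using s by (rule integrable.intros)
  have "integrable M (\<lambda>w. F w x - s N w)"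
    using m sN N by (intro integrableI_bounded) (auto intro: less_trans)
  from Bochner_Integration.integrable_add [OF this sN [of N]] have iF: "integrable M (\<lambda>w. F w x)" by simp
  have "(\<lambda>n. I n) \<longlonglongrightarrow> (LINT w|M. F w x)"
  proof (rule tendstoI)
    fix \<epsilon> :: real assume e: "0 < \<epsilon>"
    show "\<forall>\<^sub>F n in sequentially. dist (I n) (LINT w|M. F w x) < \<epsilon>"
      using small [OF e]
    proof eventually_elim
      case (elim n)
      have "ennreal (cmod (LINT w|M. F w x - s n w)) \<le> (\<integral>\<^sup>+ w. ennreal (cmod (F w x - s n w)) \<partial>M)"
        using iF sN by (intro integral_norm_bound_ennreal) auto
      then have "ennreal (cmod (LINT w|M. F w x - s n w)) < ennreal \<epsilon>" using elim by simp
      then have "cmod (LINT w|M. F w x - s n w) < \<epsilon>" using e by (simp add: ennreal_less_iff)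
      moreover have "(LINT w|M. F w x - s n w) = (LINT w|M. F w x) - I n"
        using iF sN has_bochner_integral_integral_eq [OF s] by simp
      ultimately show ?case by (simp add: dist_norm norm_minus_commute)
    qed
  qed
  moreover have "(\<lambda>n. I n) \<longlonglongrightarrow> z x"
  proof (rule tendstoI)
    fix \<epsilon> :: real assume e: "0 < \<epsilon>"
    show "\<forall>\<^sub>F n in sequentially. dist (I n) (z x) < \<epsilon>"
      using order_tendstoD(2) [OF si e]
    proof eventually_elim
      case (elim n)
      then show ?case
        using C0_dist_upper [OF simple_value_C0(2) [OF lC] z x, of M n] by (simp add: dist_norm I_def)
    qed
  qed
  ultimately show ?thesis by (rule LIMSEQ_unique)
qed

text \<open>\<open>simple_value\<close> adds the vectors of overlapping sets, so a finite cover is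
  made disjoint first: whatever \<open>U g\<close> takes from \<open>R\<close> is removed before the
  next sample point is treated.\<close>

primrec pieces :: "('w \<Rightarrow> 'w set) \<Rightarrow> ('w \<Rightarrow> 'a) \<Rightarrow> 'w set \<Rightarrow> 'w list \<Rightarrow> ('w set \<times> 'a) list" where
  "pieces U F R [] = []"
| "pieces U F R (g # gs) = (R \<inter> U g, F g) # pieces U F (R - U g) gs"

lemma simple_value_pieces_outside:
  "w \<notin> R \<Longrightarrow> simple_value (C0 T) (pieces U F R gs) w = (\<lambda>x\<in>topspace T. 0)"
  by (induction gs arbitrary: R) (auto simp: simple_value_def)

lemma simple_value_pieces_Cons:
  assumes "F g \<in> cs_carrier (C0 T)"
  shows "simple_value (C0 T) (pieces U F R (g # gs)) w =
    (if w \<in> R \<inter> U g then F g else simple_value (C0 T) (pieces U F (R - U g) gs) w)"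
proof (cases "w \<in> R \<inter> U g")
  case True
  then have "simple_value (C0 T) (pieces U F R (g # gs)) w =
      (\<lambda>x\<in>topspace T. F g x + simple_value (C0 T) (pieces U F (R - U g) gs) w x)"
    by (simp add: simple_value_def)
  also have "\<dots> = (\<lambda>x\<in>topspace T. F g x)"
    using True by (subst simple_value_pieces_outside) auto
  also have "\<dots> = F g" using C0_extensional [OF assms] by (simp add: extensional_restrict)
  finally show ?thesis using True by simp
qed (auto simp: simple_value_def)

text \<open>On a set \<open>K\<close> of finite measure, \<open>F\<close> is replaced by its values
  at finitely many sample points with uniform error \<delta>. The mean error is then at most
  \<delta> times the measure of \<open>K\<close>, and the integrals are compared with
  \<open>z\<close> pointwise, where only scalar integrals occur.\<close>

lemma has_cs_integral_C0I:
  assumes F: "\<And>w. w \<in> space M \<Longrightarrow> F w \<in> cs_carrier (C0 T)" and z: "z \<in> cs_carrier (C0 T)"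
    and K: "K \<in> sets M" "emeasure M K < \<infinity>" "\<And>w. w \<in> space M \<Longrightarrow> w \<notin> K \<Longrightarrow> F w = (\<lambda>x\<in>topspace T. 0)"
    and meas: "\<And>v. v \<in> cs_carrier (C0 T) \<Longrightarrow> (\<lambda>w. cs_dist (C0 T) (F w) v) \<in> borel_measurable M"
    and approx: "\<And>\<delta>. 0 < \<delta> \<Longrightarrow> \<exists>gs U. set gs \<subseteq> space M \<and> (\<forall>g\<in>set gs. U g \<in> sets M) \<and>
        K \<subseteq> (\<Union>g\<in>set gs. U g) \<and> (\<forall>g\<in>set gs. \<forall>w\<in>U g. cs_dist (C0 T) (F w) (F g) \<le> \<delta>)"
    and int: "\<And>x. x \<in> topspace T \<Longrightarrow> integrable M (\<lambda>w. F w x)"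
      "\<And>x. x \<in> topspace T \<Longrightarrow> (LINT w|M. F w x) = z x"
  shows "has_cs_integral (C0 T) M F z"
proof -
  have step: "\<exists>l. (\<forall>(S, v)\<in>set l. S \<in> sets M \<and> emeasure M S < \<infinity> \<and> v \<in> cs_carrier (C0 T)) \<and>
      (\<lambda>w. cs_dist (C0 T) (F w) (simple_value (C0 T) l w)) \<in> borel_measurable M \<and>
      (\<integral>\<^sup>+ w. ennreal (cs_dist (C0 T) (F w) (simple_value (C0 T) l w)) \<partial>M) \<le> ennreal \<epsilon> \<and>
      cs_dist (C0 T) (simple_int (C0 T) M l) z \<le> \<epsilon>" if e: "0 < \<epsilon>" for \<epsilon>
  proof -
    \<comment> \<open>The 1 covers a null set \<open>K\<close>.\<close>
    define \<delta> where "\<delta> = \<epsilon> / (measure M K + 1)"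
    have mK: "0 < measure M K + 1" by (simp add: add_nonneg_pos)
    then have d: "0 < \<delta>" using e by (simp add: \<delta>_def)
    obtain gs U where gs: "set gs \<subseteq> space M" "\<forall>g\<in>set gs. U g \<in> sets M" "K \<subseteq> (\<Union>g\<in>set gs. U g)"
      "\<forall>g\<in>set gs. \<forall>w\<in>U g. cs_dist (C0 T) (F w) (F g) \<le> \<delta>"
      using approx [OF d] by blast
    let ?l = "pieces U F K gs"
    \<comment> \<open>Stated for every remainder \<open>R\<close> and every list with entries from
      \<open>gs\<close>, as \<open>pieces\<close> shrinks both in its recursion; the facts
      \<open>m\<close> and \<open>close\<close> are generalised in the same way.\<close>
    have l: "\<forall>(S, v)\<in>set (pieces U F R gs'). S \<in> sets M \<and> emeasure M S < \<infinity> \<and> v \<in> cs_carrier (C0 T)"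
      if "R \<in> sets M" "R \<subseteq> K" "set gs' \<subseteq> set gs" for R gs'
      using that
    proof (induction gs' arbitrary: R)
      case (Cons g gs')
      have "emeasure M (R \<inter> U g) \<le> emeasure M K" using Cons.prems K by (intro emeasure_mono) auto
      moreover have "R - U g \<in> sets M" "R \<inter> U g \<in> sets M" using Cons.prems gs by auto
      ultimately show ?case
        using Cons.IH [of "R - U g"] Cons.prems K(2) F gs(1) by (auto intro: le_less_trans)
    qed simp
    have lK: "\<forall>(S, v)\<in>set ?l. S \<in> sets M \<and> emeasure M S < \<infinity> \<and> v \<in> cs_carrier (C0 T)"
      using l K(1) by blast
    have m: "(\<lambda>w. cs_dist (C0 T) (F w) (simple_value (C0 T) (pieces U F R gs') w)) \<in> borel_measurable M"
      if "R \<in> sets M" "set gs' \<subseteq> set gs" for R gs'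
      using that
    proof (induction gs' arbitrary: R)
      case Nil
      then show ?case using meas [OF C0_zero_closed] by (simp add: simple_value_def del: restrict_apply)
    next
      case (Cons g gs')
      have g: "g \<in> set gs" using Cons.prems by simp
      then have Fg: "F g \<in> cs_carrier (C0 T)" using F gs(1) by blast
      have S: "R - U g \<in> sets M" "R \<inter> U g \<in> sets M" using Cons.prems g gs(2) by auto
      have "(\<lambda>w. if w \<in> R \<inter> U g then cs_dist (C0 T) (F w) (F g)
          else cs_dist (C0 T) (F w) (simple_value (C0 T) (pieces U F (R - U g) gs') w)) \<in> borel_measurable M"
        using S meas [OF Fg] Cons.IH [OF S(1)] Cons.prems by (intro measurable_If_set) (auto intro: sets.Int)
      then show ?case
        by (rule measurable_cong [THEN iffD1, rotated])
           (simp add: simple_value_pieces_Cons [of F g T, OF Fg] del: pieces.simps)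
    qed
    have close: "cs_dist (C0 T) (F w) (simple_value (C0 T) (pieces U F R gs') w) \<le> \<delta>"
      if "w \<in> R" "w \<in> (\<Union>g\<in>set gs'. U g)" "set gs' \<subseteq> set gs" for w R gs'
      using that
    proof (induction gs' arbitrary: R)
      case (Cons g gs')
      have g: "g \<in> set gs" using Cons.prems by simp
      then have Fg: "F g \<in> cs_carrier (C0 T)" using F gs(1) by blast
      show ?case
      proof (cases "w \<in> U g")
        case True
        then show ?thesis using Cons.prems gs(4) g
          by (simp add: simple_value_pieces_Cons [of F g T, OF Fg] del: pieces.simps)
      next
        case False
        then show ?thesis
          using Cons.IH [of "R - U g"] Cons.prems
          by (simp add: simple_value_pieces_Cons [of F g T, OF Fg] del: pieces.simps)
      qed
    qed simp
    have zero: "cs_dist (C0 T) (F w) (simple_value (C0 T) ?l w) = 0" if "w \<in> space M" "w \<notin> K" for w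
    proof -
      have "cs_dist (C0 T) (\<lambda>x\<in>topspace T. 0) (\<lambda>x\<in>topspace T. 0) \<le> 0"
        by (subst C0_dist_le_iff [OF C0_zero_closed C0_zero_closed]) auto
      then show ?thesis
        unfolding K(3) [OF that] simple_value_pieces_outside [OF that(2)]
        using C0_dist_nonneg order_antisym by blast
    qed
    have "(\<integral>\<^sup>+ w. ennreal (cs_dist (C0 T) (F w) (simple_value (C0 T) ?l w)) \<partial>M) \<le>
        (\<integral>\<^sup>+ w. ennreal \<delta> * indicator K w \<partial>M)"
    proof (rule nn_integral_mono)
      fix w assume w: "w \<in> space M"
      show "ennreal (cs_dist (C0 T) (F w) (simple_value (C0 T) ?l w)) \<le> ennreal \<delta> * indicator K w"
      proof (cases "w \<in> K")
        case True
        then show ?thesis using close [of w K gs] gs(3) by (auto intro: ennreal_leI)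
      qed (simp add: zero [OF w])
    qed
    also have "\<dots> = ennreal \<delta> * emeasure M K" using K(1) by (rule nn_integral_cmult_indicator)
    also have "\<dots> = ennreal (\<delta> * measure M K)"
      using K(2) d by (simp add: emeasure_eq_ennreal_measure less_top ennreal_mult)
    also have "\<dots> \<le> ennreal \<epsilon>"
      using e mK by (intro ennreal_leI) (simp add: \<delta>_def field_simps)
    finally have nn: "(\<integral>\<^sup>+ w. ennreal (cs_dist (C0 T) (F w) (simple_value (C0 T) ?l w)) \<partial>M) \<le> ennreal \<epsilon>" .
    have lC: "\<forall>(S, v)\<in>set ?l. v \<in> cs_carrier (C0 T)" using lK by auto
    have "cs_dist (C0 T) (simple_int (C0 T) M ?l) z \<le> \<epsilon>"
    proof (subst C0_dist_le_iff [OF simple_value_C0(2) [OF lC] z])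
      show "\<forall>x\<in>topspace T. cmod (simple_int (C0 T) M ?l x - z x) \<le> \<epsilon>"
      proof
        fix x assume x: "x \<in> topspace T"
        have s: "has_bochner_integral M (\<lambda>w. simple_value (C0 T) ?l w x) (simple_int (C0 T) M ?l x)"
          by (rule has_bochner_integral_simple_value [OF lK x])
        then have isv: "integrable M (\<lambda>w. simple_value (C0 T) ?l w x)" by (rule integrable.intros)
        have "ennreal (cmod (LINT w|M. F w x - simple_value (C0 T) ?l w x)) \<le>
            (\<integral>\<^sup>+ w. ennreal (cmod (F w x - simple_value (C0 T) ?l w x)) \<partial>M)"
          using int(1) [OF x] isv by (intro integral_norm_bound_ennreal) auto
        also have "\<dots> \<le> (\<integral>\<^sup>+ w. ennreal (cs_dist (C0 T) (F w) (simple_value (C0 T) ?l w)) \<partial>M)"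
          using F x simple_value_C0(1) [OF lC] by (intro nn_integral_mono ennreal_leI C0_dist_upper) auto
        also note nn
        finally have "cmod (LINT w|M. F w x - simple_value (C0 T) ?l w x) \<le> \<epsilon>"
          using e by (simp add: ennreal_le_iff)
        moreover have "(LINT w|M. F w x - simple_value (C0 T) ?l w x) = z x - simple_int (C0 T) M ?l x"
          using int [OF x] isv has_bochner_integral_integral_eq [OF s] by simp
        ultimately show "cmod (simple_int (C0 T) M ?l x - z x) \<le> \<epsilon>" by (simp add: norm_minus_commute)
      qed
    qed (use e in simp)
    then show ?thesis using lK m [OF K(1) order_refl] nn by blast
  qed
  have "\<forall>n. \<exists>l. (\<forall>(S, v)\<in>set l. S \<in> sets M \<and> emeasure M S < \<infinity> \<and> v \<in> cs_carrier (C0 T)) \<and>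
      (\<lambda>w. cs_dist (C0 T) (F w) (simple_value (C0 T) l w)) \<in> borel_measurable M \<and>
      (\<integral>\<^sup>+ w. ennreal (cs_dist (C0 T) (F w) (simple_value (C0 T) l w)) \<partial>M) \<le> ennreal (inverse (real (Suc n))) \<and>
      cs_dist (C0 T) (simple_int (C0 T) M l) z \<le> inverse (real (Suc n))"
    by (intro allI step) simp
  from choice [OF this] obtain l where l: "\<forall>n. (\<forall>(S, v)\<in>set (l n). S \<in> sets M \<and> emeasure M S < \<infinity> \<and> v \<in> cs_carrier (C0 T)) \<and>
      (\<lambda>w. cs_dist (C0 T) (F w) (simple_value (C0 T) (l n) w)) \<in> borel_measurable M \<and>
      (\<integral>\<^sup>+ w. ennreal (cs_dist (C0 T) (F w) (simple_value (C0 T) (l n) w)) \<partial>M) \<le> ennreal (inverse (real (Suc n))) \<and>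
      cs_dist (C0 T) (simple_int (C0 T) M (l n)) z \<le> inverse (real (Suc n))"
    by (rule exE)
  have inv0: "(\<lambda>n. ennreal (inverse (real (Suc n)))) \<longlonglongrightarrow> 0"
    using tendsto_ennrealI [OF LIMSEQ_inverse_real_of_nat] by simp
  show ?thesis
    unfolding has_cs_integral_def
  proof (intro conjI exI [of _ l])
    show "(\<lambda>n. \<integral>\<^sup>+ w. ennreal (cs_dist (C0 T) (F w) (simple_value (C0 T) (l n) w)) \<partial>M) \<longlonglongrightarrow> 0"
      by (rule tendsto_sandwich [OF _ _ tendsto_const inv0]) (use l in auto)
    show "(\<lambda>n. cs_dist (C0 T) (simple_int (C0 T) M (l n)) z) \<longlonglongrightarrow> 0"
      by (rule tendsto_sandwich [OF _ _ tendsto_const LIMSEQ_inverse_real_of_nat])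
         (use l in \<open>auto simp: C0_dist_nonneg\<close>)
  qed (use F z l in auto)
qed

section \<open>The inner product with values in the multipliers\<close>

context groupoid_space
begin

text \<open>Again the violating pairs over a compact neighbourhood form a compact set. The condition
  says that the integrand is within \<open>t\<close> of the section \<open>g\<close>; its openness
  gives both the measurability of the distance to a fixed vector and the covers needed for
  approximation by simple functions.\<close>

lemma corr_near_usc:
  assumes c: "c \<in> Cc X" and \<phi>: "\<phi> \<in> Cc X" and g: "g \<in> cs_carrier (C0 X)" and t: "0 < t"
  shows "openin TG {\<gamma> \<in> carr. \<forall>x. (\<gamma>, x) \<in> topspace XG \<longrightarrow> cmod (corr c \<phi> (\<gamma>, x) - g x) < t}"
    (is "openin TG ?U")
proof (subst openin_subopen, clarify)
  fix \<gamma> assume \<gamma>: "\<gamma> \<in> carr" and less: "\<forall>x. (\<gamma>, x) \<in> topspace XG \<longrightarrow> cmod (corr c \<phi> (\<gamma>, x) - g x) < t"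
  obtain P where P: "compactin XG P" "\<And>z. z \<in> topspace XG \<Longrightarrow> corr c \<phi> z \<noteq> 0 \<Longrightarrow> z \<in> P"
    using corr_support [OF c \<phi>] by blast
  obtain W N where W: "openin TG W" "compactin TG N" "\<gamma> \<in> W" "W \<subseteq> N"
    using locally_compact_groupoid \<gamma> unfolding locally_compact_space_def by blast
  let ?D = "\<lambda>z. corr c \<phi> z - g (snd z)"
  have contD: "continuous_map XG euclidean ?D"
    using continuous_corr [OF Cc_continuous [OF c] Cc_continuous [OF \<phi>]]
      continuous_map_compose [OF continuous_snd_XG C0_continuous [OF g]]
    by (intro continuous_map_diff) (auto simp: o_def)
  \<comment> \<open>If the difference has modulus at least \<open>t\<close>, then either the kernel
    is nonzero and the pair lies in \<open>P\<close>, or |g x| \<ge> t; so this compact set contains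
    all violating pairs over \<open>N\<close>.\<close>
  let ?Q = "P \<union> {(\<gamma>, x) \<in> topspace XG. \<gamma> \<in> N \<and> x \<in> {x \<in> topspace X. t \<le> cmod (g x)}}"
  let ?Z = "?Q \<inter> {z \<in> topspace XG. t \<le> cmod (?D z)}"
  have "compactin XG ?Q"
    by (intro compactin_Un P(1) compactin_GX_Times(2) W(2) C0_compactin [OF g t])
  then have "compactin XG ?Z"
    by (rule compact_Int_closedin [OF _ closedin_continuous_cmod_ge [OF contD]])
  then have cl: "closedin TG (fst ` ?Z)" by (rule compactin_fst_XG_closed)
  have "\<gamma> \<notin> fst ` ?Z" using less by force
  moreover have "W - fst ` ?Z \<subseteq> ?U"
  proof (intro subsetI CollectI conjI allI impI)
    fix \<eta> assume \<eta>: "\<eta> \<in> W - fst ` ?Z"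
    then show "\<eta> \<in> carr" using openin_subset [OF W(1)] by blast
    fix x assume x: "(\<eta>, x) \<in> topspace XG"
    show "cmod (corr c \<phi> (\<eta>, x) - g x) < t"
    proof (rule ccontr)
      assume "\<not> ?thesis"
      then have ge: "t \<le> cmod (?D (\<eta>, x))" by simp
      have "(\<eta>, x) \<in> ?Q"
      proof (cases "corr c \<phi> (\<eta>, x) = 0")
        case True
        then have "t \<le> cmod (g x)" using ge by simp
        moreover have "x \<in> topspace X" using x by (simp add: topspace_XG)
        ultimately show ?thesis using x \<eta> W(4) by blast
      next
        case False
        then show ?thesis using P(2) [OF x] by blast
      qed
      then have "(\<eta>, x) \<in> ?Z" using x ge by blast
      then show False using \<eta> by force
    qed
  qed
  ultimately show "\<exists>T. openin TG T \<and> \<gamma> \<in> T \<and> T \<subseteq> ?U"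
    using W(1,3) cl by (intro exI [of _ "W - fst ` ?Z"]) blast
qed

text \<open>The integrand of \<open>is_D_inner\<close> with the fibre taken at
  \<open>r \<gamma>\<close> instead of a fixed unit; the two agree on the range fibre over that
  unit.\<close>

definition pairing :: "('x \<Rightarrow> complex) \<Rightarrow> ('x \<Rightarrow> complex) \<Rightarrow> 'g \<Rightarrow> 'x \<Rightarrow> complex" where
  "pairing c f \<gamma> = cs_mult (sys_fibre Sys (r \<gamma>)) (sys_eval Sys c (r \<gamma>)) (sys_act Sys \<gamma> (sys_eval Sys f (s \<gamma>)))"

lemma pairing_eq:
  assumes "\<gamma> \<in> carr"
  shows "pairing c f \<gamma> = (\<lambda>x\<in>topspace (fib (r \<gamma>)). corr c f (\<gamma>, x))"
  using assms by (auto simp: pairing_def C0_system_sel lt_def corr_def topspace_fib fun_eq_iff)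

lemma pairing_C0:
  assumes g: "\<gamma> \<in> carr" and c: "c \<in> cs_carrier (C0 X)" and f: "f \<in> cs_carrier (C0 X)"
  shows "pairing c f \<gamma> \<in> cs_carrier (C0 (fib (r \<gamma>)))"
proof -
  have u: "r \<gamma> \<in> topspace (unit_space G)" "s \<gamma> \<in> topspace (unit_space G)"
    using g by (auto simp: topspace_unit_space)
  have "pairing c f \<gamma> = (\<lambda>x\<in>topspace (fib (r \<gamma>)). res c (r \<gamma>) x * lt \<gamma> (res f (s \<gamma>)) x)"
    using g by (simp add: pairing_def C0_system_sel)
  then show ?thesis using C0_mult_closed [OF res_C0 [OF c u(1)] lt_C0 [OF g res_C0 [OF f u(2)]]] by simp
qed

text \<open>On an orbit that meets the compact set \<open>K\<close> the value is taken at a point of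
  \<open>K\<close>, by invariance; on all other orbits it is zero. So a bound on \<open>K\<close> is
  a bound everywhere, although the function need not vanish at infinity on \<open>X\<close>.\<close>

lemma Psi_bounded:
  assumes \<phi>: "\<phi> \<in> Cc X"
  obtains B where "\<And>x. x \<in> topspace X \<Longrightarrow> cmod (Psi \<phi> x) \<le> B"
proof -
  obtain K where K: "compactin X K" "\<And>x. x \<in> topspace X \<Longrightarrow> \<phi> x \<noteq> 0 \<Longrightarrow> x \<in> K"
    using \<phi> by (rule Cc_supp) blast
  have "compactin euclidean (Psi \<phi> ` K)" by (rule image_compactin [OF K(1) continuous_Psi [OF \<phi>]])
  then have "bounded (Psi \<phi> ` K)" by (simp add: compact_imp_bounded)
  then obtain B where B: "\<And>x. x \<in> K \<Longrightarrow> cmod (Psi \<phi> x) \<le> B" by (auto simp: bounded_iff)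
  \<comment> \<open>\<open>K\<close> may be empty, and then \<open>B\<close> is arbitrary.\<close>
  have "cmod (Psi \<phi> x) \<le> max 0 B" if x: "x \<in> topspace X" for x
  proof (cases "Psi \<phi> x = 0")
    case False
    then obtain \<gamma> where \<gamma>: "\<gamma> \<in> carr" "r \<gamma> = rX x" "\<phi> (act (iv \<gamma>) x) \<noteq> 0"
      using Psi_nonzero_orbit [OF x] by blast
    then have "act (iv \<gamma>) x \<in> K" using K(2) x by simp
    moreover have "Psi \<phi> (act (iv \<gamma>) x) = Psi \<phi> x" using Psi_invariant [OF \<phi> x, of "iv \<gamma>"] \<gamma> by simp
    ultimately show ?thesis using B by (metis max.coboundedI2)
  qed simp
  then show thesis using that by blast
qed

text \<open>The value is found pointwise, where the factor c(x) leaves the scalar integral. The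
  criterion \<open>has_cs_integral_C0I\<close> then applies with \<open>K\<close> the projection of
  the kernel's support, cut down to the fibre over \<open>u\<close>. The second conclusion keeps the
  scalar integrals for the proof of uniqueness.\<close>

lemma has_cs_integral_pairing:
  assumes c: "c \<in> Cc X" and \<phi>: "\<phi> \<in> Cc X" and u: "u \<in> units G"
  shows "has_cs_integral (C0 (fib u)) (restrict_space (lam u) (range_fibre G u)) (pairing c \<phi>)
    (\<lambda>x\<in>topspace (fib u). c x * Psi \<phi> x)"
    (is "has_cs_integral _ ?M _ ?z")
    and pairing_integral: "x \<in> topspace (fib u) \<Longrightarrow>
      (\<lambda>\<gamma>. pairing c \<phi> \<gamma> x) \<in> borel_measurable (restrict_space (lam u) (range_fibre G u)) \<and>
      (LINT \<gamma>|restrict_space (lam u) (range_fibre G u). pairing c \<phi> \<gamma> x) = c x * Psi \<phi> x"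
proof -
  have uY: "u \<in> topspace (unit_space G)" using u by (simp add: topspace_unit_space)
  have cC: "c \<in> cs_carrier (C0 X)" and \<phi>C: "\<phi> \<in> cs_carrier (C0 X)" using c \<phi> Cc_subset_C0 by auto
  let ?R = "range_fibre G u"
  have R: "?R \<in> sets (lam u)" "?R \<subseteq> carr" using range_fibre_sets [OF u] by (auto simp: range_fibre_def)
  have spM: "space ?M = ?R" using R haar(1) [OF u] by (auto simp: space_restrict_space)
  have setsM: "U \<inter> ?R \<in> sets ?M" if "openin TG U \<or> closedin TG U" for U
  proof -
    have "U \<in> sets (lam u)"
      using that haar(2) [OF u] sets_borel_of_openin [of TG U] sets_borel_of_closedin [of TG U] by auto
    then show ?thesis by (auto simp: sets_restrict_space)
  qed
  have pF: "pairing c \<phi> \<gamma> = (\<lambda>x\<in>topspace (fib u). corr c \<phi> (\<gamma>, x))" if "\<gamma> \<in> ?R" for \<gamma>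
    using pairing_eq [of \<gamma>] that by (auto simp: range_fibre_def)
  have FC: "pairing c \<phi> \<gamma> \<in> cs_carrier (C0 (fib u))" if "\<gamma> \<in> ?R" for \<gamma>
    using pairing_C0 [OF _ cC \<phi>C] that by (auto simp: range_fibre_def)
  have XG: "(\<gamma>, x) \<in> topspace XG \<longleftrightarrow> x \<in> topspace (fib u)" if "\<gamma> \<in> ?R" for \<gamma> x
    using that by (auto simp: range_fibre_def topspace_XG topspace_fib)
  obtain B where B: "\<And>x. x \<in> topspace X \<Longrightarrow> cmod (Psi \<phi> x) \<le> B" using Psi_bounded [OF \<phi>] by blast
  have "(\<lambda>x\<in>topspace X. Psi \<phi> x * c x) \<in> cs_carrier (C0 X)"
    by (rule C0_mult_bounded_closed [OF continuous_Psi [OF \<phi>] B cC])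
  from res_C0 [OF this uY] have "res (\<lambda>x\<in>topspace X. Psi \<phi> x * c x) u \<in> cs_carrier (C0 (fib u))" .
  moreover have "res (\<lambda>x\<in>topspace X. Psi \<phi> x * c x) u = ?z" by (auto simp: topspace_fib)
  ultimately have zC: "?z \<in> cs_carrier (C0 (fib u))" by simp
  have less_iff: "cs_dist (C0 (fib u)) (pairing c \<phi> \<gamma>) (res g u) < t \<longleftrightarrow>
      (\<forall>x. (\<gamma>, x) \<in> topspace XG \<longrightarrow> cmod (corr c \<phi> (\<gamma>, x) - g x) < t)"
    if "\<gamma> \<in> ?R" "g \<in> cs_carrier (C0 X)" "0 < t" for \<gamma> g t
    using C0_dist_less_iff [OF FC [OF that(1)] res_C0 [OF that(2) uY] that(3)] XG [OF that(1)] pF [OF that(1)]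
    by (simp add: Ball_def)
  have int: "integrable ?M (\<lambda>\<gamma>. pairing c \<phi> \<gamma> x) \<and> (LINT \<gamma>|?M. pairing c \<phi> \<gamma> x) = ?z x"
    if x: "x \<in> topspace (fib u)" for x
  proof -
    have xX: "x \<in> topspace X" "rX x = u" using x by (auto simp: topspace_fib)
    obtain f where f: "f \<in> Cc TG" "\<And>\<gamma>. \<gamma> \<in> range_fibre G (rX x) \<Longrightarrow> f \<gamma> = \<phi> (act (iv \<gamma>) x)"
      using fibre_function_extends [OF \<phi> xX(1)] by blast
    have eq: "pairing c \<phi> \<gamma> x = c x * f \<gamma>" if "\<gamma> \<in> ?R" for \<gamma>
      using pF [OF that] f(2) that x xX by (simp add: corr_def)
    have i1: "integrable ?M (\<lambda>\<gamma>. c x * f \<gamma>)"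
    proof -
      have "integrable (lam u) (\<lambda>\<gamma>. indicator ?R \<gamma> *\<^sub>R (c x * f \<gamma>))"
        using R Cc_integrable [OF f(1) u] by (intro integrable_mult_indicator) auto
      then show ?thesis using R by (subst integrable_restrict_space) (auto simp: haar(1) [OF u] Int_absorb2)
    qed
    have "(LINT \<gamma>|?M. c x * f \<gamma>) = (LINT \<gamma>:?R|lam u. c x * f \<gamma>)"
      unfolding set_lebesgue_integral_def
      using R haar(1) [OF u] by (subst integral_restrict_space) (auto simp: Int_absorb2)
    also have "\<dots> = c x * (LINT \<gamma>:?R|lam u. f \<gamma>)" by simp
    also have "(LINT \<gamma>:?R|lam u. f \<gamma>) = Psi \<phi> x"
      unfolding Psi_def xX(2) using R(1) f(2) xX by (intro set_lebesgue_integral_cong) auto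
    finally have i2: "(LINT \<gamma>|?M. c x * f \<gamma>) = c x * Psi \<phi> x" .
    have "integrable ?M (\<lambda>\<gamma>. pairing c \<phi> \<gamma> x) \<longleftrightarrow> integrable ?M (\<lambda>\<gamma>. c x * f \<gamma>)"
      by (rule Bochner_Integration.integrable_cong) (use eq spM in auto)
    moreover have "(LINT \<gamma>|?M. pairing c \<phi> \<gamma> x) = (LINT \<gamma>|?M. c x * f \<gamma>)"
      by (rule Bochner_Integration.integral_cong) (use eq spM in auto)
    ultimately show ?thesis using i1 i2 x by simp
  qed
  show "(\<lambda>\<gamma>. pairing c \<phi> \<gamma> x) \<in> borel_measurable ?M \<and> (LINT \<gamma>|?M. pairing c \<phi> \<gamma> x) = c x * Psi \<phi> x"
    if "x \<in> topspace (fib u)" using int [OF that] that by auto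
  obtain P where P: "compactin XG P" "\<And>z. z \<in> topspace XG \<Longrightarrow> corr c \<phi> z \<noteq> 0 \<Longrightarrow> z \<in> P"
    using corr_support [OF c \<phi>] by blast
  let ?K = "fst ` P \<inter> ?R"
  have K: "compactin TG ?K"
    by (rule compact_Int_closedin [OF compactin_fst_XG_closed(1) [OF P(1)] closedin_range_fibre [OF u]])
  show "has_cs_integral (C0 (fib u)) ?M (pairing c \<phi>) ?z"
  proof (rule has_cs_integral_C0I [where K = ?K])
    show "?K \<in> sets ?M" using setsM compactin_fst_XG_closed(2) [OF P(1)] by blast
    have "emeasure ?M ?K = emeasure (lam u) ?K"
      using R haar(1) [OF u] by (intro emeasure_restrict_space) (auto simp: Int_absorb2)
    then show "emeasure ?M ?K < \<infinity>" using haar(3) [OF u K] by simp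
    show "pairing c \<phi> \<gamma> = (\<lambda>x\<in>topspace (fib u). 0)" if "\<gamma> \<in> space ?M" "\<gamma> \<notin> ?K" for \<gamma>
    proof -
      have gR: "\<gamma> \<in> ?R" using that spM by simp
      have "corr c \<phi> (\<gamma>, x) = 0" if "x \<in> topspace (fib u)" for x
        using P(2) [of "(\<gamma>, x)"] XG [OF gR] that \<open>\<gamma> \<notin> ?K\<close> gR by force
      then show ?thesis unfolding pF [OF gR] by (intro restrict_ext)
    qed
    show "(\<lambda>\<gamma>. cs_dist (C0 (fib u)) (pairing c \<phi> \<gamma>) v) \<in> borel_measurable ?M"
      if v: "v \<in> cs_carrier (C0 (fib u))" for v
      unfolding borel_measurable_iff_less
    proof
      fix t :: real
      obtain g where g: "g \<in> cs_carrier (C0 X)" "res g u = v" using lift_exists [OF uY v] .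
      show "{\<gamma> \<in> space ?M. cs_dist (C0 (fib u)) (pairing c \<phi> \<gamma>) v < t} \<in> sets ?M"
      proof (cases "0 < t")
        case True
        let ?U = "{\<gamma> \<in> carr. \<forall>x. (\<gamma>, x) \<in> topspace XG \<longrightarrow> cmod (corr c \<phi> (\<gamma>, x) - g x) < t}"
        have "{\<gamma> \<in> space ?M. cs_dist (C0 (fib u)) (pairing c \<phi> \<gamma>) v < t} = ?U \<inter> ?R"
          unfolding spM g(2) [symmetric] using less_iff [OF _ g(1) True] R(2) by blast
        then show ?thesis using setsM [of ?U] corr_near_usc [OF c \<phi> g(1) True] by simp
      next
        case False
        then have "\<not> cs_dist (C0 (fib u)) (pairing c \<phi> \<gamma>) v < t" for \<gamma>
          using C0_dist_nonneg [of "fib u" "pairing c \<phi> \<gamma>" v] by linarith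
        then show ?thesis by simp
      qed
    qed
    fix \<delta> :: real assume d: "0 < \<delta>"
    \<comment> \<open>Relatively open by \<open>corr_near_usc\<close>, applied to a section through
      the value at \<open>g\<close>; by compactness, finitely many of them cover
      \<open>K\<close>.\<close>
    let ?V = "\<lambda>g. {\<gamma> \<in> ?R. cs_dist (C0 (fib u)) (pairing c \<phi> \<gamma>) (pairing c \<phi> g) < \<delta>}"
    have "\<exists>U. openin TG U \<and> U \<inter> ?R = ?V g" if g: "g \<in> ?R" for g
    proof -
      obtain h where h: "h \<in> cs_carrier (C0 X)" "res h u = pairing c \<phi> g" using lift_exists [OF uY FC [OF g]] .
      let ?U = "{\<gamma> \<in> carr. \<forall>x. (\<gamma>, x) \<in> topspace XG \<longrightarrow> cmod (corr c \<phi> (\<gamma>, x) - h x) < \<delta>}"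
      have "?U \<inter> ?R = ?V g"
        unfolding h(2) [symmetric] using less_iff [OF _ h(1) d] R(2) by blast
      then show ?thesis using corr_near_usc [OF c \<phi> h(1) d] by blast
    qed
    then have "\<forall>g\<in>?R. \<exists>U. openin TG U \<and> U \<inter> ?R = ?V g" by (rule ballI)
    from bchoice [OF this] obtain U where UV: "\<forall>g\<in>?R. openin TG (U g) \<and> U g \<inter> ?R = ?V g"
      by (rule exE)
    have U: "openin TG (U g)" "U g \<inter> ?R = ?V g" if "g \<in> ?R" for g
      by (rule conjunct1 [OF bspec [OF UV that]], rule conjunct2 [OF bspec [OF UV that]])
    have self: "g \<in> U g" if "g \<in> ?R" for g
    proof -
      have "cs_dist (C0 (fib u)) (pairing c \<phi> g) (pairing c \<phi> g) < \<delta>"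
        using C0_dist_less_iff [OF FC [OF that] FC [OF that] d] d by simp
      then have "g \<in> ?V g" using that by simp
      then show ?thesis using U(2) [OF that] by blast
    qed
    obtain \<F> where \<F>: "finite \<F>" "\<F> \<subseteq> U ` ?K" "?K \<subseteq> \<Union>\<F>"
      using compactinD [OF K, of "U ` ?K"] U(1) self by blast
    obtain D where D: "finite D" "D \<subseteq> ?K" "\<F> = U ` D" using finite_subset_image [OF \<F>(1,2)] by blast
    obtain gs where gs: "set gs = D" using finite_list [OF D(1)] by blast
    show "\<exists>gs U. set gs \<subseteq> space ?M \<and> (\<forall>g\<in>set gs. U g \<in> sets ?M) \<and> ?K \<subseteq> (\<Union>g\<in>set gs. U g) \<and>
        (\<forall>g\<in>set gs. \<forall>w\<in>U g. cs_dist (C0 (fib u)) (pairing c \<phi> w) (pairing c \<phi> g) \<le> \<delta>)"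
    proof (intro exI conjI)
      show "set gs \<subseteq> space ?M" using gs D(2) spM by blast
      show "\<forall>g\<in>set gs. U g \<inter> ?R \<in> sets ?M" using gs D(2) U(1) setsM by blast
      show "?K \<subseteq> (\<Union>g\<in>set gs. U g \<inter> ?R)" using \<F>(3) D(3) gs by blast
      have "cs_dist (C0 (fib u)) (pairing c \<phi> w) (pairing c \<phi> g) \<le> \<delta>" if "g \<in> set gs" "w \<in> U g \<inter> ?R" for g w
      proof -
        have "g \<in> ?R" using that gs D(2) by blast
        then have "w \<in> ?V g" using U(2) that(2) by blast
        then show ?thesis by simp
      qed
      then show "\<forall>g\<in>set gs. \<forall>w\<in>U g \<inter> ?R. cs_dist (C0 (fib u)) (pairing c \<phi> w) (pairing c \<phi> g) \<le> \<delta>" by blast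
    qed
  qed (use FC spM zC int in \<open>simp_all del: restrict_apply\<close>)
qed

text \<open>The definite description has a unique solution because every element of the fibre is the
  value of a global function, and the left component, which alone is prescribed, determines the
  multiplier.\<close>

lemma multiplier_fibre_eq:
  assumes u: "u \<in> units G" and h: "continuous_map X euclidean h" and B: "\<And>x. x \<in> topspace X \<Longrightarrow> cmod (h x) \<le> B"
  shows "multiplier_fibre Sys (multiplier X h) u = multiplier (fib u) h"
  unfolding multiplier_fibre_def C0_system_sel
proof (rule the_equality)
  have uY: "u \<in> topspace (unit_space G)" using u by (simp add: topspace_unit_space)
  have "continuous_map (fib u) euclidean h"
    using h by (simp add: fibre_space_def continuous_map_from_subtopology)
  then have DC: "multiplier (fib u) h \<in> double_centralizers (C0 (fib u))"
    using B by (rule multiplier_DC) (simp add: topspace_fib)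
  have val: "(\<lambda>u\<in>units G. res (fst (multiplier X h) a) u) u = fst (multiplier (fib u) h) ((\<lambda>u\<in>units G. res a u) u)"
    if a: "a \<in> cs_carrier (C0 X)" for a
    using u a res_C0 [OF a uY] by (auto simp: multiplier_def mult_op_def topspace_fib fun_eq_iff)
  show "multiplier (fib u) h \<in> double_centralizers (C0 (fib u)) \<and>
    (\<forall>a\<in>cs_carrier (C0 X). (\<lambda>u\<in>units G. res (fst (multiplier X h) a) u) u =
       fst (multiplier (fib u) h) ((\<lambda>u\<in>units G. res a u) u))"
    using DC val by blast
  fix m assume m: "m \<in> double_centralizers (C0 (fib u)) \<and>
    (\<forall>a\<in>cs_carrier (C0 X). (\<lambda>u\<in>units G. res (fst (multiplier X h) a) u) u = fst m ((\<lambda>u\<in>units G. res a u) u))"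
  then have mDC: "m \<in> double_centralizers (C0 (fib u))" by blast
  show "m = multiplier (fib u) h"
  proof (rule DC_eqI [OF mDC DC])
    fix b assume "b \<in> cs_carrier (C0 (fib u))"
    then obtain a where a: "a \<in> cs_carrier (C0 X)" "res a u = b" using lift_exists [OF uY] by blast
    have "fst m ((\<lambda>u\<in>units G. res a u) u) = fst (multiplier (fib u) h) ((\<lambda>u\<in>units G. res a u) u)"
      using m val [OF a(1)] a(1) by metis
    then have "fst m b = fst (multiplier (fib u) h) b" using u a(2) by simp
    then show "snd m b = snd (multiplier (fib u) h) b"
      using DC_commutative [OF mDC] DC_commutative [OF DC] by simp
  qed
qed

text \<open>For an invariant \<open>h\<close>, multiplication commutes with translation, since
  h(\<gamma>^-1 x) = h(x). Once the fibres of the multiplier are known from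
  \<open>multiplier_fibre_eq\<close>, this is the fixed point condition.\<close>

lemma multiplier_fixed:
  assumes h: "continuous_map X euclidean h" and B: "\<And>x. x \<in> topspace X \<Longrightarrow> cmod (h x) \<le> B"
    and inv: "\<And>\<gamma> x. \<gamma> \<in> carr \<Longrightarrow> x \<in> topspace X \<Longrightarrow> s \<gamma> = rX x \<Longrightarrow> h (act \<gamma> x) = h x"
  shows "multiplier X h \<in> fixed_multipliers G Sys (Cc X)"
  unfolding fixed_multipliers_def C0_system_sel
proof (intro CollectI conjI ballI)
  show "multiplier X h \<in> cs_carrier (multiplier_algebra (C0 X))"
    using multiplier_DC [OF h B] by (simp add: multiplier_algebra_def)
  fix a assume a: "a \<in> Cc X"
  then obtain K where K: "compactin X K" "\<And>x. x \<in> topspace X \<Longrightarrow> a x \<noteq> 0 \<Longrightarrow> x \<in> K"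
    by (rule Cc_supp) blast
  have "(\<lambda>x\<in>topspace X. h x * a x) \<in> Cc X"
    by (rule Cc_restrictI [OF Hausdorff_X continuous_map_mult [OF h Cc_continuous [OF a]] K(1)]) (use K(2) in auto)
  then show "snd (multiplier X h) a \<in> Cc X"
    using a Cc_subset_C0 by (auto simp: multiplier_def mult_op_def)
next
  fix \<gamma> assume g: "\<gamma> \<in> carr"
  have bij: "bij_betw (lt \<gamma>) (cs_carrier (C0 (fib (s \<gamma>)))) (cs_carrier (C0 (fib (r \<gamma>))))"
    using lt_star_isomorphism [OF g] by (simp add: star_isomorphism_def)
  have "lt \<gamma> (mult_op (fib (s \<gamma>)) h (inv_into (cs_carrier (C0 (fib (s \<gamma>)))) (lt \<gamma>) b)) = (\<lambda>x\<in>topspace (fib (r \<gamma>)). h x * b x)"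
    if b: "b \<in> cs_carrier (C0 (fib (r \<gamma>)))" for b
  proof -
    let ?a = "inv_into (cs_carrier (C0 (fib (s \<gamma>)))) (lt \<gamma>) b"
    have a: "?a \<in> cs_carrier (C0 (fib (s \<gamma>)))" "lt \<gamma> ?a = b"
      using bij_betw_inv_into_right [OF bij b] bij_betwE [OF bij_betw_inv_into [OF bij]] b by auto
    have "lt \<gamma> (\<lambda>x\<in>topspace (fib (s \<gamma>)). h x * ?a x) = (\<lambda>x\<in>topspace (fib (r \<gamma>)). h x * lt \<gamma> ?a x)"
      using g inv [of "iv \<gamma>"] by (auto simp: lt_def topspace_fib fun_eq_iff)
    then show ?thesis using a by (simp add: mult_op_def)
  qed
  then have "(\<lambda>b\<in>cs_carrier (C0 (fib (r \<gamma>))). lt \<gamma> (mult_op (fib (s \<gamma>)) h (inv_into (cs_carrier (C0 (fib (s \<gamma>)))) (lt \<gamma>) b)))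
      = mult_op (fib (r \<gamma>)) h"
    by (auto simp: mult_op_def)
  then show "multiplier_extension (C0 (fib (s \<gamma>))) (C0 (fib (r \<gamma>))) (lt \<gamma>) (multiplier_fibre Sys (multiplier X h) (s \<gamma>)) =
      multiplier_fibre Sys (multiplier X h) (r \<gamma>)"
    using multiplier_fibre_eq [OF s_units [OF g] h B] multiplier_fibre_eq [OF r_units [OF g] h B]
    by (simp add: multiplier_extension_def multiplier_def)
qed

section \<open>Existence and uniqueness of the inner product\<close>

definition star_mult :: "('x \<Rightarrow> complex) \<Rightarrow> ('x \<Rightarrow> complex) \<Rightarrow> 'x \<Rightarrow> complex" where
  "star_mult a b = cs_mult (C0 X) (cs_star (C0 X) a) b"

lemma star_mult_Cc: "a \<in> Cc X \<Longrightarrow> b \<in> Cc X \<Longrightarrow> star_mult a b \<in> Cc X"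
  using star_subalgebra_Cc [OF Hausdorff_X] unfolding star_subalgebra_def star_mult_def by blast

lemma is_D_inner_iff:
  "is_D_inner G lam Sys (Cc X) a b d \<longleftrightarrow> d \<in> fixed_multipliers G Sys (Cc X) \<and>
     (\<forall>c\<in>Cc X. \<forall>u\<in>units G. has_cs_integral (C0 (fib u)) (restrict_space (lam u) (range_fibre G u))
        (\<lambda>\<gamma>. cs_mult (C0 (fib u)) (sys_eval Sys c (r \<gamma>)) (sys_act Sys \<gamma> (sys_eval Sys (star_mult a b) (s \<gamma>))))
        (res (snd d c) u))"
  by (simp add: is_D_inner_def C0_system_sel star_mult_def)

lemma is_D_inner_integral_iff:
  "is_D_inner G lam Sys (Cc X) a b d \<longleftrightarrow> d \<in> fixed_multipliers G Sys (Cc X) \<and>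
     (\<forall>c\<in>Cc X. \<forall>u\<in>units G. has_cs_integral (C0 (fib u)) (restrict_space (lam u) (range_fibre G u))
        (pairing c (star_mult a b)) (res (snd d c) u))"
proof -
  have "has_cs_integral (C0 (fib u)) (restrict_space (lam u) (range_fibre G u))
        (\<lambda>\<gamma>. cs_mult (C0 (fib u)) (sys_eval Sys c (r \<gamma>)) (sys_act Sys \<gamma> (sys_eval Sys (star_mult a b) (s \<gamma>)))) z
      \<longleftrightarrow> has_cs_integral (C0 (fib u)) (restrict_space (lam u) (range_fibre G u)) (pairing c (star_mult a b)) z"
    for c u z
    by (rule has_cs_integral_cong) (auto simp: pairing_def C0_system_sel space_restrict_space range_fibre_def)
  then show ?thesis unfolding is_D_inner_iff by simp
qed

text \<open>Formulated as an equivalence, so that both unique existence and the value of the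
  definite description in \<open>D_inner\<close> follow by rewriting.\<close>

theorem is_D_inner_Psi:
  assumes a: "a \<in> Cc X" and b: "b \<in> Cc X"
  shows "is_D_inner G lam Sys (Cc X) a b d \<longleftrightarrow> d = multiplier X (Psi (star_mult a b))"
proof -
  let ?\<phi> = "star_mult a b"
  have \<phi>: "?\<phi> \<in> Cc X" using star_mult_Cc [OF a b] .
  obtain B where B: "\<And>x. x \<in> topspace X \<Longrightarrow> cmod (Psi ?\<phi> x) \<le> B" using Psi_bounded [OF \<phi>] by blast
  have DC: "multiplier X (Psi ?\<phi>) \<in> double_centralizers (C0 X)"
    by (rule multiplier_DC [OF continuous_Psi [OF \<phi>] B])
  have fixed: "multiplier X (Psi ?\<phi>) \<in> fixed_multipliers G Sys (Cc X)"
    by (rule multiplier_fixed [OF continuous_Psi [OF \<phi>] B]) (use Psi_invariant [OF \<phi>] in auto)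
  have val: "res (snd (multiplier X (Psi ?\<phi>)) c) u = (\<lambda>x\<in>topspace (fib u). c x * Psi ?\<phi> x)"
    if "c \<in> Cc X" for c u
    using that Cc_subset_C0 by (auto simp: multiplier_def mult_op_def topspace_fib fun_eq_iff)
  have ex: "is_D_inner G lam Sys (Cc X) a b (multiplier X (Psi ?\<phi>))"
    unfolding is_D_inner_integral_iff using fixed has_cs_integral_pairing [OF _ \<phi>] val by simp
  moreover have "d = multiplier X (Psi ?\<phi>)" if d: "is_D_inner G lam Sys (Cc X) a b d"
  proof (rule DC_eqI_dense [OF _ DC Hausdorff_X])
    show dDC: "d \<in> double_centralizers (C0 X)"
      using d by (simp add: is_D_inner_integral_iff fixed_multipliers_def C0_system_sel multiplier_algebra_def)
    fix c assume c: "c \<in> Cc X"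
    then have cC: "c \<in> cs_carrier (C0 X)" using Cc_subset_C0 by blast
    show "snd d c = snd (multiplier X (Psi ?\<phi>)) c"
    proof (rule C0_eqI)
      show "snd d c \<in> cs_carrier (C0 X)" "snd (multiplier X (Psi ?\<phi>)) c \<in> cs_carrier (C0 X)"
        using DC_D(1) [OF dDC] DC_D(1) [OF DC] cC by (auto dest: PiE_mem)
      fix x assume x: "x \<in> topspace X"
      then have xf: "x \<in> topspace (fib (rX x))" by (simp add: topspace_fib)
      have hi: "has_cs_integral (C0 (fib (rX x))) (restrict_space (lam (rX x)) (range_fibre G (rX x)))
          (pairing c ?\<phi>) (res (snd d c) (rX x))"
        using d c x by (simp add: is_D_inner_integral_iff)
      have "(LINT \<gamma>|restrict_space (lam (rX x)) (range_fibre G (rX x)). pairing c ?\<phi> \<gamma> x) = res (snd d c) (rX x) x"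
        by (rule has_cs_integral_C0_eval [OF hi xf])
           (rule conjunct1 [OF pairing_integral [OF c \<phi> rX_units [OF x] xf]])
      then have "snd d c x = c x * Psi ?\<phi> x"
        using pairing_integral [OF c \<phi> rX_units [OF x] xf] xf by simp
      then show "snd d c x = snd (multiplier X (Psi ?\<phi>)) c x"
        using x cC by (simp add: multiplier_def mult_op_def)
    qed
  qed
  ultimately show ?thesis by blast
qed

text \<open>The dynamical system and the inner product are the same for both notions of
  integrability, so the choice of \<open>LI\<close> is left to the last hypothesis.\<close>

theorem proper_system_with_C0:
  assumes "separable_space (cs_topology (C0 X))"
    and LI: "\<And>a b. a \<in> Cc X \<Longrightarrow> b \<in> Cc X \<Longrightarrow> (\<lambda>\<gamma>. complex_of_real (inner_norm a b \<gamma>)) \<in> LI"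
  shows "proper_system_with LI G lam Sys (Cc X)"
proof -
  have "\<exists>!d. is_D_inner G lam Sys (Cc X) a b d" if "a \<in> Cc X" "b \<in> Cc X" for a b
    unfolding is_D_inner_Psi [OF that] by simp
  then show ?thesis
    unfolding proper_system_with_def
    using groupoid_dynamical_system_C0 [OF assms(1)] star_subalgebra_Cc [OF Hausdorff_X] closure_of_Cc [OF Hausdorff_X] LI
    by (simp add: C0_system_sel(1) inner_norm_def)
qed

lemma D_inner_eq:
  assumes "a \<in> Cc X" "b \<in> Cc X"
  shows "D_inner G lam Sys (Cc X) a b = multiplier X (Psi (star_mult a b))"
  unfolding D_inner_def is_D_inner_Psi [OF assms] by simp

end

section \<open>The metric of the multiplier algebra\<close>

lemma multiplier_algebra_sel:
  "cs_carrier (multiplier_algebra A) = double_centralizers A"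
  "cs_zero (multiplier_algebra A) = (\<lambda>a\<in>cs_carrier A. cs_zero A, \<lambda>a\<in>cs_carrier A. cs_zero A)"
  "cs_add (multiplier_algebra A) d e =
     (\<lambda>a\<in>cs_carrier A. cs_add A (fst d a) (fst e a), \<lambda>a\<in>cs_carrier A. cs_add A (snd d a) (snd e a))"
  "cs_scale (multiplier_algebra A) k d =
     (\<lambda>a\<in>cs_carrier A. cs_scale A k (fst d a), \<lambda>a\<in>cs_carrier A. cs_scale A k (snd d a))"
  "cs_mult (multiplier_algebra A) d e =
     (\<lambda>a\<in>cs_carrier A. fst d (fst e a), \<lambda>a\<in>cs_carrier A. snd e (snd d a))"
  "cs_star (multiplier_algebra A) d =
     (\<lambda>a\<in>cs_carrier A. cs_star A (snd d (cs_star A a)), \<lambda>a\<in>cs_carrier A. cs_star A (fst d (cs_star A a)))"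
  "cs_norm (multiplier_algebra A) d = Sup {cs_norm A (fst d a) | a. a \<in> cs_carrier A \<and> cs_norm A a \<le> 1}"
  by (simp_all add: multiplier_algebra_def case_prod_unfold)

abbreviation "MC0 T \<equiv> multiplier_algebra (C0 T)"

lemma DC_C0_closed:
  "d \<in> double_centralizers (C0 T) \<Longrightarrow> a \<in> cs_carrier (C0 T) \<Longrightarrow> fst d a \<in> cs_carrier (C0 T)"
  using DC_D(1) [of d T "fst d"] by (auto dest: PiE_mem)

lemma MC0_dist:
  assumes d: "d \<in> double_centralizers (C0 T)" and e: "e \<in> double_centralizers (C0 T)"
  shows "cs_dist (MC0 T) d e = Sup {cs_dist (C0 T) (fst d a) (fst e a) | a. a \<in> cs_carrier (C0 T) \<and> cs_norm (C0 T) a \<le> 1}"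
proof -
  have "cs_norm (C0 T) (fst (cs_diff (MC0 T) d e) a) = cs_dist (C0 T) (fst d a) (fst e a)"
    if "a \<in> cs_carrier (C0 T)" for a
    using that DC_C0_closed [OF d that] DC_C0_closed [OF e that]
    by (simp add: cs_diff_def [of "MC0 T"] multiplier_algebra_sel cs_dist_def [of "C0 T"] cs_diff_def [of "C0 T"])
  then have "{cs_norm (C0 T) (fst (cs_diff (MC0 T) d e) a) | a. a \<in> cs_carrier (C0 T) \<and> cs_norm (C0 T) a \<le> 1} =
      {cs_dist (C0 T) (fst d a) (fst e a) | a. a \<in> cs_carrier (C0 T) \<and> cs_norm (C0 T) a \<le> 1}"
    by (intro Collect_cong ex_cong1) auto
  then show ?thesis
    using d e by (simp add: cs_dist_def [of "MC0 T"] multiplier_algebra_sel(1,7))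
qed

text \<open>The supremum in \<open>MC0_dist\<close> is informative only for a bounded set; the bound
  comes from the operator bounds that belong to the definition of a double centralizer.\<close>

lemma MC0_dist_bdd:
  assumes d: "d \<in> double_centralizers (C0 T)" and e: "e \<in> double_centralizers (C0 T)"
  shows "bdd_above {cs_dist (C0 T) (fst d a) (fst e a) | a. a \<in> cs_carrier (C0 T) \<and> cs_norm (C0 T) a \<le> 1}"
proof -
  obtain B where B: "\<forall>a\<in>cs_carrier (C0 T). cs_norm (C0 T) (fst d a) \<le> B * cs_norm (C0 T) a"
    using DC_D(4) [OF d disjI1 [OF refl]] by (rule exE)
  obtain C where C: "\<forall>a\<in>cs_carrier (C0 T). cs_norm (C0 T) (fst e a) \<le> C * cs_norm (C0 T) a"
    using DC_D(4) [OF e disjI1 [OF refl]] by (rule exE)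
  have bound: "cs_norm (C0 T) (fst f a) \<le> \<bar>D\<bar>"
    if "\<forall>a\<in>cs_carrier (C0 T). cs_norm (C0 T) (fst f a) \<le> D * cs_norm (C0 T) a"
      "a \<in> cs_carrier (C0 T)" "cs_norm (C0 T) a \<le> 1" for f D a
  proof -
    have "cs_norm (C0 T) (fst f a) \<le> D * cs_norm (C0 T) a" using that by blast
    also have "\<dots> \<le> \<bar>D\<bar> * 1" using that C0_norm_nonneg [OF that(2)] by (intro mult_mono) auto
    finally show ?thesis by simp
  qed
  show ?thesis
  proof (rule bdd_aboveI [of _ "\<bar>B\<bar> + \<bar>C\<bar>"])
    fix t assume "t \<in> {cs_dist (C0 T) (fst d a) (fst e a) | a. a \<in> cs_carrier (C0 T) \<and> cs_norm (C0 T) a \<le> 1}"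
    then obtain a where a: "a \<in> cs_carrier (C0 T)" "cs_norm (C0 T) a \<le> 1" and t: "t = cs_dist (C0 T) (fst d a) (fst e a)"
      by blast
    have "cmod (fst d a x - fst e a x) \<le> \<bar>B\<bar> + \<bar>C\<bar>" if x: "x \<in> topspace T" for x
      using norm_triangle_ineq4 [of "fst d a x" "fst e a x"] bound [OF B a] bound [OF C a]
        C0_norm_upper [OF DC_C0_closed [OF d a(1)] x] C0_norm_upper [OF DC_C0_closed [OF e a(1)] x] by linarith
    then show "t \<le> \<bar>B\<bar> + \<bar>C\<bar>"
      unfolding t by (subst C0_dist_le_iff [OF DC_C0_closed [OF d a(1)] DC_C0_closed [OF e a(1)]]) auto
  qed
qed

lemma MC0_dist_upper:
  assumes d: "d \<in> double_centralizers (C0 T)" and e: "e \<in> double_centralizers (C0 T)"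
    and a: "a \<in> cs_carrier (C0 T)" "cs_norm (C0 T) a \<le> 1"
  shows "cs_dist (C0 T) (fst d a) (fst e a) \<le> cs_dist (MC0 T) d e"
  unfolding MC0_dist [OF d e] using a by (intro cSup_upper MC0_dist_bdd d e) blast

lemma C0_norm_zero: "cs_norm (C0 T) (\<lambda>x\<in>topspace T. 0) \<le> 1"
  by (intro C0_norm_le) auto

lemma MC0_dist_le:
  assumes d: "d \<in> double_centralizers (C0 T)" and e: "e \<in> double_centralizers (C0 T)"
    and "\<And>a. a \<in> cs_carrier (C0 T) \<Longrightarrow> cs_norm (C0 T) a \<le> 1 \<Longrightarrow> cs_dist (C0 T) (fst d a) (fst e a) \<le> B"
  shows "cs_dist (MC0 T) d e \<le> B"
  unfolding MC0_dist [OF d e]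
proof (rule cSup_least)
  show "{cs_dist (C0 T) (fst d a) (fst e a) | a. a \<in> cs_carrier (C0 T) \<and> cs_norm (C0 T) a \<le> 1} \<noteq> {}"
    using C0_zero_closed C0_norm_zero by blast
qed (use assms(3) in blast)

lemma MC0_dist_nonneg: "0 \<le> cs_dist (MC0 T) d e"
proof (cases "d \<in> double_centralizers (C0 T) \<and> e \<in> double_centralizers (C0 T)")
  case True
  then show ?thesis
    using MC0_dist_upper [of d T e, OF _ _ C0_zero_closed C0_norm_zero] C0_dist_nonneg order_trans by blast
next
  case False
  then show ?thesis by (auto simp: cs_dist_def multiplier_algebra_sel(1))
qed

text \<open>The norm sees only the left component on the unit ball. Distance 0 gives equality there,
  rescaling extends it to the whole algebra, and \<open>DC_commutative\<close> recovers the right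
  component.\<close>

lemma Metric_space_MC0: "Metric_space (cs_carrier (MC0 T)) (cs_dist (MC0 T))"
proof -
  interpret C: Metric_space "cs_carrier (C0 T)" "cs_dist (C0 T)" by (rule Metric_space_C0)
  show ?thesis
    unfolding multiplier_algebra_sel(1)
  proof
    fix d e f
    show "0 \<le> cs_dist (MC0 T) d e" by (rule MC0_dist_nonneg)
    have le: "cs_dist (MC0 T) d e \<le> cs_dist (MC0 T) e d"
      if "d \<in> double_centralizers (C0 T)" "e \<in> double_centralizers (C0 T)" for d e
      using that by (intro MC0_dist_le) (auto simp: C.commute [of "fst d _"] intro: MC0_dist_upper)
    show "cs_dist (MC0 T) d e = cs_dist (MC0 T) e d"
    proof (cases "d \<in> double_centralizers (C0 T) \<and> e \<in> double_centralizers (C0 T)")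
      case False
      then show ?thesis by (auto simp: cs_dist_def [of "MC0 T"] multiplier_algebra_sel(1))
    qed (use le [of d e] le [of e d] in auto)
    assume d: "d \<in> double_centralizers (C0 T)" and e: "e \<in> double_centralizers (C0 T)"
    show "cs_dist (MC0 T) d e = 0 \<longleftrightarrow> d = e"
    proof
      assume 0: "cs_dist (MC0 T) d e = 0"
      have unit: "fst d a = fst e a" if a: "a \<in> cs_carrier (C0 T)" "cs_norm (C0 T) a \<le> 1" for a
      proof -
        have "cs_dist (C0 T) (fst d a) (fst e a) = 0"
          using MC0_dist_upper [OF d e a] 0 C0_dist_nonneg [of T "fst d a" "fst e a"] by linarith
        then show ?thesis using C.zero DC_C0_closed [OF d a(1)] DC_C0_closed [OF e a(1)] by blast
      qed
      have "fst d a = fst e a" if a: "a \<in> cs_carrier (C0 T)" for a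
      proof -
        \<comment> \<open>Positive also for a = 0, and large enough for a / c to lie in the unit
          ball.\<close>
        define c where "c = cs_norm (C0 T) a + 1"
        have c: "0 < c" using C0_norm_nonneg [OF a] by (simp add: c_def)
        let ?b = "\<lambda>x\<in>topspace T. complex_of_real (1 / c) * a x"
        have b: "?b \<in> cs_carrier (C0 T)" by (rule C0_scale_closed [OF a])
        have "cs_norm (C0 T) ?b \<le> 1"
        proof (rule C0_norm_le)
          fix x assume x: "x \<in> topspace T"
          have "cmod (?b x) = cmod (a x) / c" using x c by (simp add: norm_mult norm_divide)
          also have "\<dots> \<le> 1" using C0_norm_upper [OF a x] c by (simp add: c_def)
          finally show "cmod (?b x) \<le> 1" .
        qed simp
        then have eq: "fst d ?b = fst e ?b" by (rule unit [OF b])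
        have a': "a = (\<lambda>x\<in>topspace T. complex_of_real c * ?b x)"
          by (rule C0_eqI [OF a C0_scale_closed [OF b]]) (use c in simp)
        have "fst d a = (\<lambda>x\<in>topspace T. complex_of_real c * fst d ?b x)"
          by (rule trans [OF arg_cong [OF a', of "fst d"] DC_D(3) [OF d disjI1 [OF refl] b]])
        moreover have "fst e a = (\<lambda>x\<in>topspace T. complex_of_real c * fst e ?b x)"
          by (rule trans [OF arg_cong [OF a', of "fst e"] DC_D(3) [OF e disjI1 [OF refl] b]])
        ultimately show ?thesis by (simp only: eq)
      qed
      then show "d = e"
        using DC_eqI [OF d e] DC_commutative [OF d] DC_commutative [OF e] by metis
    next
      assume "d = e"
      then have "cs_dist (MC0 T) d e \<le> 0"
        using DC_C0_closed [OF d] by (intro MC0_dist_le d e) simp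
      then show "cs_dist (MC0 T) d e = 0" using MC0_dist_nonneg order_antisym by blast
    qed
    assume f: "f \<in> double_centralizers (C0 T)"
    show "cs_dist (MC0 T) d f \<le> cs_dist (MC0 T) d e + cs_dist (MC0 T) e f"
    proof (rule MC0_dist_le [OF d f])
      fix a assume a: "a \<in> cs_carrier (C0 T)" "cs_norm (C0 T) a \<le> 1"
      have "cs_dist (C0 T) (fst d a) (fst f a) \<le> cs_dist (C0 T) (fst d a) (fst e a) + cs_dist (C0 T) (fst e a) (fst f a)"
        using DC_C0_closed [OF d a(1)] DC_C0_closed [OF e a(1)] DC_C0_closed [OF f a(1)] by (rule C.triangle)
      then show "cs_dist (C0 T) (fst d a) (fst f a) \<le> cs_dist (MC0 T) d e + cs_dist (MC0 T) e f"
        using MC0_dist_upper [OF d e a] MC0_dist_upper [OF e f a] by linarith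
    qed
  qed
qed

text \<open>All axioms, completeness included, are carried along a bijection that preserves the
  operations and the norm; this spares their verification inside the multiplier algebra. The metric
  axioms are supplied separately, since the definition of \<open>cstar_algebra\<close> contains them
  only implicitly.\<close>

lemma cstar_algebra_transfer:
  assumes A: "cstar_algebra A" and MA: "Metric_space (cs_carrier A) (cs_dist A)"
    and bij: "bij_betw h (cs_carrier A) (cs_carrier B)"
    and zero: "cs_zero B = h (cs_zero A)"
    and add: "\<And>a b. a \<in> cs_carrier A \<Longrightarrow> b \<in> cs_carrier A \<Longrightarrow> cs_add B (h a) (h b) = h (cs_add A a b)"
    and scale: "\<And>a k. a \<in> cs_carrier A \<Longrightarrow> cs_scale B k (h a) = h (cs_scale A k a)"
    and mult: "\<And>a b. a \<in> cs_carrier A \<Longrightarrow> b \<in> cs_carrier A \<Longrightarrow> cs_mult B (h a) (h b) = h (cs_mult A a b)"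
    and star: "\<And>a. a \<in> cs_carrier A \<Longrightarrow> cs_star B (h a) = h (cs_star A a)"
    and norm: "\<And>a. a \<in> cs_carrier A \<Longrightarrow> cs_norm B (h a) = cs_norm A a"
  shows "cstar_algebra B"
proof -
  have B: "cs_carrier B = h ` cs_carrier A" and inj: "\<And>a b. a \<in> cs_carrier A \<Longrightarrow> b \<in> cs_carrier A \<Longrightarrow> h a = h b \<longleftrightarrow> a = b"
    using bij by (auto simp: bij_betw_def inj_on_def)
  have cl: "cs_zero A \<in> cs_carrier A" "\<And>a b. a \<in> cs_carrier A \<Longrightarrow> b \<in> cs_carrier A \<Longrightarrow> cs_add A a b \<in> cs_carrier A"
    "\<And>a k. a \<in> cs_carrier A \<Longrightarrow> cs_scale A k a \<in> cs_carrier A"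
    "\<And>a b. a \<in> cs_carrier A \<Longrightarrow> b \<in> cs_carrier A \<Longrightarrow> cs_mult A a b \<in> cs_carrier A"
    "\<And>a. a \<in> cs_carrier A \<Longrightarrow> cs_star A a \<in> cs_carrier A"
    using A by (simp_all add: cstar_algebra_def star_subalgebra_def cs_subspace_def)
  have dist: "cs_dist B (h a) (h b) = cs_dist A a b" if "a \<in> cs_carrier A" "b \<in> cs_carrier A" for a b
    using that by (simp add: cs_dist_def B cs_diff_def scale add cl norm)
  interpret MA: Metric_space "cs_carrier A" "cs_dist A" by (rule MA)
  interpret MB: Metric_space "cs_carrier B" "cs_dist B"
  proof
    fix x y z
    have "0 \<le> cs_dist B x y \<and> cs_dist B x y = cs_dist B y x"
    proof (cases "x \<in> cs_carrier B \<and> y \<in> cs_carrier B")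
      case True
      then show ?thesis by (auto simp: B dist MA.commute)
    next
      case False
      then show ?thesis by (auto simp: cs_dist_def)
    qed
    then show "0 \<le> cs_dist B x y" "cs_dist B x y = cs_dist B y x" by blast+
    assume "x \<in> cs_carrier B" "y \<in> cs_carrier B"
    then show "cs_dist B x y = 0 \<longleftrightarrow> x = y" by (auto simp: B dist inj)
    assume "z \<in> cs_carrier B"
    then show "cs_dist B x z \<le> cs_dist B x y + cs_dist B y z"
      using \<open>x \<in> cs_carrier B\<close> \<open>y \<in> cs_carrier B\<close> by (auto simp: B dist MA.triangle)
  qed
  have complete: "MB.mcomplete"
    unfolding MB.mcomplete_def
  proof (intro allI impI)
    fix \<sigma> assume \<sigma>: "MB.MCauchy \<sigma>"
    then have "\<sigma> n \<in> cs_carrier B" for n by (auto simp: MB.MCauchy_def)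
    then have "\<forall>n. \<exists>a. a \<in> cs_carrier A \<and> \<sigma> n = h a" unfolding B by blast
    then obtain \<tau> where \<tau>: "\<And>n. \<tau> n \<in> cs_carrier A" "\<And>n. \<sigma> n = h (\<tau> n)" by metis
    have "MA.MCauchy \<tau>" using \<sigma> \<tau> dist by (auto simp: MA.MCauchy_def MB.MCauchy_def)
    moreover have "MA.mcomplete" using A by (simp add: cstar_algebra_def)
    ultimately obtain a where a: "limitin MA.mtopology \<tau> a sequentially" by (auto simp: MA.mcomplete_def)
    have "limitin MB.mtopology \<sigma> (h a) sequentially"
      using a \<tau> dist unfolding MA.limitin_metric MB.limitin_metric by (auto simp: B)
    then show "\<exists>x. limitin MB.mtopology \<sigma> x sequentially" by blast
  qed
  note ax = A [unfolded cstar_algebra_def, THEN conjunct2]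
  note ax3 = bspec [OF bspec [OF bspec [OF ax [THEN conjunct1]]]]
  note ax2 = bspec [OF bspec [OF ax [THEN conjunct2, THEN conjunct1]]]
  note ax1 = bspec [OF ax [THEN conjunct2, THEN conjunct2, THEN conjunct1]]
  show ?thesis
    unfolding cstar_algebra_def star_subalgebra_def cs_subspace_def
  proof (intro conjI ballI allI subset_refl complete)
    fix x y z assume "x \<in> cs_carrier B" "y \<in> cs_carrier B" "z \<in> cs_carrier B"
    then obtain a b c where abc: "a \<in> cs_carrier A" "b \<in> cs_carrier A" "c \<in> cs_carrier A" "x = h a" "y = h b" "z = h c"
      by (auto simp: B)
    show "cs_add B (cs_add B x y) z = cs_add B x (cs_add B y z)"
      "cs_mult B (cs_mult B x y) z = cs_mult B x (cs_mult B y z)"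
      "cs_mult B (cs_add B x y) z = cs_add B (cs_mult B x z) (cs_mult B y z)"
      "cs_mult B z (cs_add B x y) = cs_add B (cs_mult B z x) (cs_mult B z y)"
      using ax3 [OF abc(1-3)] abc by (simp_all add: add mult cl)
  next
    fix x y assume "x \<in> cs_carrier B" "y \<in> cs_carrier B"
    then obtain a b where ab: "a \<in> cs_carrier A" "b \<in> cs_carrier A" "x = h a" "y = h b"
      by (auto simp: B)
    show "cs_add B x y \<in> cs_carrier B" "cs_mult B x y \<in> cs_carrier B"
      using ab by (auto simp: add mult B cl)
    show "cs_add B x y = cs_add B y x" using ax2 [OF ab(1,2), THEN conjunct1] ab by (simp add: add)
    show "cs_star B (cs_add B x y) = cs_add B (cs_star B x) (cs_star B y)"
      "cs_star B (cs_mult B x y) = cs_mult B (cs_star B y) (cs_star B x)"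
      "cs_norm B (cs_add B x y) \<le> cs_norm B x + cs_norm B y"
      "cs_norm B (cs_mult B x y) \<le> cs_norm B x * cs_norm B y"
      using ax2 [OF ab(1,2), THEN conjunct2] ab by (simp_all add: add mult star norm cl)
    fix k
    show "cs_scale B k (cs_add B x y) = cs_add B (cs_scale B k x) (cs_scale B k y)"
      "cs_mult B (cs_scale B k x) y = cs_scale B k (cs_mult B x y)"
      "cs_mult B x (cs_scale B k y) = cs_scale B k (cs_mult B x y)"
      using ax2 [OF ab(1,2), THEN conjunct2] ab by (simp_all add: add mult scale cl)
  next
    fix x assume "x \<in> cs_carrier B"
    then obtain a where a: "a \<in> cs_carrier A" "x = h a" by (auto simp: B)
    show "cs_star B x \<in> cs_carrier B" using a by (auto simp: star B cl)
    show "cs_add B (cs_zero B) x = x" "cs_add B x (cs_scale B (- 1) x) = cs_zero B" "cs_scale B 1 x = x"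
      "cs_star B (cs_star B x) = x" "0 \<le> cs_norm B x" "cs_norm B x = 0 \<longleftrightarrow> x = cs_zero B"
      "cs_norm B (cs_mult B (cs_star B x) x) = (cs_norm B x)\<^sup>2"
      using ax1 [OF a(1)] a by (simp_all add: zero add mult scale star norm cl inj)
    fix k l
    show "cs_scale B k x \<in> cs_carrier B" using a by (auto simp: scale B cl)
    show "cs_scale B (k + l) x = cs_add B (cs_scale B k x) (cs_scale B l x)"
      "cs_scale B (k * l) x = cs_scale B k (cs_scale B l x)"
      "cs_star B (cs_scale B k x) = cs_scale B (cnj k) (cs_star B x)"
      "cs_norm B (cs_scale B k x) = cmod k * cs_norm B x"
      using ax1 [OF a(1)] a by (simp_all add: add scale star norm cl)
  qed (use cl zero in \<open>auto simp: B\<close>)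
qed

section \<open>The orbit space and the generalized fixed point algebra\<close>

context groupoid_space
begin

abbreviation "q \<equiv> orbit G rX act"
abbreviation "OS \<equiv> orbit_space G X rX act"

lemma orbit_self: "x \<in> topspace X \<Longrightarrow> x \<in> q x"
  using act_unit rX_carr units_s rX_units by (force simp: orbit_def)

lemma orbit_act:
  assumes g: "\<gamma> \<in> carr" "s \<gamma> = rX x" and x: "x \<in> topspace X"
  shows "q (act \<gamma> x) = q x"
proof (intro equalityI subsetI)
  fix y assume "y \<in> q (act \<gamma> x)"
  then obtain \<eta> where "\<eta> \<in> carr" "s \<eta> = r \<gamma>" "y = act \<eta> (act \<gamma> x)" using g x by (auto simp: orbit_def)
  then have "y = act (g_mult G \<eta> \<gamma>) x" "g_mult G \<eta> \<gamma> \<in> carr" "s (g_mult G \<eta> \<gamma>) = rX x"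
    using g x by (auto simp: act_mult)
  then show "y \<in> q x" unfolding orbit_def by blast
next
  fix y assume "y \<in> q x"
  then obtain \<eta> where \<eta>: "\<eta> \<in> carr" "s \<eta> = rX x" "y = act \<eta> x" by (auto simp: orbit_def)
  have "y = act (g_mult G \<eta> (iv \<gamma>)) (act \<gamma> x)" using \<eta> g x by (simp add: act_mult)
  moreover have "g_mult G \<eta> (iv \<gamma>) \<in> carr" "s (g_mult G \<eta> (iv \<gamma>)) = rX (act \<gamma> x)" using \<eta> g x by auto
  ultimately show "y \<in> q (act \<gamma> x)" unfolding orbit_def by blast
qed

lemma orbit_eqD:
  assumes "y \<in> topspace X" "q x = q y"
  obtains \<gamma> where "\<gamma> \<in> carr" "s \<gamma> = rX x" "y = act \<gamma> x"
  using orbit_self [OF assms(1)] assms(2) that by (auto simp: orbit_def)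

lemma topspace_OS: "topspace OS = q ` topspace X"
proof
  show "topspace OS \<subseteq> q ` topspace X"
    using openin_topspace [of OS] unfolding openin_orbit_space by blast
  have "openin OS (q ` topspace X)"
    unfolding openin_orbit_space
  proof
    have "{x \<in> topspace X. q x \<in> q ` topspace X} = topspace X" by blast
    then show "openin X {x \<in> topspace X. q x \<in> q ` topspace X}" by simp
  qed simp
  then show "q ` topspace X \<subseteq> topspace OS" by (rule openin_subset)
qed

lemma continuous_q: "continuous_map X OS q"
  unfolding continuous_map_def by (auto simp: topspace_OS openin_orbit_space)

section \<open>Invariant functions on \<open>X\<close> as functions on the orbit space\<close>

definition invariant :: "('x \<Rightarrow> complex) \<Rightarrow> bool" where
  "invariant h \<longleftrightarrow> (\<forall>\<gamma>\<in>carr. \<forall>x\<in>topspace X. s \<gamma> = rX x \<longrightarrow> h (act \<gamma> x) = h x)"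

definition descend :: "('x \<Rightarrow> complex) \<Rightarrow> 'x set \<Rightarrow> complex" where
  "descend h = (\<lambda>p\<in>topspace OS. h (SOME x. x \<in> topspace X \<and> q x = p))"

lemma descend_q:
  assumes h: "invariant h" and x: "x \<in> topspace X"
  shows "descend h (q x) = h x"
proof -
  let ?y = "SOME y. y \<in> topspace X \<and> q y = q x"
  have y: "?y \<in> topspace X \<and> q ?y = q x" by (rule someI [of _ x]) (use x in simp)
  then have "?y \<in> topspace X" "q x = q ?y" by simp_all
  then obtain \<gamma> where "\<gamma> \<in> carr" "s \<gamma> = rX x" "?y = act \<gamma> x" by (rule orbit_eqD)
  then have "h ?y = h x" using h x by (auto simp: invariant_def)
  then show ?thesis using x by (simp add: descend_def topspace_OS)
qed

lemma continuous_descend: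
  assumes h: "invariant h" and c: "continuous_map X euclidean h"
  shows "continuous_map OS euclidean (descend h)"
  unfolding continuous_map_def
proof (intro conjI allI impI)
  fix U :: "complex set" assume U: "openin euclidean U"
  show "openin OS {p \<in> topspace OS. descend h p \<in> U}"
    unfolding openin_orbit_space
  proof
    show "{p \<in> topspace OS. descend h p \<in> U} \<subseteq> q ` topspace X" by (auto simp: topspace_OS)
    have "{x \<in> topspace X. q x \<in> {p \<in> topspace OS. descend h p \<in> U}} = {x \<in> topspace X. h x \<in> U}"
      using descend_q [OF h] by (auto simp: topspace_OS)
    then show "openin X {x \<in> topspace X. q x \<in> {p \<in> topspace OS. descend h p \<in> U}}"
      using openin_continuous_map_preimage [OF c U] by simp
  qed
qed simp

lemma invariant_Psi: "\<phi> \<in> Cc X \<Longrightarrow> invariant (Psi \<phi>)"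
  using Psi_invariant by (simp add: invariant_def)

text \<open>The nonzero values lie on the image under the quotient map of a compact set outside
  which \<phi> vanishes, and this image is compact whatever the separation properties of the orbit
  space.\<close>

lemma descend_Psi_C0:
  assumes \<phi>: "\<phi> \<in> Cc X"
  shows "descend (Psi \<phi>) \<in> cs_carrier (C0 OS)"
proof -
  have cont: "continuous_map OS euclidean (descend (Psi \<phi>))"
    by (rule continuous_descend [OF invariant_Psi [OF \<phi>] continuous_Psi [OF \<phi>]])
  obtain K where K: "compactin X K" "\<And>x. x \<in> topspace X \<Longrightarrow> \<phi> x \<noteq> 0 \<Longrightarrow> x \<in> K"
    using \<phi> by (rule Cc_supp) blast
  have "p \<in> q ` K" if p: "p \<in> topspace OS" and n: "descend (Psi \<phi>) p \<noteq> 0" for p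
  proof -
    obtain x where x: "x \<in> topspace X" "p = q x" using p by (auto simp: topspace_OS)
    then have "Psi \<phi> x \<noteq> 0" using n descend_q [OF invariant_Psi [OF \<phi>]] by simp
    then obtain \<gamma> where \<gamma>: "\<gamma> \<in> carr" "r \<gamma> = rX x" "\<phi> (act (iv \<gamma>) x) \<noteq> 0"
      using Psi_nonzero_orbit [OF x(1)] by blast
    then have "act (iv \<gamma>) x \<in> K" using K(2) x by simp
    moreover have "q (act (iv \<gamma>) x) = q x" using \<gamma> x by (intro orbit_act) auto
    ultimately show ?thesis using x(2) by blast
  qed
  then have "restrict (descend (Psi \<phi>)) (topspace OS) \<in> cs_carrier (C0 OS)"
    using image_compactin [OF K(1) continuous_q]
    by (intro C0_restrictI [OF cont] exI [of _ "q ` K"]) force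
  then show ?thesis by (simp add: descend_def)
qed

section \<open>The isometric embedding of C_0 of the orbit space into the multiplier algebra\<close>

definition pull :: "('x set \<Rightarrow> complex) \<Rightarrow> (('x \<Rightarrow> complex) \<Rightarrow> 'x \<Rightarrow> complex) \<times> (('x \<Rightarrow> complex) \<Rightarrow> 'x \<Rightarrow> complex)" where
  "pull \<psi> = multiplier X (\<lambda>x. \<psi> (q x))"

lemma q_OS: "x \<in> topspace X \<Longrightarrow> q x \<in> topspace OS"
  by (simp add: topspace_OS)

lemma pull_DC:
  assumes \<psi>: "\<psi> \<in> cs_carrier (C0 OS)"
  shows "pull \<psi> \<in> double_centralizers (C0 X)"
  unfolding pull_def
proof (rule multiplier_DC)
  show "continuous_map X euclidean (\<lambda>x. \<psi> (q x))"
    using continuous_map_compose [OF continuous_q C0_continuous [OF \<psi>]] by (simp add: o_def)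
  show "cmod (\<psi> (q x)) \<le> cs_norm (C0 OS) \<psi>" if "x \<in> topspace X" for x
    using C0_norm_upper [OF \<psi> q_OS [OF that]] .
qed

lemma pull_apply:
  "a \<in> cs_carrier (C0 X) \<Longrightarrow> fst (pull \<psi>) a = (\<lambda>x\<in>topspace X. \<psi> (q x) * a x)"
  "a \<in> cs_carrier (C0 X) \<Longrightarrow> snd (pull \<psi>) a = (\<lambda>x\<in>topspace X. \<psi> (q x) * a x)"
  by (simp_all add: pull_def multiplier_def mult_op_apply)

lemma pull_eqI:
  assumes "\<And>a. a \<in> cs_carrier (C0 X) \<Longrightarrow> L a = (\<lambda>x\<in>topspace X. \<psi> (q x) * a x)"
  shows "(\<lambda>a\<in>cs_carrier (C0 X). L a) = mult_op X (\<lambda>x. \<psi> (q x))"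
  using assms by (auto simp: mult_op_def)

text \<open>Only the product asks for members of C_0: there one operator is applied to the output of
  the other, which must lie in the domain where \<open>mult_op\<close> is given by its
  formula.\<close>

lemma pull_operations:
  shows "cs_zero (MC0 X) = pull (cs_zero (C0 OS))"
    and "cs_add (MC0 X) (pull \<psi>) (pull \<psi>') = pull (cs_add (C0 OS) \<psi> \<psi>')"
    and "cs_scale (MC0 X) k (pull \<psi>) = pull (cs_scale (C0 OS) k \<psi>)"
    and "\<psi> \<in> cs_carrier (C0 OS) \<Longrightarrow> \<psi>' \<in> cs_carrier (C0 OS) \<Longrightarrow>
      cs_mult (MC0 X) (pull \<psi>) (pull \<psi>') = pull (cs_mult (C0 OS) \<psi> \<psi>')"
    and "cs_star (MC0 X) (pull \<psi>) = pull (cs_star (C0 OS) \<psi>)"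
proof -
  show "cs_zero (MC0 X) = pull (cs_zero (C0 OS))"
    unfolding multiplier_algebra_sel(2) C0_sel pull_def multiplier_def
    by (intro arg_cong2 [where f = Pair] pull_eqI restrict_ext) (auto simp: q_OS)
  show "cs_add (MC0 X) (pull \<psi>) (pull \<psi>') = pull (cs_add (C0 OS) \<psi> \<psi>')"
    unfolding multiplier_algebra_sel(3) C0_sel pull_def [of "restrict _ _"] multiplier_def
    by (intro arg_cong2 [where f = Pair] pull_eqI restrict_ext) (auto simp: q_OS pull_apply distrib_right)
  show "cs_scale (MC0 X) k (pull \<psi>) = pull (cs_scale (C0 OS) k \<psi>)"
    unfolding multiplier_algebra_sel(4) C0_sel pull_def [of "restrict _ _"] multiplier_def
    by (intro arg_cong2 [where f = Pair] pull_eqI restrict_ext) (auto simp: q_OS pull_apply)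
  show "cs_star (MC0 X) (pull \<psi>) = pull (cs_star (C0 OS) \<psi>)"
    unfolding multiplier_algebra_sel(6) C0_sel pull_def [of "restrict _ _"] multiplier_def
    by (intro arg_cong2 [where f = Pair] pull_eqI restrict_ext)
       (auto simp: q_OS pull_apply C0_star_closed simp del: restrict_apply simp: restrict_apply')
  assume \<psi>: "\<psi> \<in> cs_carrier (C0 OS)" "\<psi>' \<in> cs_carrier (C0 OS)"
  have cl: "(\<lambda>x\<in>topspace X. \<psi> (q x) * a x) \<in> cs_carrier (C0 X)"
    if "\<psi> \<in> cs_carrier (C0 OS)" "a \<in> cs_carrier (C0 X)" for \<psi> a
    using DC_C0_closed [OF pull_DC [OF that(1)] that(2)] pull_apply(1) [OF that(2)] by simp
  show "cs_mult (MC0 X) (pull \<psi>) (pull \<psi>') = pull (cs_mult (C0 OS) \<psi> \<psi>')"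
    unfolding multiplier_algebra_sel(5) C0_sel pull_def [of "restrict _ _"] multiplier_def
  proof (intro arg_cong2 [where f = Pair] pull_eqI)
    fix a assume a: "a \<in> cs_carrier (C0 X)"
    show "fst (pull \<psi>) (fst (pull \<psi>') a) = (\<lambda>x\<in>topspace X. (\<lambda>p\<in>topspace OS. \<psi> p * \<psi>' p) (q x) * a x)"
      unfolding pull_apply(1) [OF a] pull_apply(1) [OF cl [OF \<psi>(2) a]]
      by (rule restrict_ext) (simp add: q_OS)
    show "snd (pull \<psi>') (snd (pull \<psi>) a) = (\<lambda>x\<in>topspace X. (\<lambda>p\<in>topspace OS. \<psi> p * \<psi>' p) (q x) * a x)"
      unfolding pull_apply(2) [OF a] pull_apply(2) [OF cl [OF \<psi>(1) a]]
      by (rule restrict_ext) (simp add: q_OS)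
  qed
qed

text \<open>Testing on functions of norm at most 1 gives one inequality. For the other, a bump
  function of norm at most 1 with value 1 at \<open>x\<close> recovers the difference of the two
  functions at the orbit of \<open>x\<close>.\<close>

lemma pull_dist:
  assumes \<psi>: "\<psi> \<in> cs_carrier (C0 OS)" and \<psi>': "\<psi>' \<in> cs_carrier (C0 OS)"
  shows "cs_dist (MC0 X) (pull \<psi>) (pull \<psi>') = cs_dist (C0 OS) \<psi> \<psi>'"
proof (rule order_antisym)
  show "cs_dist (MC0 X) (pull \<psi>) (pull \<psi>') \<le> cs_dist (C0 OS) \<psi> \<psi>'"
  proof (rule MC0_dist_le [OF pull_DC [OF \<psi>] pull_DC [OF \<psi>']])
    fix a assume a: "a \<in> cs_carrier (C0 X)" "cs_norm (C0 X) a \<le> 1"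
    have "cmod (\<psi> (q x) * a x - \<psi>' (q x) * a x) \<le> cs_dist (C0 OS) \<psi> \<psi>'" if x: "x \<in> topspace X" for x
    proof -
      have "cmod (\<psi> (q x) * a x - \<psi>' (q x) * a x) = cmod (\<psi> (q x) - \<psi>' (q x)) * cmod (a x)"
        by (metis left_diff_distrib norm_mult)
      also have "\<dots> \<le> cs_dist (C0 OS) \<psi> \<psi>' * 1"
        using C0_dist_upper [OF \<psi> \<psi>' q_OS [OF x]] C0_norm_upper [OF a(1) x] a(2) C0_dist_nonneg
        by (intro mult_mono) auto
      finally show ?thesis by simp
    qed
    then show "cs_dist (C0 X) (fst (pull \<psi>) a) (fst (pull \<psi>') a) \<le> cs_dist (C0 OS) \<psi> \<psi>'"
      using a(1) C0_dist_nonneg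
      by (subst C0_dist_le_iff [OF DC_C0_closed [OF pull_DC [OF \<psi>] a(1)] DC_C0_closed [OF pull_DC [OF \<psi>'] a(1)]])
         (auto simp: pull_apply)
  qed
  show "cs_dist (C0 OS) \<psi> \<psi>' \<le> cs_dist (MC0 X) (pull \<psi>) (pull \<psi>')"
  proof (subst C0_dist_le_iff [OF \<psi> \<psi>' MC0_dist_nonneg], rule ballI)
    fix p assume "p \<in> topspace OS"
    then obtain x where x: "x \<in> topspace X" "p = q x" by (auto simp: topspace_OS)
    then have "compactin X {x}" by simp
    then obtain \<kappa> :: "'x \<Rightarrow> real" and L where \<kappa>: "continuous_map X euclideanreal \<kappa>" "\<And>y. 0 \<le> \<kappa> y" "\<And>y. \<kappa> y \<le> 1"
      "\<And>y. y \<in> {x} \<Longrightarrow> \<kappa> y = 1" "compactin X L" "\<And>y. y \<in> topspace X \<Longrightarrow> \<kappa> y \<noteq> 0 \<Longrightarrow> y \<in> L"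
      by (rule Urysohn_Cc [OF locally_compact_X Hausdorff_X]) (rule that)
    let ?a = "restrict (\<lambda>y. complex_of_real (\<kappa> y)) (topspace X)"
    have "continuous_map X euclidean (\<lambda>y. complex_of_real (\<kappa> y))"
      using \<kappa>(1) unfolding continuous_map_euclidean_tendsto by (auto intro: tendsto_of_real)
    then have "?a \<in> Cc X" by (rule Cc_restrictI [OF Hausdorff_X _ \<kappa>(5)]) (use \<kappa>(6) in auto)
    then have a: "?a \<in> cs_carrier (C0 X)" using Cc_subset_C0 by blast
    have an: "cs_norm (C0 X) ?a \<le> 1" using \<kappa>(2,3) by (intro C0_norm_le) auto
    have "cmod (fst (pull \<psi>) ?a x - fst (pull \<psi>') ?a x) \<le> cs_dist (C0 X) (fst (pull \<psi>) ?a) (fst (pull \<psi>') ?a)"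
      by (rule C0_dist_upper [OF DC_C0_closed [OF pull_DC [OF \<psi>] a] DC_C0_closed [OF pull_DC [OF \<psi>'] a] x(1)])
    also have "\<dots> \<le> cs_dist (MC0 X) (pull \<psi>) (pull \<psi>')"
      by (rule MC0_dist_upper [OF pull_DC [OF \<psi>] pull_DC [OF \<psi>'] a an])
    finally show "cmod (\<psi> p - \<psi>' p) \<le> cs_dist (MC0 X) (pull \<psi>) (pull \<psi>')"
      using x \<kappa>(4) by (simp add: pull_apply [OF a])
  qed
qed

lemma pull_norm:
  assumes \<psi>: "\<psi> \<in> cs_carrier (C0 OS)"
  shows "cs_norm (MC0 X) (pull \<psi>) = cs_norm (C0 OS) \<psi>"
proof -
  let ?z = "\<lambda>p\<in>topspace OS. 0 :: complex"
  have z: "?z \<in> cs_carrier (C0 OS)" by (rule C0_zero_closed)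
  have "cs_diff (MC0 X) (pull \<psi>) (pull ?z) = pull (cs_add (C0 OS) \<psi> (cs_scale (C0 OS) (-1) ?z))"
    by (simp only: cs_diff_def pull_operations)
  also have "cs_add (C0 OS) \<psi> (cs_scale (C0 OS) (-1) ?z) = \<psi>"
    unfolding C0_sel by (rule C0_eqI [OF C0_add_closed [OF \<psi> C0_scale_closed [OF z]] \<psi>]) simp
  finally have "cs_norm (MC0 X) (pull \<psi>) = cs_dist (MC0 X) (pull \<psi>) (pull ?z)"
    using pull_DC [OF \<psi>] pull_DC [OF z]
    by (simp add: cs_dist_def multiplier_algebra_sel(1) del: restrict_apply)
  also have "\<dots> = cs_dist (C0 OS) \<psi> ?z" by (rule pull_dist [OF \<psi> z])
  also have "\<dots> = cs_norm (C0 OS) \<psi>"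
    unfolding C0_dist [OF \<psi> z] by (rule C0_norm_cong) simp
  finally show ?thesis .
qed

lemma inj_pull: "inj_on pull (cs_carrier (C0 OS))"
proof (rule inj_onI)
  fix \<psi> \<psi>' assume \<psi>: "\<psi> \<in> cs_carrier (C0 OS)" "\<psi>' \<in> cs_carrier (C0 OS)" and eq: "pull \<psi> = pull \<psi>'"
  interpret C: Metric_space "cs_carrier (C0 OS)" "cs_dist (C0 OS)" by (rule Metric_space_C0)
  interpret M: Metric_space "cs_carrier (MC0 X)" "cs_dist (MC0 X)" by (rule Metric_space_MC0)
  have "cs_dist (C0 OS) \<psi> \<psi>' = cs_dist (MC0 X) (pull \<psi>) (pull \<psi>')" using pull_dist [OF \<psi>] by simp
  also have "\<dots> = 0" unfolding eq using M.zero pull_DC [OF \<psi>(2)] by (simp add: multiplier_algebra_sel(1))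
  finally show "\<psi> = \<psi>'" using C.zero \<psi> by blast
qed

lemma pull_subspace: "cs_subspace (MC0 X) (pull ` cs_carrier (C0 OS))"
proof -
  have A: "star_subalgebra (C0 OS) (cs_carrier (C0 OS))" using cstar_algebra_C0 [of OS] unfolding cstar_algebra_def by (rule conjunct1)
  then have cl: "cs_zero (C0 OS) \<in> cs_carrier (C0 OS)"
    "\<And>\<psi> \<psi>'. \<psi> \<in> cs_carrier (C0 OS) \<Longrightarrow> \<psi>' \<in> cs_carrier (C0 OS) \<Longrightarrow> cs_add (C0 OS) \<psi> \<psi>' \<in> cs_carrier (C0 OS)"
    "\<And>\<psi> k. \<psi> \<in> cs_carrier (C0 OS) \<Longrightarrow> cs_scale (C0 OS) k \<psi> \<in> cs_carrier (C0 OS)"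
    unfolding star_subalgebra_def cs_subspace_def by blast+
  show ?thesis
    unfolding cs_subspace_def
  proof (intro conjI ballI allI)
    show "pull ` cs_carrier (C0 OS) \<subseteq> cs_carrier (MC0 X)" using pull_DC by (auto simp: multiplier_algebra_sel(1))
    show "cs_zero (MC0 X) \<in> pull ` cs_carrier (C0 OS)" unfolding pull_operations(1) using cl(1) by (rule imageI)
    fix d k assume "d \<in> pull ` cs_carrier (C0 OS)"
    then obtain \<psi> where d: "\<psi> \<in> cs_carrier (C0 OS)" "d = pull \<psi>" by blast
    show "cs_scale (MC0 X) k d \<in> pull ` cs_carrier (C0 OS)"
      unfolding d(2) pull_operations(3) by (intro imageI cl d)
    fix e assume "e \<in> pull ` cs_carrier (C0 OS)"
    then obtain \<psi>' where e: "\<psi>' \<in> cs_carrier (C0 OS)" "e = pull \<psi>'" by blast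
    show "cs_add (MC0 X) d e \<in> pull ` cs_carrier (C0 OS)"
      unfolding d(2) e(2) pull_operations(2) by (intro imageI cl d e)
  qed
qed

text \<open>The embedding is isometric and C_0 of the orbit space is complete, so a limit in the
  multiplier algebra of elements of the image is again in the image.\<close>

lemma pull_closed: "closedin (cs_topology (MC0 X)) (pull ` cs_carrier (C0 OS))"
proof -
  interpret C: Metric_space "cs_carrier (C0 OS)" "cs_dist (C0 OS)" by (rule Metric_space_C0)
  interpret M: Metric_space "cs_carrier (MC0 X)" "cs_dist (MC0 X)" by (rule Metric_space_MC0)
  let ?V = "pull ` cs_carrier (C0 OS)"
  have sub: "?V \<subseteq> cs_carrier (MC0 X)" using pull_DC by (auto simp: multiplier_algebra_sel(1))
  have "closedin M.mtopology ?V"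
    unfolding M.metric_closedin_iff_sequentially_closed
  proof (intro conjI allI impI sub)
    fix \<sigma> d assume "range \<sigma> \<subseteq> ?V \<and> limitin M.mtopology \<sigma> d sequentially"
    then have \<sigma>: "\<And>n. \<sigma> n \<in> ?V" and lim: "limitin M.mtopology \<sigma> d sequentially" by blast+
    have "\<forall>n. \<exists>\<psi>. \<psi> \<in> cs_carrier (C0 OS) \<and> \<sigma> n = pull \<psi>" using \<sigma> by blast
    then obtain \<tau> where \<tau>: "\<And>n. \<tau> n \<in> cs_carrier (C0 OS)" "\<And>n. \<sigma> n = pull (\<tau> n)" by metis
    have "M.MCauchy \<sigma>" using M.convergent_imp_MCauchy [OF _ lim] \<sigma> sub by blast
    then have "C.MCauchy \<tau>" using \<tau> pull_dist by (auto simp: M.MCauchy_def C.MCauchy_def)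
    then obtain \<psi> where \<psi>: "limitin C.mtopology \<tau> \<psi> sequentially"
      using mcomplete_C0 [of OS] unfolding C.mcomplete_def by blast
    then have \<psi>C: "\<psi> \<in> cs_carrier (C0 OS)" by (rule C.limitin_mspace)
    have "pull (\<tau> n) \<in> cs_carrier (MC0 X)" "pull \<psi> \<in> cs_carrier (MC0 X)" for n
      using sub \<tau>(1) \<psi>C by blast+
    then have "limitin M.mtopology \<sigma> (pull \<psi>) sequentially"
      using \<psi> \<tau> pull_dist [OF \<tau>(1) \<psi>C] unfolding C.limitin_metric M.limitin_metric by simp
    then have "d = pull \<psi>" using M.limitin_metric_unique [OF lim] by simp
    then show "d \<in> ?V" using \<psi>C by blast
  qed
  then show ?thesis by (simp add: cs_topology_def)
qed

section \<open>Compactly supported functions on the orbit space as inner products\<close>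

definition nonneg_Cc :: "('x \<Rightarrow> complex) set" where
  "nonneg_Cc = {g \<in> Cc X. \<forall>x\<in>topspace X. g x = complex_of_real (Re (g x)) \<and> 0 \<le> Re (g x)}"

text \<open>Here \<open>star_mult g g\<close> is the square of a real function, so nothing cancels
  in its average, which is positive at every \<open>y\<close> with g(y) nonzero; invariance spreads
  this along the orbit.\<close>

lemma Psi_square_nonzero_iff:
  assumes g: "g \<in> nonneg_Cc" and x: "x \<in> topspace X"
  shows "Psi (star_mult g g) x \<noteq> 0 \<longleftrightarrow> (\<exists>y\<in>topspace X. q y = q x \<and> g y \<noteq> 0)"
proof -
  have gC: "g \<in> Cc X" and gR: "\<And>x. x \<in> topspace X \<Longrightarrow> g x = complex_of_real (Re (g x))"
    using g by (auto simp: nonneg_Cc_def)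
  have \<phi>: "star_mult g g \<in> Cc X" using star_mult_Cc gC by blast
  have sq: "star_mult g g x = complex_of_real ((Re (g x))\<^sup>2) \<and> 0 \<le> (Re (g x))\<^sup>2" if "x \<in> topspace X" for x
    using gR [OF that] that
    by (simp add: star_mult_def power2_eq_square) (metis complex_cnj_complex_of_real of_real_mult)
  show ?thesis
  proof
    assume "Psi (star_mult g g) x \<noteq> 0"
    then obtain \<gamma> where \<gamma>: "\<gamma> \<in> carr" "r \<gamma> = rX x" "star_mult g g (act (iv \<gamma>) x) \<noteq> 0"
      using Psi_nonzero_orbit [OF x] by blast
    let ?y = "act (iv \<gamma>) x"
    have y: "?y \<in> topspace X" "q ?y = q x" using \<gamma> x by (simp_all add: orbit_act)
    moreover have "g ?y \<noteq> 0" using \<gamma>(3) y(1) by (auto simp: star_mult_def)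
    ultimately show "\<exists>y\<in>topspace X. q y = q x \<and> g y \<noteq> 0" by blast
  next
    assume "\<exists>y\<in>topspace X. q y = q x \<and> g y \<noteq> 0"
    then obtain y where y: "y \<in> topspace X" "q y = q x" "g y \<noteq> 0" by blast
    then have "0 < (Re (g y))\<^sup>2" using gR [OF y(1)] by (metis of_real_0 zero_less_power2)
    then have "Psi (star_mult g g) y \<noteq> 0" using Psi_nonneg_pos(3) [OF \<phi> sq y(1)] by force
    moreover obtain \<gamma> where "\<gamma> \<in> carr" "s \<gamma> = rX y" "x = act \<gamma> y" using orbit_eqD [OF x y(2)] .
    ultimately show "Psi (star_mult g g) x \<noteq> 0" using Psi_invariant [OF \<phi> y(1)] by metis
  qed
qed

lemma nonneg_Cc_point:
  assumes x: "x \<in> topspace X"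
  shows "\<exists>g\<in>nonneg_Cc. g x \<noteq> 0"
proof -
  have "compactin X {x}" using x by simp
  then obtain \<kappa> :: "'x \<Rightarrow> real" and L where \<kappa>: "continuous_map X euclideanreal \<kappa>" "\<And>y. 0 \<le> \<kappa> y" "\<And>y. \<kappa> y \<le> 1"
    "\<And>y. y \<in> {x} \<Longrightarrow> \<kappa> y = 1" "compactin X L" "\<And>y. y \<in> topspace X \<Longrightarrow> \<kappa> y \<noteq> 0 \<Longrightarrow> y \<in> L"
    by (rule Urysohn_Cc [OF locally_compact_X Hausdorff_X]) (rule that)
  have "continuous_map X euclidean (\<lambda>y. complex_of_real (\<kappa> y))"
    using \<kappa>(1) unfolding continuous_map_euclidean_tendsto by (auto intro: tendsto_of_real)
  then have "restrict (\<lambda>y. complex_of_real (\<kappa> y)) (topspace X) \<in> Cc X"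
    by (rule Cc_restrictI [OF Hausdorff_X _ \<kappa>(5)]) (use \<kappa>(6) in auto)
  then show ?thesis using \<kappa>(2,4) x
    by (intro bexI [of _ "restrict (\<lambda>y. complex_of_real (\<kappa> y)) (topspace X)"]) (auto simp: nonneg_Cc_def)
qed

text \<open>The sum of the family works, because nonnegative functions cannot cancel.\<close>

lemma nonneg_Cc_finite:
  assumes "finite D" "D \<subseteq> nonneg_Cc"
  shows "\<exists>g\<in>nonneg_Cc. \<forall>x\<in>topspace X. (\<exists>h\<in>D. h x \<noteq> 0) \<longrightarrow> g x \<noteq> 0"
  using assms
proof (induction D rule: finite_induct)
  case empty
  have "(\<lambda>x\<in>topspace X. 0) \<in> Cc X"
    using star_subalgebra_Cc [OF Hausdorff_X] by (simp add: star_subalgebra_def cs_subspace_def)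
  then show ?case by (auto simp: nonneg_Cc_def)
next
  case (insert h D)
  then obtain g where g: "g \<in> nonneg_Cc" "\<And>x. x \<in> topspace X \<Longrightarrow> \<exists>h\<in>D. h x \<noteq> 0 \<Longrightarrow> g x \<noteq> 0"
    by blast
  have h: "h \<in> nonneg_Cc" using insert.prems by blast
  have re: "g x = complex_of_real (Re (g x))" "0 \<le> Re (g x)" "h x = complex_of_real (Re (h x))" "0 \<le> Re (h x)"
    if "x \<in> topspace X" for x using that g(1) h by (auto simp: nonneg_Cc_def)
  let ?k = "\<lambda>x\<in>topspace X. h x + g x"
  have "cs_add (C0 X) h g \<in> Cc X"
    using g(1) h star_subalgebra_Cc [OF Hausdorff_X]
    unfolding star_subalgebra_def cs_subspace_def nonneg_Cc_def by blast
  then have "?k \<in> Cc X" by simp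
  then have "?k \<in> nonneg_Cc" using re by (auto simp: nonneg_Cc_def)
  moreover have "?k x \<noteq> 0" if x: "x \<in> topspace X" and n: "h x \<noteq> 0 \<or> g x \<noteq> 0" for x
  proof -
    have "Re (h x) \<noteq> 0 \<or> Re (g x) \<noteq> 0" using n re [OF x] by (metis of_real_0)
    then have "0 < Re (?k x)" using re [OF x] x by auto
    then show ?thesis by auto
  qed
  ultimately show ?case using g(2) by (intro bexI [of _ ?k]) auto
qed

text \<open>The sets where the descended average is nonzero are open, so finitely many pointwise
  choices of \<open>g\<close> serve all of \<open>K\<close>; by \<open>nonneg_Cc_finite\<close> they
  combine into a single function.\<close>

lemma nonneg_Cc_compact:
  assumes K: "compactin OS K"
  shows "\<exists>g\<in>nonneg_Cc. \<forall>x\<in>topspace X. q x \<in> K \<longrightarrow> Psi (star_mult g g) x \<noteq> 0"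
proof -
  let ?U = "\<lambda>g. {p \<in> topspace OS. descend (Psi (star_mult g g)) p \<in> - {0}}"
  have gg: "star_mult g g \<in> Cc X" if "g \<in> nonneg_Cc" for g
    using star_mult_Cc that by (auto simp: nonneg_Cc_def)
  have U: "openin OS (?U g)" if "g \<in> nonneg_Cc" for g
    by (rule openin_continuous_map_preimage [OF C0_continuous [OF descend_Psi_C0 [OF gg [OF that]]]])
       (simp add: open_Compl)
  have mem: "q x \<in> ?U g \<longleftrightarrow> Psi (star_mult g g) x \<noteq> 0" if "g \<in> nonneg_Cc" "x \<in> topspace X" for g x
    using descend_q [OF invariant_Psi [OF gg [OF that(1)]] that(2)] q_OS [OF that(2)] by simp
  have "K \<subseteq> \<Union>(?U ` nonneg_Cc)"
  proof
    fix p assume "p \<in> K"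
    then obtain x where x: "x \<in> topspace X" "p = q x"
      using compactin_subset_topspace [OF K] by (auto simp: topspace_OS)
    obtain g where g: "g \<in> nonneg_Cc" "g x \<noteq> 0" using nonneg_Cc_point [OF x(1)] by blast
    then have "p \<in> ?U g" using mem [OF g(1) x(1)] Psi_square_nonzero_iff [OF g(1) x(1)] x by blast
    then show "p \<in> \<Union>(?U ` nonneg_Cc)" using g(1) by blast
  qed
  then obtain \<F> where \<F>: "finite \<F>" "\<F> \<subseteq> ?U ` nonneg_Cc" "K \<subseteq> \<Union>\<F>"
    using compactinD [OF K, of "?U ` nonneg_Cc"] U by blast
  obtain D where D: "finite D" "D \<subseteq> nonneg_Cc" "\<F> = ?U ` D" using finite_subset_image [OF \<F>(1,2)] by blast
  obtain g where g: "g \<in> nonneg_Cc" "\<And>x. x \<in> topspace X \<Longrightarrow> \<exists>h\<in>D. h x \<noteq> 0 \<Longrightarrow> g x \<noteq> 0"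
    using nonneg_Cc_finite [OF D(1,2)] by blast
  have "Psi (star_mult g g) x \<noteq> 0" if x: "x \<in> topspace X" "q x \<in> K" for x
  proof -
    obtain h where h: "h \<in> D" "q x \<in> ?U h" using x(2) \<F>(3) D(3) by blast
    then have "h \<in> nonneg_Cc" using D(2) by blast
    then obtain y where "y \<in> topspace X" "q y = q x" "h y \<noteq> 0"
      using mem [of h x] Psi_square_nonzero_iff [of h x] h(2) x(1) by blast
    then show ?thesis using Psi_square_nonzero_iff [OF g(1) x(1)] g(2) h(1) by blast
  qed
  then show ?thesis using g(1) by blast
qed

text \<open>Dividing by \<open>\<Psi>(g\<^sup>2)\<close>, an invariant function, shows that every compactly supported function on the
  orbit space is itself an inner product.\<close>

lemma D_inner_surjective:
  assumes \<psi>: "\<psi> \<in> cs_carrier (C0 OS)" and K: "compactin OS K" "closedin OS K"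
    and supp: "\<And>p. p \<in> topspace OS \<Longrightarrow> \<psi> p \<noteq> 0 \<Longrightarrow> p \<in> K"
  shows "\<exists>a\<in>Cc X. \<exists>b\<in>Cc X. D_inner G lam Sys (Cc X) a b = pull \<psi>"
proof -
  obtain g where g: "g \<in> nonneg_Cc" "\<And>x. x \<in> topspace X \<Longrightarrow> q x \<in> K \<Longrightarrow> Psi (star_mult g g) x \<noteq> 0"
    using nonneg_Cc_compact [OF K(1)] by blast
  have gC: "g \<in> Cc X" using g(1) by (simp add: nonneg_Cc_def)
  have gg: "star_mult g g \<in> Cc X" using star_mult_Cc gC by blast
  define w where "w x = \<psi> (q x) / Psi (star_mult g g) x" for x
  have \<psi>q: "continuous_map X euclidean (\<lambda>x. \<psi> (q x))"
    using continuous_map_compose [OF continuous_q C0_continuous [OF \<psi>]] by (simp add: o_def)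
  have w: "continuous_map X euclidean w"
    unfolding continuous_map_euclidean_tendsto
  proof
    fix x assume x: "x \<in> topspace X"
    show "(w \<longlongrightarrow> w x) (atin X x)"
    proof (cases "q x \<in> K")
      case True
      then show ?thesis
        using \<psi>q continuous_Psi [OF gg] g(2) [OF x] x unfolding w_def continuous_map_euclidean_tendsto
        by (intro tendsto_divide) auto
    next
      case False
      \<comment> \<open>Off \<open>K\<close> the denominator may vanish, but \<psi> is zero there
        and 0 / 0 is 0; as \<open>K\<close> is closed, \<open>w\<close> is zero on a whole
        neighbourhood of \<open>x\<close>.\<close>
      have "openin X {x \<in> topspace X. q x \<in> topspace OS - K}"
        using K(2) by (intro openin_continuous_map_preimage [OF continuous_q]) auto
      moreover have "w y = 0" if "y \<in> topspace X" "q y \<notin> K" for y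
        using supp [OF q_OS [OF that(1)]] that(2) by (auto simp: w_def)
      ultimately have "\<forall>\<^sub>F y in atin X x. w y = w x"
        unfolding eventually_atin using x False q_OS [OF x]
        by (intro disjI2 exI [of _ "{x \<in> topspace X. q x \<in> topspace OS - K}"]) auto
      then show ?thesis by (rule tendsto_eventually)
    qed
  qed
  obtain L where L: "compactin X L" "\<And>x. x \<in> topspace X \<Longrightarrow> g x \<noteq> 0 \<Longrightarrow> x \<in> L"
    using gC by (rule Cc_supp) blast
  \<comment> \<open>\<open>w\<close> is constant on orbits and need not have compact support; the
    factor \<open>g\<close> supplies it. The second factor \<open>g\<close> comes from the first
    argument of the inner product, which accounts for the square in the denominator of
    \<open>w\<close>.\<close>
  let ?b = "restrict (\<lambda>x. w x * g x) (topspace X)"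
  have b: "?b \<in> Cc X"
    by (rule Cc_restrictI [OF Hausdorff_X continuous_map_mult [OF w Cc_continuous [OF gC]] L(1)]) (use L(2) in auto)
  have Psi_b: "Psi (star_mult g ?b) x = \<psi> (q x)" if x: "x \<in> topspace X" for x
  proof -
    have "star_mult g ?b (act (iv \<gamma>) x) = w x * star_mult g g (act (iv \<gamma>) x)"
      if "\<gamma> \<in> range_fibre G (rX x)" for \<gamma>
    proof -
      let ?y = "act (iv \<gamma>) x"
      have \<gamma>: "iv \<gamma> \<in> carr" "s (iv \<gamma>) = rX x" using that by (auto simp: range_fibre_def)
      have "w ?y = w x"
        unfolding w_def using orbit_act [OF \<gamma> x] Psi_invariant [OF gg x \<gamma>] by simp
      moreover have "?y \<in> topspace X" using \<gamma> x by simp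
      ultimately show ?thesis by (simp add: star_mult_def)
    qed
    then have "Psi (star_mult g ?b) x = (LINT \<gamma>:range_fibre G (rX x)|lam (rX x). w x * star_mult g g (act (iv \<gamma>) x))"
      unfolding Psi_def using range_fibre_sets x by (intro set_lebesgue_integral_cong) auto
    also have "\<dots> = w x * Psi (star_mult g g) x" by (simp add: Psi_def)
    also have "\<dots> = \<psi> (q x)"
      using g(2) [OF x] supp [OF q_OS [OF x]] by (auto simp: w_def)
    finally show ?thesis .
  qed
  have "D_inner G lam Sys (Cc X) g ?b = multiplier X (Psi (star_mult g ?b))"
    by (rule D_inner_eq [OF gC b])
  also have "\<dots> = pull \<psi>"
    using Psi_b by (auto simp: pull_def multiplier_def mult_op_def cong: restrict_cong)
  finally show ?thesis using gC b by blast
qed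

section \<open>Identification of the generalized fixed point algebra\<close>

lemma D_inner_pull:
  assumes "a \<in> Cc X" "b \<in> Cc X"
  shows "D_inner G lam Sys (Cc X) a b \<in> pull ` cs_carrier (C0 OS)"
proof -
  have \<phi>: "star_mult a b \<in> Cc X" using star_mult_Cc [OF assms] .
  have "multiplier X (Psi (star_mult a b)) = pull (descend (Psi (star_mult a b)))"
    using descend_q [OF invariant_Psi [OF \<phi>]] by (auto simp: pull_def multiplier_def mult_op_def cong: restrict_cong)
  then show ?thesis using D_inner_eq [OF assms] descend_Psi_C0 [OF \<phi>] by auto
qed

text \<open>The image of C_0 of the orbit space is a closed subspace containing all inner products,
  hence also their closed span. Conversely, \<open>C0_threshold\<close> replaces a function by a
  nearby one whose nonzero values lie on a closed compact set, and such a function is an inner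
  product by \<open>D_inner_surjective\<close>.\<close>

lemma fixed_point_carrier:
  "cs_topology (MC0 X) closure_of (cs_subspace (MC0 X) hull {D_inner G lam Sys (Cc X) a b | a b. a \<in> Cc X \<and> b \<in> Cc X}) =
    pull ` cs_carrier (C0 OS)" (is "_ closure_of (_ hull ?D) = ?V")
proof
  interpret M: Metric_space "cs_carrier (MC0 X)" "cs_dist (MC0 X)" by (rule Metric_space_MC0)
  have "?D \<subseteq> ?V" using D_inner_pull by blast
  then have "cs_subspace (MC0 X) hull ?D \<subseteq> ?V" using pull_subspace by (rule hull_minimal)
  then show "cs_topology (MC0 X) closure_of (cs_subspace (MC0 X) hull ?D) \<subseteq> ?V"
    using pull_closed by (rule closure_of_minimal)
  have "?V \<subseteq> cs_topology (MC0 X) closure_of ?D"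
    unfolding cs_topology_def M.metric_closure_of
  proof (intro subsetI CollectI conjI allI impI)
    fix d assume "d \<in> ?V"
    then obtain \<psi> where \<psi>: "\<psi> \<in> cs_carrier (C0 OS)" "d = pull \<psi>" by blast
    show dM: "d \<in> cs_carrier (MC0 X)" using pull_DC [OF \<psi>(1)] \<psi>(2) by (simp add: multiplier_algebra_sel(1))
    fix t :: real assume t: "0 < t"
    then have t2: "0 < t/2" by simp
    obtain \<psi>' where \<psi>': "\<psi>' \<in> cs_carrier (C0 OS)" "\<And>p. p \<in> topspace OS \<Longrightarrow> cmod (\<psi>' p - \<psi> p) \<le> t/2"
      "\<And>p. p \<in> topspace OS \<Longrightarrow> \<psi>' p \<noteq> 0 \<Longrightarrow> t/2 \<le> cmod (\<psi> p)"
      by (rule C0_threshold [OF \<psi>(1) t2]) (rule that)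
    let ?K = "{p \<in> topspace OS. t/2 \<le> cmod (\<psi> p)}"
    have "\<exists>a\<in>Cc X. \<exists>b\<in>Cc X. D_inner G lam Sys (Cc X) a b = pull \<psi>'"
    proof (rule D_inner_surjective [OF \<psi>'(1)])
      show "compactin OS ?K" by (rule C0_compactin [OF \<psi>(1) t2])
      show "closedin OS ?K" by (rule closedin_continuous_cmod_ge [OF C0_continuous [OF \<psi>(1)]])
    qed (use \<psi>'(3) in blast)
    then have D: "pull \<psi>' \<in> ?D" by force
    have "cs_dist (MC0 X) d (pull \<psi>') \<le> t/2"
      unfolding \<psi>(2) pull_dist [OF \<psi>(1) \<psi>'(1)] using \<psi>'(2) t
      by (subst C0_dist_le_iff [OF \<psi>(1) \<psi>'(1)]) (auto simp: norm_minus_commute)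
    then have less: "cs_dist (MC0 X) d (pull \<psi>') < t" using t by linarith
    have "pull \<psi>' \<in> cs_carrier (MC0 X)" using pull_DC [OF \<psi>'(1)] by (simp add: multiplier_algebra_sel(1))
    then have "pull \<psi>' \<in> M.mball d t" unfolding M.in_mball using dM less by blast
    with D show "\<exists>y\<in>?D. y \<in> M.mball d t" by blast
  qed
  also have "\<dots> \<subseteq> cs_topology (MC0 X) closure_of (cs_subspace (MC0 X) hull ?D)"
    by (intro closure_of_mono hull_subset)
  finally show "?V \<subseteq> cs_topology (MC0 X) closure_of (cs_subspace (MC0 X) hull ?D)" .
qed

text \<open>The isomorphism is the inverse of the embedding \<open>pull\<close>; that the fixed
  point algebra is a C*-algebra in the first place is transported along \<open>pull\<close>
  itself.\<close>

theorem fixed_point_algebra_isomorphic: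
  "cstar_isomorphic (generalized_fixed_point_algebra G lam Sys (Cc X)) (C0 OS)"
proof -
  let ?A = "generalized_fixed_point_algebra G lam Sys (Cc X)"
  have A: "?A = (MC0 X) \<lparr> cs_carrier := pull ` cs_carrier (C0 OS) \<rparr>"
    unfolding generalized_fixed_point_algebra_def C0_system_sel Let_def fixed_point_carrier ..
  have sel: "cs_carrier ?A = pull ` cs_carrier (C0 OS)" "cs_zero ?A = cs_zero (MC0 X)" "cs_add ?A = cs_add (MC0 X)"
    "cs_scale ?A = cs_scale (MC0 X)" "cs_mult ?A = cs_mult (MC0 X)" "cs_star ?A = cs_star (MC0 X)"
    "cs_norm ?A = cs_norm (MC0 X)"
    unfolding A by simp_all
  have bij: "bij_betw pull (cs_carrier (C0 OS)) (cs_carrier ?A)"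
    unfolding sel(1) bij_betw_def using inj_pull by blast
  have "cstar_algebra ?A"
    by (rule cstar_algebra_transfer [OF cstar_algebra_C0 Metric_space_C0 bij])
       (simp_all only: sel pull_operations pull_norm)
  moreover have "star_isomorphism ?A (C0 OS) (inv_into (cs_carrier (C0 OS)) pull)" (is "star_isomorphism _ _ ?h")
  proof -
    have h: "?h (pull \<psi>) = \<psi>" if "\<psi> \<in> cs_carrier (C0 OS)" for \<psi>
      using inv_into_f_f [OF inj_pull that] .
    have cl: "star_subalgebra (C0 OS) (cs_carrier (C0 OS))" using cstar_algebra_C0 [of OS] unfolding cstar_algebra_def by (rule conjunct1)
    show ?thesis
      unfolding star_isomorphism_def
    proof (intro conjI ballI allI)
      show "bij_betw ?h (cs_carrier ?A) (cs_carrier (C0 OS))" by (rule bij_betw_inv_into [OF bij])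
      fix d assume "d \<in> cs_carrier ?A"
      then obtain \<psi> where \<psi>: "\<psi> \<in> cs_carrier (C0 OS)" "d = pull \<psi>" unfolding sel by blast
      have "cs_scale (C0 OS) k \<psi> \<in> cs_carrier (C0 OS)" "cs_star (C0 OS) \<psi> \<in> cs_carrier (C0 OS)" for k
        using cl \<psi>(1) unfolding star_subalgebra_def cs_subspace_def by blast+
      then show "?h (cs_scale ?A k d) = cs_scale (C0 OS) k (?h d)" "?h (cs_star ?A d) = cs_star (C0 OS) (?h d)" for k
        using \<psi> by (simp_all only: sel pull_operations h)
      fix e assume "e \<in> cs_carrier ?A"
      then obtain \<psi>' where \<psi>': "\<psi>' \<in> cs_carrier (C0 OS)" "e = pull \<psi>'" unfolding sel by blast
      have "cs_add (C0 OS) \<psi> \<psi>' \<in> cs_carrier (C0 OS)" "cs_mult (C0 OS) \<psi> \<psi>' \<in> cs_carrier (C0 OS)"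
        using cl \<psi>(1) \<psi>'(1) unfolding star_subalgebra_def cs_subspace_def by blast+
      then show "?h (cs_add ?A d e) = cs_add (C0 OS) (?h d) (?h e)" "?h (cs_mult ?A d e) = cs_mult (C0 OS) (?h d) (?h e)"
        using \<psi> \<psi>' by (simp_all only: sel pull_operations h)
    qed
  qed
  ultimately show ?thesis unfolding cstar_isomorphic_def using cstar_algebra_C0 by blast
qed

end

theorem proposition4p1:
  fixes G :: "'g groupoid" and lam :: "'g \<Rightarrow> 'g measure"
    and X :: "'x topology" and rX :: "'x \<Rightarrow> 'g" and act :: "'g \<Rightarrow> 'x \<Rightarrow> 'x"
  assumes "topological_groupoid G"
    and "second_countable (g_top G)" and "locally_compact_space (g_top G)"
    and "Hausdorff_space (g_top G)"
    and "haar_system G lam"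
    and "locally_compact_space X" and "Hausdorff_space X"
    and "separable_space (cs_topology (C0 X))"
    and "proper_action G X rX act"
  shows "proper_groupoid_dynamical_system_usc G lam (C0_system G X rX act) (Cc X) \<and>
    (open_map X (unit_space G) rX \<longrightarrow>
       proper_groupoid_dynamical_system G lam (C0_system G X rX act) (Cc X)) \<and>
    cstar_isomorphic (generalized_fixed_point_algebra G lam (C0_system G X rX act) (Cc X))
      (C0 (orbit_space G X rX act))"
proof -
  interpret groupoid_space G lam X rX act
    by standard (fact assms)+
  show ?thesis
    unfolding proper_groupoid_dynamical_system_def proper_groupoid_dynamical_system_usc_def
    using proper_system_with_C0 [OF assms(8)] inner_norm_L_I_usc inner_norm_L_I fixed_point_algebra_isomorphic
    by blast
qed

end
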